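(* Let $\mathcal{B}$ be a Serre subcategory of an abelian category $\mathcal{A}$, let $q\colon\mathcal{A}\to\mathcal{C}:=\mathcal{A}/\mathcal{B}$ be the quotient functor, and let $\mathcal{E}\subset\mathcal{A}$ be the full subcategory of $\mathcal{B}$-closed objects. Consider a torsion pair $(\mathcal{T},\mathcal{F})$ in $\mathcal{A}$ and a full subcategory $\mathcal{G}\subset\mathcal{F}\cap\mathcal{E}$. Assume that $\mathcal{F}$ satisfies the embedding condition with respect to $\mathcal{G}$. Then $(q(\mathcal{T}),\mathcal{G})$ is a torsion pair in $\mathcal{C}$.
   Context: The full subcategory of $\mathcal{B}$-closed objects is $\mathcal{E}=\{A\in\mathcal{A}\mid\operatorname{Hom}(B,A)=0=\operatorname{Ext}^1(B,A)\ \text{for all } B\in\mathcal{B}\}$. The quotient functor $q$ is fully faithful on $\mathcal{E}$, so $\mathcal{G}\subset\mathcal{E}$ is regarded as a full subcategory of $\mathcal{C}$, identified with its essential image $q(\mathcal{G})$. For a full subcategory $\mathcal{H}\subset\mathcal{A}$, $q(\mathcal{H})\subset\mathcal{C}$ denotes the essential image, i.e. the full subcategory of objects isomorphic in $\mathcal{C}$ to $q(H)$ for some $H\in\mathcal{H}$. A torsion pair $(\mathcal{T},\mathcal{F})$ in an abelian category is a pair of full subcategories with $\operatorname{Hom}(\mathcal{T},\mathcal{F})=0$ such that every object $A$ fits into a short exact sequence $0\to T\to A\to F\to0$ with $T\in\mathcal{T}$, $F\in\mathcal{F}$. $\mathcal{F}\subset\mathcal{A}$ satisfies the embedding condition with respect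 to $\mathcal{G}\subset\mathcal{E}$ if for every $F\in\mathcal{F}$ there exist $G\in\mathcal{G}$, $B\in\mathcal{B}$ and a short exact sequence $0\to F\to G\to B\to 0$ in $\mathcal{A}$. *)

theory Defs
  imports "HOL-Algebra.Group"
begin

section \<open>Categories\<close>

record ('o, 'a) cat =
  Obj :: "'o set"
  Arr :: "'a set"
  Dom :: "'a \<Rightarrow> 'o"
  Cod :: "'a \<Rightarrow> 'o"
  Id :: "'o \<Rightarrow> 'a"
  Comp :: "'a \<Rightarrow> 'a \<Rightarrow> 'a"  (infixl "\<cdot>\<index>" 70)

definition Hom :: "('o, 'a) cat \<Rightarrow> 'o \<Rightarrow> 'o \<Rightarrow> 'a set" where
  "Hom C X Y = {f \<in> Arr C. Dom C f = X \<and> Cod C f = Y}"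

locale category =
  fixes C :: "('o, 'a) cat" (structure)
  assumes Dom_in_Obj: "f \<in> Arr C \<Longrightarrow> Dom C f \<in> Obj C"
    and Cod_in_Obj: "f \<in> Arr C \<Longrightarrow> Cod C f \<in> Obj C"
    and Id_in_Hom: "X \<in> Obj C \<Longrightarrow> Id C X \<in> Hom C X X"
    and Comp_in_Hom: "f \<in> Hom C X Y \<Longrightarrow> g \<in> Hom C Y Z \<Longrightarrow> g \<cdot> f \<in> Hom C X Z"
    and Comp_Id_right: "f \<in> Hom C X Y \<Longrightarrow> f \<cdot> Id C X = f"
    and Comp_Id_left: "f \<in> Hom C X Y \<Longrightarrow> Id C Y \<cdot> f = f"
    and Comp_assoc: "f \<in> Hom C W X \<Longrightarrow> g \<in> Hom C X Y \<Longrightarrow> h \<in> Hom C Y Z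
                      \<Longrightarrow> (h \<cdot> g) \<cdot> f = h \<cdot> (g \<cdot> f)"

definition isomorphism :: "('o, 'a) cat \<Rightarrow> 'a \<Rightarrow> bool" where
  "isomorphism C f \<longleftrightarrow> f \<in> Arr C \<and>
     (\<exists>g \<in> Hom C (Cod C f) (Dom C f).
        g \<cdot>\<^bsub>C\<^esub> f = Id C (Dom C f) \<and> f \<cdot>\<^bsub>C\<^esub> g = Id C (Cod C f))"

definition isomorphic :: "('o, 'a) cat \<Rightarrow> 'o \<Rightarrow> 'o \<Rightarrow> bool" where
  "isomorphic C X Y \<longleftrightarrow> (\<exists>f \<in> Hom C X Y. isomorphism C f)"

definition monic :: "('o, 'a) cat \<Rightarrow> 'a \<Rightarrow> bool" where
  "monic C f \<longleftrightarrow> f \<in> Arr C \<and>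
     (\<forall>W. \<forall>g \<in> Hom C W (Dom C f). \<forall>h \<in> Hom C W (Dom C f).
        f \<cdot>\<^bsub>C\<^esub> g = f \<cdot>\<^bsub>C\<^esub> h \<longrightarrow> g = h)"

definition epic :: "('o, 'a) cat \<Rightarrow> 'a \<Rightarrow> bool" where
  "epic C f \<longleftrightarrow> f \<in> Arr C \<and>
     (\<forall>W. \<forall>g \<in> Hom C (Cod C f) W. \<forall>h \<in> Hom C (Cod C f) W.
        g \<cdot>\<^bsub>C\<^esub> f = h \<cdot>\<^bsub>C\<^esub> f \<longrightarrow> g = h)"

definition zero_object :: "('o, 'a) cat \<Rightarrow> 'o \<Rightarrow> bool" where
  "zero_object C Z \<longleftrightarrow> Z \<in> Obj C \<and>
     (\<forall>X \<in> Obj C. (\<exists>!f. f \<in> Hom C X Z) \<and> (\<exists>!f. f \<in> Hom C Z X))"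

definition zero_arr :: "('o, 'a) cat \<Rightarrow> 'a \<Rightarrow> bool" where
  "zero_arr C f \<longleftrightarrow> f \<in> Arr C \<and>
     (\<exists>Z. zero_object C Z \<and>
        (\<exists>g \<in> Hom C (Dom C f) Z. \<exists>h \<in> Hom C Z (Cod C f). f = h \<cdot>\<^bsub>C\<^esub> g))"

definition Hom_vanishes :: "('o, 'a) cat \<Rightarrow> 'o \<Rightarrow> 'o \<Rightarrow> bool" where
  "Hom_vanishes C X Y \<longleftrightarrow> (\<forall>f \<in> Hom C X Y. zero_arr C f)"

definition is_kernel :: "('o, 'a) cat \<Rightarrow> 'a \<Rightarrow> 'a \<Rightarrow> bool" where
  "is_kernel C f k \<longleftrightarrow> f \<in> Arr C \<and> k \<in> Arr C \<and> Cod C k = Dom C f \<and> zero_arr C (f \<cdot>\<^bsub>C\<^esub> k) \<and>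
     (\<forall>g \<in> Arr C. Cod C g = Dom C f \<and> zero_arr C (f \<cdot>\<^bsub>C\<^esub> g) \<longrightarrow>
        (\<exists>!u. u \<in> Hom C (Dom C g) (Dom C k) \<and> k \<cdot>\<^bsub>C\<^esub> u = g))"

definition is_cokernel :: "('o, 'a) cat \<Rightarrow> 'a \<Rightarrow> 'a \<Rightarrow> bool" where
  "is_cokernel C f c \<longleftrightarrow> f \<in> Arr C \<and> c \<in> Arr C \<and> Dom C c = Cod C f \<and> zero_arr C (c \<cdot>\<^bsub>C\<^esub> f) \<and>
     (\<forall>g \<in> Arr C. Dom C g = Cod C f \<and> zero_arr C (g \<cdot>\<^bsub>C\<^esub> f) \<longrightarrow>
        (\<exists>!u. u \<in> Hom C (Cod C c) (Cod C g) \<and> u \<cdot>\<^bsub>C\<^esub> c = g))"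

section \<open>Abelian categories\<close>

locale preadditive_category = category C for C :: "('o, 'a) cat" (structure) +
  fixes add :: "'a \<Rightarrow> 'a \<Rightarrow> 'a"
  assumes Hom_comm_group: "X \<in> Obj C \<Longrightarrow> Y \<in> Obj C \<Longrightarrow>
      \<exists>z. comm_group \<lparr>carrier = Hom C X Y, monoid.mult = add, one = z\<rparr>"
    and Comp_add_right: "f \<in> Hom C X Y \<Longrightarrow> g \<in> Hom C X Y \<Longrightarrow> h \<in> Hom C Y Z \<Longrightarrow>
      h \<cdot> add f g = add (h \<cdot> f) (h \<cdot> g)"
    and Comp_add_left: "f \<in> Hom C X Y \<Longrightarrow> g \<in> Hom C Y Z \<Longrightarrow> h \<in> Hom C Y Z \<Longrightarrow>
      add g h \<cdot> f = add (g \<cdot> f) (h \<cdot> f)"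

locale abelian_category = preadditive_category +
  assumes ex_zero_object: "\<exists>Z. zero_object C Z"
    and ex_biproduct: "X \<in> Obj C \<Longrightarrow> Y \<in> Obj C \<Longrightarrow>
      \<exists>P. \<exists>i \<in> Hom C X P. \<exists>j \<in> Hom C Y P. \<exists>p \<in> Hom C P X. \<exists>q \<in> Hom C P Y.
        p \<cdot> i = Id C X \<and> q \<cdot> j = Id C Y \<and> add (i \<cdot> p) (j \<cdot> q) = Id C P"
    and ex_kernel: "f \<in> Arr C \<Longrightarrow> \<exists>k. is_kernel C f k"
    and ex_cokernel: "f \<in> Arr C \<Longrightarrow> \<exists>c. is_cokernel C f c"
    and monic_is_kernel: "monic C k \<Longrightarrow> \<exists>f. is_kernel C f k"
    and epic_is_cokernel: "epic C c \<Longrightarrow> \<exists>f. is_cokernel C f c"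

text \<open>\<open>short_exact C X i Y p Z\<close>: the sequence \<open>0 \<rightarrow> X \<rightarrow> Y \<rightarrow> Z \<rightarrow> 0\<close> with maps \<open>i\<close>, \<open>p\<close> is exact.\<close>

definition short_exact :: "('o, 'a) cat \<Rightarrow> 'o \<Rightarrow> 'a \<Rightarrow> 'o \<Rightarrow> 'a \<Rightarrow> 'o \<Rightarrow> bool" where
  "short_exact C X i Y p Z \<longleftrightarrow>
     i \<in> Hom C X Y \<and> p \<in> Hom C Y Z \<and> is_kernel C p i \<and> is_cokernel C i p"

section \<open>Yoneda extensions\<close>

definition extensions :: "('o, 'a) cat \<Rightarrow> 'o \<Rightarrow> 'o \<Rightarrow> ('a \<times> 'o \<times> 'a) set" where
  "extensions C X Y = {(i, E, p). short_exact C Y i E p X}"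

definition extension_equiv ::
    "('o, 'a) cat \<Rightarrow> 'o \<Rightarrow> 'o \<Rightarrow> (('a \<times> 'o \<times> 'a) \<times> ('a \<times> 'o \<times> 'a)) set" where
  "extension_equiv C X Y =
     {((i, E, p), (i', E', p')). (i, E, p) \<in> extensions C X Y \<and> (i', E', p') \<in> extensions C X Y \<and>
        (\<exists>h \<in> Hom C E E'. isomorphism C h \<and> h \<cdot>\<^bsub>C\<^esub> i = i' \<and> p' \<cdot>\<^bsub>C\<^esub> h = p)}"

definition Ext1 :: "('o, 'a) cat \<Rightarrow> 'o \<Rightarrow> 'o \<Rightarrow> ('a \<times> 'o \<times> 'a) set set" where
  "Ext1 C X Y = extensions C X Y // extension_equiv C X Y"

text \<open>Only the vanishing of \<open>Ext1\<close> is used, so its Baer sum is not introduced: the group is zero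
  iff its underlying set has exactly one element.\<close>

definition Ext1_vanishes :: "('o, 'a) cat \<Rightarrow> 'o \<Rightarrow> 'o \<Rightarrow> bool" where
  "Ext1_vanishes C X Y \<longleftrightarrow> is_singleton (Ext1 C X Y)"

section \<open>Subcategories\<close>

text \<open>A full subcategory is given by its set of objects, which need not be closed under
  isomorphism.\<close>

definition full_subcategory :: "('o, 'a) cat \<Rightarrow> 'o set \<Rightarrow> bool" where
  "full_subcategory C \<H> \<longleftrightarrow> \<H> \<subseteq> Obj C"

definition serre_subcategory :: "('o, 'a) cat \<Rightarrow> 'o set \<Rightarrow> bool" where
  "serre_subcategory C \<B> \<longleftrightarrow> full_subcategory C \<B> \<and> \<B> \<noteq> {} \<and>
     (\<forall>X i Y p Z. short_exact C X i Y p Z \<longrightarrow> (Y \<in> \<B> \<longleftrightarrow> X \<in> \<B> \<and> Z \<in> \<B>))"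

definition closed_objects :: "('o, 'a) cat \<Rightarrow> 'o set \<Rightarrow> 'o set" where
  "closed_objects C \<B> =
     {X \<in> Obj C. \<forall>B \<in> \<B>. Hom_vanishes C B X \<and> Ext1_vanishes C B X}"

text \<open>That the ambient category is abelian is not part of the predicate; it is only meant to be
  applied to abelian categories and their Serre quotients.\<close>

definition torsion_pair :: "('o, 'a) cat \<Rightarrow> 'o set \<Rightarrow> 'o set \<Rightarrow> bool" where
  "torsion_pair C \<T> \<F> \<longleftrightarrow> full_subcategory C \<T> \<and> full_subcategory C \<F> \<and>
     (\<forall>T \<in> \<T>. \<forall>F \<in> \<F>. Hom_vanishes C T F) \<and>
     (\<forall>X \<in> Obj C. \<exists>T \<in> \<T>. \<exists>F \<in> \<F>. \<exists>i p. short_exact C T i X p F)"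

definition embedding_condition :: "('o, 'a) cat \<Rightarrow> 'o set \<Rightarrow> 'o set \<Rightarrow> 'o set \<Rightarrow> bool" where
  "embedding_condition C \<B> \<F> \<G> \<longleftrightarrow>
     (\<forall>F \<in> \<F>. \<exists>G \<in> \<G>. \<exists>B \<in> \<B>. \<exists>i p. short_exact C F i G p B)"

section \<open>The quotient category\<close>

text \<open>The quotient of \<open>A\<close> by a Serre subcategory \<open>\<B>\<close> is the localisation of \<open>A\<close> at the arrows
  whose kernel and cokernel lie in \<open>\<B>\<close>. These admit a calculus of fractions, so an arrow
  \<open>X \<rightarrow> Y\<close> of the quotient is an equivalence class of roofs \<open>(s, f)\<close>, standing for
  \<open>f \<cdot> s\<^sup>-\<^sup>1\<close>, where \<open>s : W \<rightarrow> X\<close> is such an arrow and \<open>f : W \<rightarrow> Y\<close> is arbitrary.\<close>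

definition quot_weq :: "('o, 'a) cat \<Rightarrow> 'o set \<Rightarrow> 'a set" where
  "quot_weq A \<B> = {s \<in> Arr A. (\<exists>k. is_kernel A s k \<and> Dom A k \<in> \<B>) \<and>
                               (\<exists>c. is_cokernel A s c \<and> Cod A c \<in> \<B>)}"

definition roofs :: "('o, 'a) cat \<Rightarrow> 'o set \<Rightarrow> 'o \<Rightarrow> 'o \<Rightarrow> ('a \<times> 'a) set" where
  "roofs A \<B> X Y = {(s, f). s \<in> quot_weq A \<B> \<and> f \<in> Arr A \<and>
                             Dom A s = Dom A f \<and> Cod A s = X \<and> Cod A f = Y}"

definition roof_equiv ::
    "('o, 'a) cat \<Rightarrow> 'o set \<Rightarrow> 'o \<Rightarrow> 'o \<Rightarrow> (('a \<times> 'a) \<times> ('a \<times> 'a)) set" where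
  "roof_equiv A \<B> X Y =
     {((s, f), (s', f')). (s, f) \<in> roofs A \<B> X Y \<and> (s', f') \<in> roofs A \<B> X Y \<and>
        (\<exists>V. \<exists>u \<in> Hom A V (Dom A s). \<exists>u' \<in> Hom A V (Dom A s').
           s \<cdot>\<^bsub>A\<^esub> u \<in> quot_weq A \<B> \<and> s \<cdot>\<^bsub>A\<^esub> u = s' \<cdot>\<^bsub>A\<^esub> u' \<and> f \<cdot>\<^bsub>A\<^esub> u = f' \<cdot>\<^bsub>A\<^esub> u')}"

text \<open>Roofs \<open>(s, f)\<close> from \<open>X\<close> to \<open>Y\<close> and \<open>(t, g)\<close> from \<open>Y\<close> to \<open>Z\<close> compose to
  \<open>(s \<cdot> u, g \<cdot> h)\<close> for any commutative square \<open>f \<cdot> u = t \<cdot> h\<close> with \<open>u\<close> in \<open>quot_weq\<close>. All choices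
  of representatives and squares give the same class, so the union below is this class.\<close>

definition roof_comp ::
    "('o, 'a) cat \<Rightarrow> 'o set \<Rightarrow> 'o \<Rightarrow> 'o \<Rightarrow> ('a \<times> 'a) set \<Rightarrow> ('a \<times> 'a) set \<Rightarrow> ('a \<times> 'a) set" where
  "roof_comp A \<B> X Z \<psi> \<phi> =
     \<Union> {roof_equiv A \<B> X Z `` {(s \<cdot>\<^bsub>A\<^esub> u, g \<cdot>\<^bsub>A\<^esub> h)} | s f t g u h.
          (s, f) \<in> \<phi> \<and> (t, g) \<in> \<psi> \<and> u \<in> quot_weq A \<B> \<and> Cod A u = Dom A f \<and>
          h \<in> Hom A (Dom A u) (Dom A t) \<and> f \<cdot>\<^bsub>A\<^esub> u = t \<cdot>\<^bsub>A\<^esub> h}"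

text \<open>Arrows carry their domain and codomain: \<open>(X, \<phi>, Y)\<close> with \<open>\<phi>\<close> a class of roofs.\<close>

definition quotient_category ::
    "('o, 'a) cat \<Rightarrow> 'o set \<Rightarrow> ('o, 'o \<times> ('a \<times> 'a) set \<times> 'o) cat" where
  "quotient_category A \<B> =
     \<lparr>Obj = Obj A,
      Arr = {(X, \<phi>, Y). X \<in> Obj A \<and> Y \<in> Obj A \<and> \<phi> \<in> roofs A \<B> X Y // roof_equiv A \<B> X Y},
      Dom = (\<lambda>(X, \<phi>, Y). X),
      Cod = (\<lambda>(X, \<phi>, Y). Y),
      Id = (\<lambda>X. (X, roof_equiv A \<B> X X `` {(Id A X, Id A X)}, X)),
      Comp = (\<lambda>(Y', \<psi>, Z) (X, \<phi>, Y). (X, roof_comp A \<B> X Z \<psi> \<phi>, Z))\<rparr>"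

record ('o, 'a, 'p, 'b) cat_functor =
  ObjMap :: "'o \<Rightarrow> 'p"
  ArrMap :: "'a \<Rightarrow> 'b"

definition quotient_functor ::
    "('o, 'a) cat \<Rightarrow> 'o set \<Rightarrow> ('o, 'a, 'o, 'o \<times> ('a \<times> 'a) set \<times> 'o) cat_functor" where
  "quotient_functor A \<B> =
     \<lparr>ObjMap = (\<lambda>X. X),
      ArrMap = (\<lambda>f. (Dom A f,
                     roof_equiv A \<B> (Dom A f) (Cod A f) `` {(Id A (Dom A f), f)},
                     Cod A f))\<rparr>"

definition essential_image ::
    "('p, 'b) cat \<Rightarrow> ('o, 'a, 'p, 'b) cat_functor \<Rightarrow> 'o set \<Rightarrow> 'p set" where
  "essential_image D F \<H> = {Y \<in> Obj D. \<exists>X \<in> \<H>. isomorphic D (ObjMap F X) Y}"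

end

theory Submission
  imports Defs
begin

text \<open>Call an arrow negligible if it factors through an object of \<open>\<B>\<close>. Negligible arrows form an
  ideal, and the arrows inverted by the quotient are exactly those that are left and right
  cancellable modulo this ideal, so the calculus of fractions becomes cancellation; a roof \<open>(s, f)\<close>
  is zero in the quotient iff \<open>f\<close> is negligible.

  Let \<open>(\<T>, \<F>)\<close> be the torsion pair. If \<open>G \<in> \<G>\<close> is \<open>\<B>\<close>-closed, then in a roof \<open>(s, f)\<close> from \<open>T \<in> \<T>\<close>
  to \<open>G\<close> the arrow \<open>f\<close> factors as \<open>f = h \<cdot> s\<close> with \<open>h : T \<rightarrow> G\<close>, hence vanishes. For an object \<open>X\<close> compose
  its torsion quotient \<open>X \<rightarrow> F\<close> with an embedding \<open>F \<rightarrow> G\<close> whose cokernel lies in \<open>\<B>\<close>: the composite has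
  the torsion part of \<open>X\<close> as kernel and is epic modulo \<open>\<B>\<close>, so it gives a short exact sequence in the
  quotient.\<close>

section \<open>Categories and their opposites\<close>

text \<open>A roof inverts only its left leg, so its two ends are not on the same footing, and the
  opposite of \<open>quotient_category A \<B>\<close> is not literally the quotient category of
  \<open>opposite A\<close>. Duality is therefore exploited inside \<open>A\<close> only: statements
  there are proved on one side and transported along \<open>opposite\<close>, whereas kernels and
  cokernels in the quotient receive separate arguments. The abelian axioms offer kernels, cokernels
  and biproducts, and no elements. Pullbacks along epics take the place of choosing preimages in the
  diagram chases; what has to be known about them is that the projection parallel to the epic is
  again epic. A further obstacle is that the composite
  \<open>X \<rightarrow> F \<rightarrow> G\<close> need not be epic in \<open>A\<close>. Cokernels
  in the quotient must therefore be recognised for arrows that are epic only modulo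
  \<open>\<B>\<close>, which is more than preservation of short exact sequences of
  \<open>A\<close>.\<close>

definition opposite :: "('o, 'a) cat \<Rightarrow> ('o, 'a) cat" where
  "opposite C = \<lparr>Obj = Obj C, Arr = Arr C, Dom = Cod C, Cod = Dom C, Id = Id C,
     Comp = (\<lambda>g f. f \<cdot>\<^bsub>C\<^esub> g)\<rparr>"

lemma opposite_simps [simp]:
  "Obj (opposite C) = Obj C" "Arr (opposite C) = Arr C"
  "Dom (opposite C) = Cod C" "Cod (opposite C) = Dom C" "Id (opposite C) = Id C"
  "g \<cdot>\<^bsub>opposite C\<^esub> f = f \<cdot>\<^bsub>C\<^esub> g"
  by (simp_all add: opposite_def)

lemma Hom_opposite [simp]: "Hom (opposite C) X Y = Hom C Y X"
  by (auto simp: Hom_def)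

lemma monic_opposite [simp]: "monic (opposite C) f \<longleftrightarrow> epic C f"
  by (simp add: monic_def epic_def)

lemma epic_opposite [simp]: "epic (opposite C) f \<longleftrightarrow> monic C f"
  by (simp add: monic_def epic_def)

lemma zero_object_opposite [simp]: "zero_object (opposite C) Z \<longleftrightarrow> zero_object C Z"
  by (auto simp: zero_object_def)

lemma zero_arr_opposite [simp]: "zero_arr (opposite C) f \<longleftrightarrow> zero_arr C f"
  by (auto simp: zero_arr_def)

lemma is_kernel_opposite [simp]: "is_kernel (opposite C) f k \<longleftrightarrow> is_cokernel C f k"
  by (simp add: is_kernel_def is_cokernel_def)

lemma is_cokernel_opposite [simp]: "is_cokernel (opposite C) f k \<longleftrightarrow> is_kernel C f k"
  by (simp add: is_kernel_def is_cokernel_def)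

lemma short_exact_opposite [simp]:
  "short_exact (opposite C) X i Y p Z \<longleftrightarrow> short_exact C Z p Y i X"
  by (auto simp: short_exact_def)

lemma serre_subcategory_opposite [simp]:
  "serre_subcategory (opposite C) \<B> \<longleftrightarrow> serre_subcategory C \<B>"
  by (simp add: serre_subcategory_def full_subcategory_def) blast

context category
begin

lemma in_Hom: "f \<in> Hom C X Y \<longleftrightarrow> f \<in> Arr C \<and> Dom C f = X \<and> Cod C f = Y"
  by (simp add: Hom_def)

lemma Comp_simps [simp]:
  assumes "f \<in> Arr C" "g \<in> Arr C" "Cod C f = Dom C g"
  shows "g \<cdot> f \<in> Arr C" "Dom C (g \<cdot> f) = Dom C f" "Cod C (g \<cdot> f) = Cod C g"
  using Comp_in_Hom[of f "Dom C f" "Cod C f" g "Cod C g"] assms by (simp_all add: in_Hom)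

lemma Id_simps [simp]:
  assumes "X \<in> Obj C"
  shows "Id C X \<in> Arr C" "Dom C (Id C X) = X" "Cod C (Id C X) = X"
  using Id_in_Hom[OF assms] by (simp_all add: in_Hom)

lemma Comp_Id [simp]:
  assumes "f \<in> Arr C"
  shows "Dom C f = X \<Longrightarrow> f \<cdot> Id C X = f" "Cod C f = X \<Longrightarrow> Id C X \<cdot> f = f"
  using Comp_Id_right[of f "Dom C f" "Cod C f"] Comp_Id_left[of f "Dom C f" "Cod C f"] assms
  by (auto simp: in_Hom)

lemma Comp_assoc_Arr [simp]:
  assumes "f \<in> Arr C" "g \<in> Arr C" "h \<in> Arr C" "Cod C f = Dom C g" "Cod C g = Dom C h"
  shows "(h \<cdot> g) \<cdot> f = h \<cdot> (g \<cdot> f)"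
  using Comp_assoc assms by (auto simp: in_Hom)

text \<open>Composites are normalised with brackets to the right, where the side
  \<open>f \<cdot> u\<close> of the square is no longer a subterm once \<open>a\<close> is appended.
  This form gives the equation between the normalised composites.\<close>

lemma Comp_eq_extend:
  assumes "f \<cdot> u = t \<cdot> h" "u \<in> Arr C" "f \<in> Arr C" "t \<in> Arr C" "h \<in> Arr C" "a \<in> Arr C"
    "Cod C u = Dom C f" "Cod C h = Dom C t" "Cod C a = Dom C u" "Dom C h = Dom C u"
  shows "f \<cdot> (u \<cdot> a) = t \<cdot> (h \<cdot> a)"
  using assms Comp_assoc_Arr[of a u f] Comp_assoc_Arr[of a h t] by simp

lemma zero_arr_Comp:
  assumes "zero_arr C f" "a \<in> Arr C" "b \<in> Arr C" "Cod C a = Dom C f" "Dom C b = Cod C f"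
  shows "zero_arr C (b \<cdot> (f \<cdot> a))"
proof -
  obtain Z g h where Z: "zero_object C Z" "g \<in> Hom C (Dom C f) Z" "h \<in> Hom C Z (Cod C f)" "f = h \<cdot> g"
    using assms(1) unfolding zero_arr_def by blast
  have f: "f \<in> Arr C" using assms(1) by (simp add: zero_arr_def)
  have gh: "g \<in> Arr C" "Dom C g = Cod C a" "h \<in> Arr C" "Cod C h = Dom C b" "Cod C g = Dom C h"
    using Z(2,3) assms(4,5) by (simp_all add: in_Hom)
  then have "b \<cdot> (f \<cdot> a) = (b \<cdot> h) \<cdot> (g \<cdot> a)"
    unfolding Z(4) using assms(2,3) by simp
  moreover have "g \<cdot> a \<in> Hom C (Dom C a) Z" "b \<cdot> h \<in> Hom C Z (Cod C b)"
    using Z(2,3) assms by (simp_all add: in_Hom)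
  moreover have "b \<cdot> (f \<cdot> a) \<in> Arr C" "Dom C (b \<cdot> (f \<cdot> a)) = Dom C a" "Cod C (b \<cdot> (f \<cdot> a)) = Cod C b"
    using f assms by simp_all
  ultimately show ?thesis using Z(1) unfolding zero_arr_def by metis
qed

text \<open>Conjugation by the isomorphisms carries an arrow \<open>X' \<rightarrow> Y'\<close> to
  one \<open>X \<rightarrow> Y\<close>, and zero arrows form a two-sided ideal. It is stated for a
  bare category because it is applied to the quotient, for which no additive structure is
  constructed.\<close>

lemma Hom_vanishes_isomorphic:
  assumes "Hom_vanishes C X Y" "isomorphic C X X'" "isomorphic C Y Y'"
  shows "Hom_vanishes C X' Y'"
  unfolding Hom_vanishes_def
proof
  fix \<phi> assume \<phi>: "\<phi> \<in> Hom C X' Y'"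
  obtain \<alpha> \<alpha>' where \<alpha>: "\<alpha> \<in> Hom C X X'" "\<alpha>' \<in> Hom C X' X" "\<alpha> \<cdot> \<alpha>' = Id C X'"
    using assms(2) by (auto simp: isomorphic_def isomorphism_def in_Hom)
  obtain \<beta> \<beta>' where \<beta>: "\<beta> \<in> Hom C Y Y'" "\<beta>' \<in> Hom C Y' Y" "\<beta> \<cdot> \<beta>' = Id C Y'"
    using assms(3) by (auto simp: isomorphic_def isomorphism_def in_Hom)
  have "\<beta> \<cdot> ((\<beta>' \<cdot> (\<phi> \<cdot> \<alpha>)) \<cdot> \<alpha>') = (\<beta> \<cdot> \<beta>') \<cdot> (\<phi> \<cdot> (\<alpha> \<cdot> \<alpha>'))"
    using \<alpha>(1,2) \<beta>(1,2) \<phi> by (simp add: in_Hom)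
  also have "\<dots> = \<phi>" unfolding \<alpha>(3) \<beta>(3) using \<phi> Dom_in_Obj Cod_in_Obj by (auto simp: in_Hom)
  finally have e: "\<beta> \<cdot> ((\<beta>' \<cdot> (\<phi> \<cdot> \<alpha>)) \<cdot> \<alpha>') = \<phi>" .
  have h: "\<beta>' \<cdot> (\<phi> \<cdot> \<alpha>) \<in> Hom C X Y" using Comp_in_Hom \<alpha> \<beta> \<phi> by blast
  then have "zero_arr C (\<beta>' \<cdot> (\<phi> \<cdot> \<alpha>))" using assms(1) by (simp add: Hom_vanishes_def)
  then have "zero_arr C (\<beta> \<cdot> ((\<beta>' \<cdot> (\<phi> \<cdot> \<alpha>)) \<cdot> \<alpha>'))"
    by (rule zero_arr_Comp) (use h \<alpha>(1,2) \<beta>(1,2) in \<open>simp_all only: in_Hom\<close>)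
  then show "zero_arr C \<phi>" unfolding e .
qed

lemma isomorphic_refl: "X \<in> Obj C \<Longrightarrow> isomorphic C X X"
  unfolding isomorphic_def isomorphism_def by (intro bexI[of _ "Id C X"]) (auto simp: in_Hom)

lemma category_opposite: "category (opposite C)"
  by unfold_locales (auto simp: in_Hom Dom_in_Obj Cod_in_Obj)

end

section \<open>Zero arrows and differences\<close>

context preadditive_category
begin

text \<open>The axiom asserts a neutral element for each hom set separately and names none, while
  \<open>add\<close> is one operation for all of them; hence a choice indexed by the two objects.
  Neutral elements are unique, so the choice is immaterial.\<close>

definition zer where
  "zer X Y = (SOME z. comm_group \<lparr>carrier = Hom C X Y, monoid.mult = add, one = z\<rparr>)"

definition HomGroup where
  "HomGroup X Y = \<lparr>carrier = Hom C X Y, monoid.mult = add, one = zer X Y\<rparr>"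

definition diff where
  "diff f g = add f (inv\<^bsub>HomGroup (Dom C f) (Cod C f)\<^esub> g)"

lemma HomGroup_simps [simp]:
  "carrier (HomGroup X Y) = Hom C X Y" "monoid.mult (HomGroup X Y) = add"
  "one (HomGroup X Y) = zer X Y"
  by (simp_all add: HomGroup_def)

lemma comm_group_HomGroup:
  assumes "X \<in> Obj C" "Y \<in> Obj C" shows "comm_group (HomGroup X Y)"
  unfolding HomGroup_def zer_def by (rule someI_ex) (rule Hom_comm_group[OF assms])

lemma group_HomGroup:
  assumes "X \<in> Obj C" "Y \<in> Obj C" shows "group (HomGroup X Y)"
  using comm_group_HomGroup[OF assms] by (simp add: comm_group_def)

lemma zer_simps [simp]:
  assumes "X \<in> Obj C" "Y \<in> Obj C"
  shows "zer X Y \<in> Arr C" "Dom C (zer X Y) = X" "Cod C (zer X Y) = Y"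
  using monoid.one_closed[OF group.is_monoid[OF group_HomGroup[OF assms]]] by (simp_all add: in_Hom)

lemma Obj_Dom_Cod [simp]: "f \<in> Arr C \<Longrightarrow> Dom C f \<in> Obj C" "f \<in> Arr C \<Longrightarrow> Cod C f \<in> Obj C"
  by (simp_all add: Dom_in_Obj Cod_in_Obj)

lemma add_simps [simp]:
  assumes "f \<in> Arr C" "g \<in> Arr C" "Dom C f = Dom C g" "Cod C f = Cod C g"
  shows "add f g \<in> Arr C" "Dom C (add f g) = Dom C g" "Cod C (add f g) = Cod C g"
  using monoid.m_closed[OF group.is_monoid[OF group_HomGroup[of "Dom C g" "Cod C g"]], of f g] assms
  by (simp_all add: in_Hom)

text \<open>An idempotent of a group is neutral. With distributivity this is how composites with
  \<open>zer\<close> are recognised as zero.\<close>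

lemma add_idem_imp_zer:
  assumes "f \<in> Arr C" "add f f = f" shows "f = zer (Dom C f) (Cod C f)"
  using group.l_cancel_one[OF group_HomGroup[of "Dom C f" "Cod C f"], of f f] assms
  by (simp add: in_Hom)

lemma add_zer [simp]:
  assumes "f \<in> Arr C" "Dom C f = X" "Cod C f = Y"
  shows "add f (zer X Y) = f" "add (zer X Y) f = f"
  using monoid.r_one[OF group.is_monoid[OF group_HomGroup[of X Y]], of f]
    monoid.l_one[OF group.is_monoid[OF group_HomGroup[of X Y]], of f] assms
  by (auto simp: in_Hom)

lemma Comp_zer [simp]:
  assumes "h \<in> Arr C" "Dom C h = Y" "X \<in> Obj C"
  shows "h \<cdot> zer X Y = zer X (Cod C h)"
  using add_idem_imp_zer[of "h \<cdot> zer X Y"] assms Comp_add_right[of "zer X Y" X Y "zer X Y" h "Cod C h"]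
  by (auto simp: in_Hom)

lemma zer_Comp [simp]:
  assumes "h \<in> Arr C" "Cod C h = X" "Y \<in> Obj C"
  shows "zer X Y \<cdot> h = zer (Dom C h) Y"
  using add_idem_imp_zer[of "zer X Y \<cdot> h"] assms Comp_add_left[of h "Dom C h" X "zer X Y" Y "zer X Y"]
  by (auto simp: in_Hom)

lemma inv_simps [simp]:
  assumes "f \<in> Arr C" "Dom C f = X" "Cod C f = Y"
  shows "inv\<^bsub>HomGroup X Y\<^esub> f \<in> Arr C"
    "Dom C (inv\<^bsub>HomGroup X Y\<^esub> f) = X" "Cod C (inv\<^bsub>HomGroup X Y\<^esub> f) = Y"
  using group.inv_closed[OF group_HomGroup[of X Y], of f] assms by (auto simp: in_Hom)

lemma diff_simps [simp]:
  assumes "f \<in> Arr C" "g \<in> Arr C" "Dom C f = Dom C g" "Cod C f = Cod C g"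
  shows "diff f g \<in> Arr C" "Dom C (diff f g) = Dom C g" "Cod C (diff f g) = Cod C g"
  unfolding diff_def using assms by simp_all

lemma diff_add:
  assumes "f \<in> Arr C" "g \<in> Arr C" "Dom C f = Dom C g" "Cod C f = Cod C g"
  shows "add (diff f g) g = f"
  unfolding diff_def
  using group.inv_solve_right[OF group_HomGroup[of "Dom C g" "Cod C g"], of "diff f g" f g] assms
  by (auto simp: in_Hom diff_def)

lemma add_right_cancel:
  assumes "add f h = add g h" "f \<in> Arr C" "g \<in> Arr C" "h \<in> Arr C"
    "Dom C f = Dom C h" "Dom C g = Dom C h" "Cod C f = Cod C h" "Cod C g = Cod C h"
  shows "f = g"
  using group.right_cancel[OF group_HomGroup[of "Dom C h" "Cod C h"], of h f g] assms
  by (simp add: in_Hom)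

text \<open>A difference is determined by the sum it has to solve. Composition thus distributes over
  \<open>diff\<close> because it does over \<open>add\<close>, without computing inverses.\<close>

lemma diff_eqI:
  assumes "add h g = f" "h \<in> Arr C" "g \<in> Arr C" "Dom C h = Dom C g" "Cod C h = Cod C g"
  shows "diff f g = h"
proof (rule add_right_cancel[of _ g])
  have f: "f \<in> Arr C" "Dom C f = Dom C g" "Cod C f = Cod C g" using assms by auto
  then show "add (diff f g) g = add h g" using assms by (simp add: diff_add)
  show "diff f g \<in> Arr C" "Dom C (diff f g) = Dom C g" "Cod C (diff f g) = Cod C g"
    using f assms by simp_all
qed (use assms in simp_all)

lemma diff_self [simp]:
  "f \<in> Arr C \<Longrightarrow> diff f f = zer (Dom C f) (Cod C f)"
  by (rule diff_eqI) simp_all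

lemma diff_eq_zer_iff:
  assumes "f \<in> Arr C" "g \<in> Arr C" "Dom C f = Dom C g" "Cod C f = Cod C g"
  shows "diff f g = zer (Dom C g) (Cod C g) \<longleftrightarrow> f = g"
  using diff_add[OF assms] assms by auto

lemma Comp_diff:
  assumes "f \<in> Arr C" "g \<in> Arr C" "Dom C f = Dom C g" "Cod C f = Cod C g"
    "h \<in> Arr C" "Dom C h = Cod C g"
  shows "h \<cdot> diff f g = diff (h \<cdot> f) (h \<cdot> g)"
  using Comp_add_right[of "diff f g" "Dom C g" "Cod C g" g h "Cod C h"] assms
  by (intro diff_eqI[symmetric]) (simp_all add: in_Hom diff_add)

lemma diff_Comp:
  assumes "f \<in> Arr C" "g \<in> Arr C" "Dom C f = Dom C g" "Cod C f = Cod C g"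
    "h \<in> Arr C" "Cod C h = Dom C g"
  shows "diff f g \<cdot> h = diff (f \<cdot> h) (g \<cdot> h)"
  using Comp_add_left[of h "Dom C h" "Dom C g" "diff f g" "Cod C g" g] assms
  by (intro diff_eqI[symmetric]) (simp_all add: in_Hom diff_add)

lemma diff_zer [simp]:
  assumes "f \<in> Arr C" "Dom C f = X" "Cod C f = Y" shows "diff f (zer X Y) = f"
  using assms by (intro diff_eqI) auto

lemma preadditive_category_opposite: "preadditive_category (opposite C) add"
proof -
  interpret op: category "opposite C" by (rule category_opposite)
  show ?thesis
    by unfold_locales (use Hom_comm_group Comp_add_right Comp_add_left in auto)
qed

text \<open>Both sides choose from literally the same family of group records, since the hom sets of
  the opposite are those of \<open>C\<close> with the arguments exchanged; the chosen elements are
  therefore equal.\<close>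

lemma zer_opposite [simp]: "preadditive_category.zer (opposite C) add X Y = zer Y X"
  by (simp add: preadditive_category.zer_def[OF preadditive_category_opposite] zer_def)

end

section \<open>Abelian categories\<close>

context abelian_category
begin

lemma zero_object_Hom:
  assumes "zero_object C Z" "f \<in> Arr C"
  shows "Cod C f = Z \<Longrightarrow> zer (Dom C f) Z = f" "Dom C f = Z \<Longrightarrow> zer Z (Cod C f) = f"
proof -
  have Z: "Z \<in> Obj C" "\<exists>!g. g \<in> Hom C (Dom C f) Z" "\<exists>!g. g \<in> Hom C Z (Cod C f)"
    using assms by (auto simp: zero_object_def)
  show "zer (Dom C f) Z = f" if "Cod C f = Z"
    using Z(2) that assms(2) Z(1) by (metis Obj_Dom_Cod(1) in_Hom zer_simps)
  show "zer Z (Cod C f) = f" if "Dom C f = Z"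
    using Z(3) that assms(2) Z(1) by (metis Obj_Dom_Cod(2) in_Hom zer_simps)
qed

text \<open>Arrows into a zero object are unique, hence neutral, and composition preserves neutral
  elements. Conversely a neutral element factors through any zero object.\<close>

lemma zero_arr_iff: "zero_arr C f \<longleftrightarrow> f \<in> Arr C \<and> zer (Dom C f) (Cod C f) = f"
proof safe
  assume f: "zero_arr C f"
  then show "f \<in> Arr C" by (simp add: zero_arr_def)
  from f obtain Z g h where h: "zero_object C Z" "g \<in> Hom C (Dom C f) Z"
    "h \<in> Hom C Z (Cod C f)" "f = h \<cdot> g" unfolding zero_arr_def by blast
  then have "g = zer (Dom C f) Z" by (metis zero_object_Hom(1) in_Hom)
  then show "zer (Dom C f) (Cod C f) = f" using h by (metis Comp_zer Dom_in_Obj \<open>f \<in> Arr C\<close> in_Hom)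
next
  assume f: "f \<in> Arr C" "zer (Dom C f) (Cod C f) = f"
  obtain Z where Z: "zero_object C Z" using ex_zero_object by blast
  then have [simp]: "Z \<in> Obj C" by (simp add: zero_object_def)
  have "f = zer Z (Cod C f) \<cdot> zer (Dom C f) Z" using f by simp
  then show "zero_arr C f" unfolding zero_arr_def using f Z
    by (metis \<open>Z \<in> Obj C\<close> Obj_Dom_Cod in_Hom zer_simps)
qed

lemma abelian_category_opposite: "abelian_category (opposite C) add"
proof -
  interpret op: preadditive_category "opposite C" add by (rule preadditive_category_opposite)
  show ?thesis
  proof
    fix X Y assume "X \<in> Obj (opposite C)" "Y \<in> Obj (opposite C)"
    then obtain P i j p q where "i \<in> Hom C X P" "j \<in> Hom C Y P" "p \<in> Hom C P X" "q \<in> Hom C P Y"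
        "p \<cdot> i = Id C X" "q \<cdot> j = Id C Y" "add (i \<cdot> p) (j \<cdot> q) = Id C P"
      using ex_biproduct[of X Y] by auto
    then show "\<exists>P. \<exists>i\<in>Hom (opposite C) X P. \<exists>j\<in>Hom (opposite C) Y P.
      \<exists>p\<in>Hom (opposite C) P X. \<exists>q\<in>Hom (opposite C) P Y.
      p \<cdot>\<^bsub>opposite C\<^esub> i = cat.Id (opposite C) X \<and> q \<cdot>\<^bsub>opposite C\<^esub> j = cat.Id (opposite C) Y \<and>
      add (i \<cdot>\<^bsub>opposite C\<^esub> p) (j \<cdot>\<^bsub>opposite C\<^esub> q) = cat.Id (opposite C) P"
      by (intro exI[of _ P] bexI[of _ p] bexI[of _ q] bexI[of _ i] bexI[of _ j]) auto
  qed (use ex_zero_object ex_kernel ex_cokernel monic_is_kernel epic_is_cokernel in auto)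
qed

lemma zero_arr_zer [simp]: "X \<in> Obj C \<Longrightarrow> Y \<in> Obj C \<Longrightarrow> zero_arr C (zer X Y)"
  by (simp add: zero_arr_iff)

lemma zero_arr_Comp_iff:
  assumes "f \<in> Arr C" "g \<in> Arr C" "Cod C g = Dom C f"
  shows "zero_arr C (f \<cdot> g) \<longleftrightarrow> f \<cdot> g = zer (Dom C g) (Cod C f)"
  unfolding zero_arr_iff using assms by (metis Comp_simps)

lemma is_kernelD:
  assumes "is_kernel C f k"
  shows "f \<in> Arr C" "k \<in> Arr C" "Cod C k = Dom C f" "f \<cdot> k = zer (Dom C k) (Cod C f)"
  using assms zero_arr_Comp_iff[of f k] unfolding is_kernel_def by blast+

lemma is_cokernelD:
  assumes "is_cokernel C f k"
  shows "f \<in> Arr C" "k \<in> Arr C" "Dom C k = Cod C f" "k \<cdot> f = zer (Dom C f) (Cod C k)"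
  using assms zero_arr_Comp_iff[of k f] unfolding is_cokernel_def by metis+

lemma kernel_factor:
  assumes "is_kernel C f k" "g \<in> Arr C" "Cod C g = Dom C f" "f \<cdot> g = zer (Dom C g) (Cod C f)"
  obtains u where "u \<in> Arr C" "Dom C u = Dom C g" "Cod C u = Dom C k" "k \<cdot> u = g"
proof -
  have "zero_arr C (f \<cdot> g)" using assms is_kernelD[OF assms(1)] by (simp add: zero_arr_Comp_iff)
  then show ?thesis using assms that unfolding is_kernel_def in_Hom by blast
qed

lemma cokernel_factor:
  assumes "is_cokernel C f k" "g \<in> Arr C" "Dom C g = Cod C f" "g \<cdot> f = zer (Dom C f) (Cod C g)"
  obtains u where "u \<in> Arr C" "Cod C u = Cod C g" "Dom C u = Cod C k" "u \<cdot> k = g"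
proof -
  have "zero_arr C (g \<cdot> f)" using assms is_cokernelD[OF assms(1)] by (simp add: zero_arr_Comp_iff)
  then show ?thesis using assms that unfolding is_cokernel_def in_Hom by blast
qed

text \<open>The common composite is killed by \<open>f\<close>, and both arrows are factorisations
  of it through \<open>k\<close>, so uniqueness of the factorisation applies.\<close>

lemma kernel_monic: assumes "is_kernel C f k" shows "monic C k"
  unfolding monic_def
proof safe
  note k = is_kernelD[OF assms]
  show "k \<in> Arr C" by (rule k)
  fix W g h assume gh: "g \<in> Hom C W (Dom C k)" "h \<in> Hom C W (Dom C k)" "k \<cdot> g = k \<cdot> h"
  have "f \<cdot> (k \<cdot> h) = zer (Dom C (k \<cdot> h)) (Cod C f)"
    using k gh Comp_assoc_Arr[of h k f] by (simp add: in_Hom del: Comp_assoc_Arr)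
  then have "zero_arr C (f \<cdot> (k \<cdot> h))" using k gh by (subst zero_arr_Comp_iff) (auto simp: in_Hom)
  moreover have "k \<cdot> h \<in> Arr C" "Cod C (k \<cdot> h) = Dom C f" "Dom C (k \<cdot> h) = W" using k gh by (auto simp: in_Hom)
  ultimately have "\<exists>!u. u \<in> Hom C W (Dom C k) \<and> k \<cdot> u = k \<cdot> h"
    using assms unfolding is_kernel_def by metis
  then show "g = h" using gh by blast
qed

lemma monic_cancel:
  assumes "monic C m" "m \<cdot> f = m \<cdot> g" "f \<in> Arr C" "g \<in> Arr C" "Dom C f = Dom C g"
    "Cod C f = Dom C m" "Cod C g = Dom C m"
  shows "f = g"
proof -
  have "f \<in> Hom C (Dom C g) (Dom C m)" "g \<in> Hom C (Dom C g) (Dom C m)"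
    using assms by (simp_all add: in_Hom)
  then show ?thesis using assms(1,2) unfolding monic_def by blast
qed

lemma monic_Arr: "monic C m \<Longrightarrow> m \<in> Arr C"
  by (simp add: monic_def)

lemma epic_Arr: "epic C m \<Longrightarrow> m \<in> Arr C"
  by (simp add: epic_def)

lemma epic_cancel:
  assumes "epic C m" "f \<cdot> m = g \<cdot> m" "f \<in> Arr C" "g \<in> Arr C" "Cod C f = Cod C g"
    "Dom C f = Cod C m" "Dom C g = Cod C m"
  shows "f = g"
proof -
  have "f \<in> Hom C (Cod C m) (Cod C g)" "g \<in> Hom C (Cod C m) (Cod C g)"
    using assms by (simp_all add: in_Hom)
  then show ?thesis using assms(1,2) unfolding epic_def by blast
qed

lemma cokernel_epic: "is_cokernel C f k \<Longrightarrow> epic C k"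
  using abelian_category.kernel_monic[OF abelian_category_opposite, of f k] by simp

lemma monic_if_zero:
  assumes "m \<in> Arr C"
    "\<And>x. x \<in> Arr C \<Longrightarrow> Cod C x = Dom C m \<Longrightarrow> m \<cdot> x = zer (Dom C x) (Cod C m) \<Longrightarrow> zer (Dom C x) (Cod C x) = x"
  shows "monic C m"
  unfolding monic_def
proof (intro conjI allI ballI impI assms(1))
  fix W g h assume gh: "g \<in> Hom C W (Dom C m)" "h \<in> Hom C W (Dom C m)" "m \<cdot> g = m \<cdot> h"
  then have "m \<cdot> diff g h = zer (Dom C (diff g h)) (Cod C m)"
    using assms(1) by (simp add: in_Hom Comp_diff)
  then have "zer (Dom C (diff g h)) (Cod C (diff g h)) = diff g h"
    by (rule assms(2)[rotated 2]) (use gh in \<open>auto simp: in_Hom\<close>)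
  then show "g = h" using diff_eq_zer_iff[of g h] gh by (simp add: in_Hom)
qed

lemma epic_if_zero:
  assumes "m \<in> Arr C"
    "\<And>x. x \<in> Arr C \<Longrightarrow> Dom C x = Cod C m \<Longrightarrow> x \<cdot> m = zer (Dom C m) (Cod C x) \<Longrightarrow> zer (Dom C x) (Cod C x) = x"
  shows "epic C m"
  using abelian_category.monic_if_zero[OF abelian_category_opposite, of m] assms by simp

lemma is_kernelI:
  assumes "f \<in> Arr C" "monic C k" "Cod C k = Dom C f" "f \<cdot> k = zer (Dom C k) (Cod C f)"
    and "\<And>g. g \<in> Arr C \<Longrightarrow> Cod C g = Dom C f \<Longrightarrow> f \<cdot> g = zer (Dom C g) (Cod C f)
      \<Longrightarrow> \<exists>u \<in> Hom C (Dom C g) (Dom C k). k \<cdot> u = g"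
  shows "is_kernel C f k"
  unfolding is_kernel_def
proof (intro conjI ballI impI)
  note k = monic_Arr[OF assms(2)]
  show "zero_arr C (f \<cdot> k)" using assms k by (simp add: zero_arr_Comp_iff)
  fix g assume g: "g \<in> Arr C" "Cod C g = Dom C f \<and> zero_arr C (f \<cdot> g)"
  then have "f \<cdot> g = zer (Dom C g) (Cod C f)" using assms(1) zero_arr_Comp_iff[of f g] by blast
  from assms(5)[OF g(1) _ this] g obtain u where "u \<in> Hom C (Dom C g) (Dom C k)" "k \<cdot> u = g" by auto
  then show "\<exists>!u. u \<in> Hom C (Dom C g) (Dom C k) \<and> k \<cdot> u = g"
    using monic_cancel[OF assms(2)] by (intro ex1I[of _ u]) (auto simp: in_Hom)
qed (use assms monic_Arr in auto)

lemma is_cokernelI: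
  assumes "f \<in> Arr C" "epic C k" "Dom C k = Cod C f" "k \<cdot> f = zer (Dom C f) (Cod C k)"
    and "\<And>g. g \<in> Arr C \<Longrightarrow> Dom C g = Cod C f \<Longrightarrow> g \<cdot> f = zer (Dom C f) (Cod C g)
      \<Longrightarrow> \<exists>u \<in> Hom C (Cod C k) (Cod C g). u \<cdot> k = g"
  shows "is_cokernel C f k"
  using abelian_category.is_kernelI[OF abelian_category_opposite, of f k] assms by simp

text \<open>By the axiom \<open>m\<close> is a kernel of some \<open>f\<close>. Since
  \<open>f\<close> kills \<open>m\<close>, it factors through the cokernel \<open>c\<close>;
  whatever \<open>c\<close> kills is then killed by \<open>f\<close> and factors through
  \<open>m\<close>.\<close>

lemma monic_kernel_of_cokernel:
  assumes "monic C m" "is_cokernel C m c" shows "is_kernel C c m"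
proof -
  from monic_is_kernel[OF assms(1)] obtain f where f: "is_kernel C f m" ..
  note c = is_cokernelD[OF assms(2)] and m = is_kernelD[OF f]
  obtain w where w: "w \<in> Arr C" "Cod C w = Cod C f" "Dom C w = Cod C c" "w \<cdot> c = f"
    using cokernel_factor[OF assms(2), of f] m by metis
  show ?thesis
  proof (rule is_kernelI[OF c(2) assms(1) _ c(4)])
    fix g assume g: "g \<in> Arr C" "Cod C g = Dom C c" "c \<cdot> g = zer (Dom C g) (Cod C c)"
    have "f \<cdot> g = w \<cdot> (c \<cdot> g)" using w c g by (metis Comp_assoc_Arr)
    then have "f \<cdot> g = zer (Dom C g) (Cod C f)" using w(1,2,3) g c(2) by (metis Comp_zer Obj_Dom_Cod(1))
    moreover have "Cod C g = Dom C f" using g c m by simp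
    ultimately obtain u where "u \<in> Arr C" "Dom C u = Dom C g" "Cod C u = Dom C m" "m \<cdot> u = g"
      using kernel_factor[OF f g(1)] by blast
    then show "\<exists>u \<in> Hom C (Dom C g) (Dom C m). m \<cdot> u = g" by (auto simp: in_Hom)
  qed (use c in simp)
qed

lemma epic_cokernel_of_kernel:
  "epic C e \<Longrightarrow> is_kernel C e k \<Longrightarrow> is_cokernel C k e"
  using abelian_category.monic_kernel_of_cokernel[OF abelian_category_opposite, of e k] by simp

end

section \<open>Pullbacks and image factorisations\<close>

text \<open>Defined for an arbitrary category record so that a pushout can be expressed as a
  pullback in \<open>opposite C\<close>.\<close>

definition pullback :: "('o, 'a) cat \<Rightarrow> 'a \<Rightarrow> 'a \<Rightarrow> 'a \<Rightarrow> 'a \<Rightarrow> bool" where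
  "pullback C f g h k \<longleftrightarrow> f \<in> Arr C \<and> g \<in> Arr C \<and> h \<in> Arr C \<and> k \<in> Arr C \<and>
     Cod C f = Cod C g \<and> Dom C h = Dom C k \<and> Cod C h = Dom C f \<and> Cod C k = Dom C g \<and>
     f \<cdot>\<^bsub>C\<^esub> h = g \<cdot>\<^bsub>C\<^esub> k \<and>
     (\<forall>a \<in> Arr C. \<forall>b \<in> Arr C. Dom C a = Dom C b \<and> Cod C a = Dom C f \<and> Cod C b = Dom C g \<and>
        f \<cdot>\<^bsub>C\<^esub> a = g \<cdot>\<^bsub>C\<^esub> b \<longrightarrow>
        (\<exists>!u. u \<in> Hom C (Dom C a) (Dom C h) \<and> h \<cdot>\<^bsub>C\<^esub> u = a \<and> k \<cdot>\<^bsub>C\<^esub> u = b))"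

context abelian_category
begin

lemma pullbackD:
  assumes "pullback C f g h k"
  shows "f \<in> Arr C" "g \<in> Arr C" "h \<in> Arr C" "k \<in> Arr C" "Cod C f = Cod C g" "Dom C h = Dom C k"
    "Cod C h = Dom C f" "Cod C k = Dom C g" "f \<cdot> h = g \<cdot> k"
  using assms unfolding pullback_def by blast+

lemma pullback_factor:
  assumes "pullback C f g h k" "a \<in> Arr C" "b \<in> Arr C" "Dom C a = Dom C b" "Cod C a = Dom C f"
    "Cod C b = Dom C g" "f \<cdot> a = g \<cdot> b"
  obtains u where "u \<in> Arr C" "Dom C u = Dom C a" "Cod C u = Dom C h" "h \<cdot> u = a" "k \<cdot> u = b"
  using assms unfolding pullback_def in_Hom by blast

lemma pullback_cancel:
  assumes pb: "pullback C f g h k" and x: "x \<in> Arr C" "y \<in> Arr C" "Dom C x = Dom C y"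
    "Cod C x = Dom C h" "Cod C y = Dom C h" "h \<cdot> x = h \<cdot> y" "k \<cdot> x = k \<cdot> y"
  shows "x = y"
proof -
  note p = pullbackD[OF pb]
  have "f \<cdot> (h \<cdot> y) = g \<cdot> (k \<cdot> y)" by (rule Comp_eq_extend) (use p x in auto)
  moreover have "h \<cdot> y \<in> Arr C" "k \<cdot> y \<in> Arr C" "Dom C (h \<cdot> y) = Dom C (k \<cdot> y)"
    "Cod C (h \<cdot> y) = Dom C f" "Cod C (k \<cdot> y) = Dom C g" "Dom C (h \<cdot> y) = Dom C y"
    using p x by auto
  ultimately have "\<exists>!u. u \<in> Hom C (Dom C y) (Dom C h) \<and> h \<cdot> u = h \<cdot> y \<and> k \<cdot> u = k \<cdot> y"
    using pb unfolding pullback_def by metis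
  moreover have "x \<in> Hom C (Dom C y) (Dom C h)" "y \<in> Hom C (Dom C y) (Dom C h)"
    using x by (auto simp: in_Hom)
  ultimately show "x = y" using x(6,7) by metis
qed

lemma monic_Comp_zerD:
  assumes "monic C m" "x \<in> Arr C" "Cod C x = Dom C m" "m \<cdot> x = zer (Dom C x) (Cod C m)"
  shows "x = zer (Dom C x) (Dom C m)"
  by (rule monic_cancel[OF assms(1)]) (use assms monic_Arr in auto)

lemma epic_Comp_zerD:
  assumes "epic C m" "x \<in> Arr C" "Dom C x = Cod C m" "x \<cdot> m = zer (Dom C m) (Cod C x)"
  shows "x = zer (Cod C m) (Cod C x)"
  by (rule epic_cancel[OF assms(1)]) (use assms epic_Arr in auto)

lemma monic_Comp:
  assumes "monic C m" "monic C n" "Cod C n = Dom C m"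
  shows "monic C (m \<cdot> n)"
proof (rule monic_if_zero)
  note a = monic_Arr[OF assms(1)] monic_Arr[OF assms(2)]
  fix x assume x: "x \<in> Arr C" "Cod C x = Dom C (m \<cdot> n)" "(m \<cdot> n) \<cdot> x = zer (Dom C x) (Cod C (m \<cdot> n))"
  then have "n \<cdot> x = zer (Dom C (n \<cdot> x)) (Dom C m)"
    using a assms by (intro monic_Comp_zerD[OF assms(1)]) auto
  then show "zer (Dom C x) (Cod C x) = x"
    using monic_Comp_zerD[OF assms(2) x(1)] a assms x by simp
qed (use assms monic_Arr in auto)

lemma monic_Comp_right:
  assumes "monic C (m \<cdot> n)" "m \<in> Arr C" "n \<in> Arr C" "Cod C n = Dom C m"
  shows "monic C n"
proof (rule monic_if_zero[OF assms(3)])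
  fix x assume x: "x \<in> Arr C" "Cod C x = Dom C n" "n \<cdot> x = zer (Dom C x) (Cod C n)"
  then have "(m \<cdot> n) \<cdot> x = zer (Dom C x) (Cod C (m \<cdot> n))" using assms by simp
  then show "zer (Dom C x) (Cod C x) = x"
    using monic_Comp_zerD[OF assms(1) x(1)] x assms by simp
qed

lemma epic_Comp: "epic C m \<Longrightarrow> epic C n \<Longrightarrow> Cod C n = Dom C m \<Longrightarrow> epic C (m \<cdot> n)"
  using abelian_category.monic_Comp[OF abelian_category_opposite, of n m] by simp

lemma epic_Comp_left:
  "epic C (m \<cdot> n) \<Longrightarrow> m \<in> Arr C \<Longrightarrow> n \<in> Arr C \<Longrightarrow> Cod C n = Dom C m \<Longrightarrow> epic C m"
  using abelian_category.monic_Comp_right[OF abelian_category_opposite, of n m] by simp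

lemma monic_Id: "X \<in> Obj C \<Longrightarrow> monic C (Id C X)"
  by (rule monic_if_zero) simp_all

lemma epic_Id: "X \<in> Obj C \<Longrightarrow> epic C (Id C X)"
  by (rule epic_if_zero) simp_all

text \<open>The axiom provides only three of the identities. The mixed composites vanish because
  \<open>i \<cdot> p\<close> is the identity minus \<open>j \<cdot> q\<close>: composing with
  \<open>j\<close>, or with \<open>q\<close> on the other side, gives zero, and then
  \<open>p \<cdot> i\<close> or \<open>q \<cdot> j\<close> absorbs what remains.\<close>

lemma biproduct:
  assumes "X \<in> Obj C" "Y \<in> Obj C"
  obtains P i j p q where "P \<in> Obj C"
    "i \<in> Arr C" "Dom C i = X" "Cod C i = P" "j \<in> Arr C" "Dom C j = Y" "Cod C j = P"
    "p \<in> Arr C" "Dom C p = P" "Cod C p = X" "q \<in> Arr C" "Dom C q = P" "Cod C q = Y"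
    "p \<cdot> i = Id C X" "q \<cdot> j = Id C Y" "p \<cdot> j = zer Y X" "q \<cdot> i = zer X Y"
    "add (i \<cdot> p) (j \<cdot> q) = Id C P"
proof -
  obtain P i j p q where h: "i \<in> Hom C X P" "j \<in> Hom C Y P" "p \<in> Hom C P X" "q \<in> Hom C P Y"
    and pi: "p \<cdot> i = Id C X" and qj: "q \<cdot> j = Id C Y" and s: "add (i \<cdot> p) (j \<cdot> q) = Id C P"
    using ex_biproduct[OF assms] by auto
  note a = h[unfolded in_Hom]
  have P: "P \<in> Obj C" using a Cod_in_Obj by auto
  have ip: "i \<cdot> p \<in> Hom C P P" "j \<cdot> q \<in> Hom C P P" using h Comp_in_Hom by blast+
  have d: "diff (Id C P) (j \<cdot> q) = i \<cdot> p" using s by (rule diff_eqI) (use a in auto)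
  have "i \<cdot> (p \<cdot> j) = diff (Id C P) (j \<cdot> q) \<cdot> j" using a by (auto simp: d)
  also have "\<dots> = diff j (j \<cdot> (q \<cdot> j))" using a P by (subst diff_Comp) auto
  also have "\<dots> = zer Y P" using a qj by auto
  finally have "p \<cdot> (i \<cdot> (p \<cdot> j)) = zer Y X" using a assms by auto
  then have pj: "p \<cdot> j = zer Y X" using a pi Comp_assoc_Arr[of "p \<cdot> j" i p] by auto
  have "(q \<cdot> i) \<cdot> p = q \<cdot> diff (Id C P) (j \<cdot> q)" using a by (auto simp: d)
  also have "\<dots> = diff q ((q \<cdot> j) \<cdot> q)" using a P by (subst Comp_diff) auto
  also have "\<dots> = zer P Y" unfolding qj using a by auto
  finally have "((q \<cdot> i) \<cdot> p) \<cdot> i = zer X Y" using a assms by auto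
  then have qi: "q \<cdot> i = zer X Y" using a pi by auto
  show ?thesis by (rule that[of P i j p q]) (use a P pi qj pj qi s in auto)
qed

text \<open>This is the split extension with which other extensions are compared when
  \<open>Ext1\<close> vanishes.\<close>

lemma short_exact_biproduct:
  assumes "X \<in> Obj C" "Y \<in> Obj C"
  obtains P i q p where "short_exact C X i P q Y" "p \<in> Hom C P X" "p \<cdot> i = Id C X"
proof -
  from biproduct[OF assms] obtain P i j p q where a: "P \<in> Obj C"
    "i \<in> Arr C" "Dom C i = X" "Cod C i = P" "j \<in> Arr C" "Dom C j = Y" "Cod C j = P"
    "p \<in> Arr C" "Dom C p = P" "Cod C p = X" "q \<in> Arr C" "Dom C q = P" "Cod C q = Y"
    and e: "p \<cdot> i = Id C X" "q \<cdot> j = Id C Y" "p \<cdot> j = zer Y X" "q \<cdot> i = zer X Y"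
    and s: "add (i \<cdot> p) (j \<cdot> q) = Id C P" .
  have m: "monic C i" by (rule monic_Comp_right[of p]) (use a e monic_Id assms in auto)
  have ep: "epic C q" by (rule epic_Comp_left[of _ j]) (use a e epic_Id assms in auto)
  have "is_kernel C q i"
  proof (rule is_kernelI[OF _ m])
    fix g assume g: "g \<in> Arr C" "Cod C g = Dom C q" "q \<cdot> g = zer (Dom C g) (Cod C q)"
    have "g = add (i \<cdot> p) (j \<cdot> q) \<cdot> g" using g a by (simp add: s)
    also have "\<dots> = add ((i \<cdot> p) \<cdot> g) ((j \<cdot> q) \<cdot> g)"
      by (rule Comp_add_left[of _ "Dom C g" P _ P]) (use g a in \<open>auto simp: in_Hom\<close>)
    also have "\<dots> = i \<cdot> (p \<cdot> g)" using g a by simp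
    finally show "\<exists>u\<in>Hom C (Dom C g) (Dom C i). i \<cdot> u = g"
      using g a by (intro bexI[of _ "p \<cdot> g"]) (auto simp: in_Hom)
  qed (use a e in auto)
  moreover have "is_cokernel C i q"
  proof (rule is_cokernelI[OF _ ep])
    fix g assume g: "g \<in> Arr C" "Dom C g = Cod C i" "g \<cdot> i = zer (Dom C i) (Cod C g)"
    have "g = g \<cdot> add (i \<cdot> p) (j \<cdot> q)" using g a by (simp add: s)
    also have "\<dots> = add (g \<cdot> (i \<cdot> p)) (g \<cdot> (j \<cdot> q))"
      by (rule Comp_add_right[of _ P P _ _ "Cod C g"]) (use g a in \<open>auto simp: in_Hom\<close>)
    also have "g \<cdot> (i \<cdot> p) = (g \<cdot> i) \<cdot> p" using g a by (simp del: Comp_assoc_Arr add: Comp_assoc_Arr[symmetric])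
    also have "\<dots> = zer P (Cod C g)" using g a by simp
    also have "add (zer P (Cod C g)) (g \<cdot> (j \<cdot> q)) = (g \<cdot> j) \<cdot> q" using g a by simp
    finally show "\<exists>u\<in>Hom C (Cod C q) (Cod C g). u \<cdot> q = g"
      using g a by (intro bexI[of _ "g \<cdot> j"]) (auto simp: in_Hom)
  qed (use a e in auto)
  ultimately have "short_exact C X i P q Y" using a by (auto simp: short_exact_def in_Hom)
  then show ?thesis using a e by (intro that) (auto simp: in_Hom)
qed

text \<open>The pullback is the kernel of the difference \<open>d\<close> of the two arrows out of
  the biproduct. On the first summand \<open>d\<close> is \<open>f\<close>, so \<open>d\<close> is
  epic and hence the cokernel of that kernel; this is what makes the projection \<open>k\<close>
  epic.\<close>

lemma pullback_of_epic:
  assumes f: "epic C f" and g: "g \<in> Arr C" "Cod C f = Cod C g"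
  obtains h k where "pullback C f g h k" "epic C k"
proof -
  note f' = epic_Arr[OF f]
  obtain P i j p q where a: "P \<in> Obj C"
    "i \<in> Arr C" "Dom C i = Dom C f" "Cod C i = P" "j \<in> Arr C" "Dom C j = Dom C g" "Cod C j = P"
    "p \<in> Arr C" "Dom C p = P" "Cod C p = Dom C f" "q \<in> Arr C" "Dom C q = P" "Cod C q = Dom C g"
    and e: "p \<cdot> i = Id C (Dom C f)" "q \<cdot> j = Id C (Dom C g)"
      "p \<cdot> j = zer (Dom C g) (Dom C f)" "q \<cdot> i = zer (Dom C f) (Dom C g)"
    and s: "add (i \<cdot> p) (j \<cdot> q) = Id C P"
    by (rule biproduct[OF Obj_Dom_Cod(1)[OF f'] Obj_Dom_Cod(1)[OF g(1)]])
  define d where "d = diff (f \<cdot> p) (g \<cdot> q)"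
  have d: "d \<in> Arr C" "Dom C d = P" "Cod C d = Cod C g"
    unfolding d_def using a g f' by auto
  obtain \<kappa> where \<kappa>: "is_kernel C d \<kappa>" using ex_kernel[OF d(1)] ..
  note k = is_kernelD[OF \<kappa>] kernel_monic[OF \<kappa>]
  have dx: "d \<cdot> x = diff (f \<cdot> (p \<cdot> x)) (g \<cdot> (q \<cdot> x))" if "x \<in> Arr C" "Cod C x = P" for x
    unfolding d_def using that a g f' by (subst diff_Comp) auto
  have split: "x = add (i \<cdot> (p \<cdot> x)) (j \<cdot> (q \<cdot> x))" if "x \<in> Arr C" "Cod C x = P" for x
  proof -
    have "x = add (i \<cdot> p) (j \<cdot> q) \<cdot> x" using that by (simp add: s)
    also have "\<dots> = add ((i \<cdot> p) \<cdot> x) ((j \<cdot> q) \<cdot> x)"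
      by (rule Comp_add_left[of _ "Dom C x" P _ P]) (use that a in \<open>auto simp: in_Hom\<close>)
    finally show ?thesis using that a by simp
  qed
  have "pullback C f g (p \<cdot> \<kappa>) (q \<cdot> \<kappa>)"
    unfolding pullback_def
  proof (intro conjI ballI impI)
    have "diff (f \<cdot> (p \<cdot> \<kappa>)) (g \<cdot> (q \<cdot> \<kappa>)) = zer (Dom C (g \<cdot> (q \<cdot> \<kappa>))) (Cod C (g \<cdot> (q \<cdot> \<kappa>)))"
      using dx[of \<kappa>] k d a g f' by simp
    then show "f \<cdot> (p \<cdot> \<kappa>) = g \<cdot> (q \<cdot> \<kappa>)"
      by (subst (asm) diff_eq_zer_iff) (use k d a g f' in auto)
    fix x y assume xy: "x \<in> Arr C" "y \<in> Arr C"
      "Dom C x = Dom C y \<and> Cod C x = Dom C f \<and> Cod C y = Dom C g \<and> f \<cdot> x = g \<cdot> y"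
    define z where "z = add (i \<cdot> x) (j \<cdot> y)"
    have z: "z \<in> Arr C" "Dom C z = Dom C y" "Cod C z = P" using xy a by (auto simp: z_def)
    have "p \<cdot> z = add (p \<cdot> (i \<cdot> x)) (p \<cdot> (j \<cdot> y))" unfolding z_def
      by (rule Comp_add_right[of _ "Dom C x" P _ _ "Dom C f"]) (use xy a in \<open>auto simp: in_Hom\<close>)
    also have "\<dots> = add ((p \<cdot> i) \<cdot> x) ((p \<cdot> j) \<cdot> y)" using xy a by simp
    finally have pz: "p \<cdot> z = x" unfolding e using xy a f' by simp
    have "q \<cdot> z = add (q \<cdot> (i \<cdot> x)) (q \<cdot> (j \<cdot> y))" unfolding z_def
      by (rule Comp_add_right[of _ "Dom C x" P _ _ "Dom C g"]) (use xy a in \<open>auto simp: in_Hom\<close>)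
    also have "\<dots> = add ((q \<cdot> i) \<cdot> x) ((q \<cdot> j) \<cdot> y)" using xy a by simp
    finally have qz: "q \<cdot> z = y" unfolding e using xy a g by simp
    have "d \<cdot> z = zer (Dom C z) (Cod C d)"
      using dx[OF z(1,3)] unfolding pz qz using xy z g d by simp
    then obtain u where u: "u \<in> Arr C" "Dom C u = Dom C z" "Cod C u = Dom C \<kappa>" "\<kappa> \<cdot> u = z"
      using kernel_factor[OF \<kappa> z(1)] z d by metis
    show "\<exists>!u. u \<in> Hom C (Dom C x) (Dom C (p \<cdot> \<kappa>)) \<and> (p \<cdot> \<kappa>) \<cdot> u = x \<and> (q \<cdot> \<kappa>) \<cdot> u = y"
    proof (rule ex1I[of _ u])
      show "u \<in> Hom C (Dom C x) (Dom C (p \<cdot> \<kappa>)) \<and> (p \<cdot> \<kappa>) \<cdot> u = x \<and> (q \<cdot> \<kappa>) \<cdot> u = y"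
        using u z xy pz qz k a d by (auto simp: in_Hom)
      fix v assume v: "v \<in> Hom C (Dom C x) (Dom C (p \<cdot> \<kappa>)) \<and> (p \<cdot> \<kappa>) \<cdot> v = x \<and> (q \<cdot> \<kappa>) \<cdot> v = y"
      have v': "v \<in> Arr C" "Cod C v = Dom C \<kappa>" "Dom C v = Dom C x" "p \<cdot> (\<kappa> \<cdot> v) = x" "q \<cdot> (\<kappa> \<cdot> v) = y"
        using v k a d by (auto simp: in_Hom)
      have "\<kappa> \<cdot> v = add (i \<cdot> (p \<cdot> (\<kappa> \<cdot> v))) (j \<cdot> (q \<cdot> (\<kappa> \<cdot> v)))"
        by (rule split) (use v' k d in auto)
      also have "\<dots> = z" unfolding v' z_def ..
      finally have "\<kappa> \<cdot> v = z" .
      then have "\<kappa> \<cdot> v = \<kappa> \<cdot> u" by (simp only: u(4))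
      moreover have "Dom C v = Dom C u" using v'(3) u(2) z(2) xy(3) by metis
      ultimately show "v = u" by (rule monic_cancel[OF k(5) _ v'(1) u(1) _ v'(2) u(3)])
    qed
  qed (use k d a g f' in auto)
  moreover have "epic C (q \<cdot> \<kappa>)"
  proof (rule epic_if_zero)
    fix y assume y: "y \<in> Arr C" "Dom C y = Cod C (q \<cdot> \<kappa>)"
      "y \<cdot> (q \<cdot> \<kappa>) = zer (Dom C (q \<cdot> \<kappa>)) (Cod C y)"
    have di: "d \<cdot> i = f" using dx[of i] a e g f' by simp
    have "epic C d"
      by (rule epic_Comp_left[of _ i]) (use d a f in \<open>simp_all add: di\<close>)
    then have "is_cokernel C \<kappa> d" using \<kappa> by (rule epic_cokernel_of_kernel)
    \<comment> \<open>If \<open>y\<close> kills the projection, then \<open>y \<cdot> q\<close>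
      factors through \<open>d\<close>. On the first summand \<open>q\<close> vanishes while
      \<open>d\<close> is the epic \<open>f\<close>, so the factor \<open>w\<close> is zero; on the
      second summand this gives that \<open>y\<close> is zero.\<close>
    then obtain w where w: "w \<in> Arr C" "Cod C w = Cod C y" "Dom C w = Cod C d" "w \<cdot> d = y \<cdot> q"
      using cokernel_factor[of \<kappa> d "y \<cdot> q"] y k d a by auto
    have "w \<cdot> f = (w \<cdot> d) \<cdot> i" using w(1,3) a d Comp_assoc_Arr[of i d w] by (simp add: di)
    also have "\<dots> = zer (Dom C f) (Cod C w)" unfolding w(4) using a y w k e g d f' by simp
    finally have "w = zer (Cod C f) (Cod C w)" using epic_Comp_zerD[OF f w(1)] w d g by simp
    then have yq: "y \<cdot> q = zer P (Cod C y)" using w(1,2,4) d g by (metis Obj_Dom_Cod(2) zer_Comp)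
    have "y = (y \<cdot> q) \<cdot> j" using y a e k d by simp
    then have "y = zer (Dom C y) (Cod C y)" unfolding yq using a y k d by simp
    then show "zer (Dom C y) (Cod C y) = y" ..
  qed (use k d a in auto)
  ultimately show ?thesis by (rule that)
qed

text \<open>For monicity of \<open>m\<close>, an arrow killed by \<open>m\<close> is lifted along
  the epic \<open>c\<close> by a pullback. The lift is killed by \<open>f\<close>, so it factors
  through the kernel \<open>k\<close>, and \<open>c\<close> kills \<open>k\<close>.\<close>

lemma coimage_factorization:
  assumes "is_kernel C f k" "is_cokernel C k c"
  obtains m where "monic C m" "Dom C m = Cod C c" "Cod C m = Cod C f" "m \<cdot> c = f"
proof -
  note k = is_kernelD[OF assms(1)] and c = is_cokernelD[OF assms(2)] cokernel_epic[OF assms(2)]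
  obtain m where m: "m \<in> Arr C" "Cod C m = Cod C f" "Dom C m = Cod C c" "m \<cdot> c = f"
    using cokernel_factor[OF assms(2), of f] k by metis
  have "monic C m"
  proof (rule monic_if_zero[OF m(1)])
    fix x assume x: "x \<in> Arr C" "Cod C x = Dom C m" "m \<cdot> x = zer (Dom C x) (Cod C m)"
    then obtain h e where pb: "pullback C c x h e" and e: "epic C e"
      using pullback_of_epic[OF c(5), of x] m by metis
    note p = pullbackD[OF pb]
    have "f \<cdot> h = m \<cdot> (c \<cdot> h)" using m(1,3) p c by (simp flip: m(4))
    also have "\<dots> = m \<cdot> (x \<cdot> e)" using p by simp
    also have "\<dots> = (m \<cdot> x) \<cdot> e" using x(1,2) m(1) p by simp
    also have "(m \<cdot> x) \<cdot> e = zer (Dom C h) (Cod C f)" unfolding x(3) using m(1,2) p k by simp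
    finally obtain y where y: "y \<in> Arr C" "Dom C y = Dom C h" "Cod C y = Dom C k" "k \<cdot> y = h"
      using kernel_factor[OF assms(1) p(3)] p c k by metis
    have "x \<cdot> e = c \<cdot> (k \<cdot> y)" using p(9) y(4) by simp
    also have "\<dots> = (c \<cdot> k) \<cdot> y" by (rule Comp_assoc_Arr[symmetric]) (use y(1-3) c k in simp_all)
    also have "\<dots> = zer (Dom C e) (Cod C x)" unfolding c(4) using p y c by simp
    finally show "zer (Dom C x) (Cod C x) = x" using epic_Comp_zerD[OF e x(1)] p by simp
  qed
  then show ?thesis using m by (intro that)
qed

lemma image_factorization:
  assumes "is_cokernel C f c" "is_kernel C c m"
  obtains e where "epic C e" "Cod C e = Dom C m" "Dom C e = Dom C f" "m \<cdot> e = f"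
  using abelian_category.coimage_factorization[OF abelian_category_opposite, of f c m] assms by auto

lemma epic_monic_factorization:
  assumes "f \<in> Arr C"
  obtains m e where "monic C m" "epic C e" "Dom C m = Cod C e" "Cod C m = Cod C f" "Dom C e = Dom C f" "m \<cdot> e = f"
proof -
  obtain k where k: "is_kernel C f k" using ex_kernel[OF assms] ..
  then obtain c where c: "is_cokernel C k c" using ex_cokernel is_kernelD by blast
  from coimage_factorization[OF k c] obtain m where
    "monic C m" "Dom C m = Cod C c" "Cod C m = Cod C f" "m \<cdot> c = f" .
  then show ?thesis using cokernel_epic[OF c] is_cokernelD[OF c] is_kernelD[OF k] by (intro that[of m c]) auto
qed

lemma short_exact_kernel:
  assumes "epic C e" "is_kernel C e k" shows "short_exact C (Dom C k) k (Dom C e) e (Cod C e)"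
  using is_kernelD[OF assms(2)] epic_cokernel_of_kernel[OF assms] assms(2)
  by (simp add: short_exact_def in_Hom)

lemma short_exact_cokernel:
  assumes "monic C m" "is_cokernel C m c" shows "short_exact C (Dom C m) m (Cod C m) c (Cod C c)"
  using is_cokernelD[OF assms(2)] monic_kernel_of_cokernel[OF assms] assms(2)
  by (simp add: short_exact_def in_Hom)

end

section \<open>Arrows modulo a Serre subcategory\<close>

definition negligible :: "('o, 'a) cat \<Rightarrow> 'o set \<Rightarrow> 'a \<Rightarrow> bool" where
  "negligible C \<B> f \<longleftrightarrow> (\<exists>a \<in> Arr C. \<exists>b \<in> Arr C. Cod C a \<in> \<B> \<and> Dom C b = Cod C a \<and> f = b \<cdot>\<^bsub>C\<^esub> a)"

text \<open>Monicity in the quotient, expressed inside \<open>A\<close>. Testing single arrows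
  suffices by additivity: applied to a difference, the condition cancels congruent pairs. In this
  form composition and duality are immediate, which the kernel condition in \<open>quot_weq\<close>
  hides.\<close>

definition mono_mod :: "('o, 'a) cat \<Rightarrow> 'o set \<Rightarrow> 'a \<Rightarrow> bool" where
  "mono_mod C \<B> s \<longleftrightarrow> s \<in> Arr C \<and>
     (\<forall>x \<in> Arr C. Cod C x = Dom C s \<and> negligible C \<B> (s \<cdot>\<^bsub>C\<^esub> x) \<longrightarrow> negligible C \<B> x)"

definition epi_mod :: "('o, 'a) cat \<Rightarrow> 'o set \<Rightarrow> 'a \<Rightarrow> bool" where
  "epi_mod C \<B> s \<longleftrightarrow> s \<in> Arr C \<and>
     (\<forall>x \<in> Arr C. Dom C x = Cod C s \<and> negligible C \<B> (x \<cdot>\<^bsub>C\<^esub> s) \<longrightarrow> negligible C \<B> x)"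

lemma negligible_opposite [simp]: "negligible (opposite C) \<B> f \<longleftrightarrow> negligible C \<B> f"
  unfolding negligible_def by (auto; metis)

lemma mono_mod_opposite [simp]: "mono_mod (opposite C) \<B> f \<longleftrightarrow> epi_mod C \<B> f"
  by (simp add: mono_mod_def epi_mod_def)

lemma epi_mod_opposite [simp]: "epi_mod (opposite C) \<B> f \<longleftrightarrow> mono_mod C \<B> f"
  by (simp add: mono_mod_def epi_mod_def)

lemma quot_weq_opposite [simp]: "quot_weq (opposite C) \<B> = quot_weq C \<B>"
  by (auto simp: quot_weq_def)

locale serre_quotient = abelian_category A add
  for A :: "('o, 'a) cat" (structure) and add +
  fixes \<B> :: "'o set"
  assumes serre: "serre_subcategory A \<B>"
begin

abbreviation "negl \<equiv> negligible A \<B>"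
abbreviation "W \<equiv> quot_weq A \<B>"

lemma serre_quotient_opposite: "serre_quotient (opposite A) add \<B>"
  by (intro serre_quotient.intro abelian_category_opposite serre_quotient_axioms.intro) (simp add: serre)

section \<open>Objects of \<open>\<B>\<close>, negligible arrows and cancellation modulo
  them\<close>

lemma serre_short_exact: "short_exact A X i Y p Z \<Longrightarrow> Y \<in> \<B> \<longleftrightarrow> X \<in> \<B> \<and> Z \<in> \<B>"
  using serre unfolding serre_subcategory_def by blast

lemma serre_Obj: "X \<in> \<B> \<Longrightarrow> X \<in> Obj A"
  using serre unfolding serre_subcategory_def full_subcategory_def by blast

lemma serre_monic: assumes "monic A m" "Cod A m \<in> \<B>" shows "Dom A m \<in> \<B>"
  using ex_cokernel[OF monic_Arr[OF assms(1)]] short_exact_cokernel[OF assms(1)] serre_short_exact assms(2)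
  by blast

lemma serre_epic: "epic A m \<Longrightarrow> Dom A m \<in> \<B> \<Longrightarrow> Cod A m \<in> \<B>"
  using serre_quotient.serre_monic[OF serre_quotient_opposite, of m] by simp

lemma negligibleI: "a \<in> Arr A \<Longrightarrow> b \<in> Arr A \<Longrightarrow> Cod A a \<in> \<B> \<Longrightarrow> Dom A b = Cod A a \<Longrightarrow> negl (b \<cdot> a)"
  unfolding negligible_def by blast

text \<open>A zero arrow factors through every object, and \<open>\<B>\<close> is nonempty.\<close>

lemma negl_zer [simp]: assumes "X \<in> Obj A" "Y \<in> Obj A" shows "negl (zer X Y)"
proof -
  from serre obtain Z where Z: "Z \<in> \<B>" unfolding serre_subcategory_def by blast
  then have "zer X Y = zer Z Y \<cdot> zer X Z" using assms serre_Obj by simp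
  then show ?thesis using negligibleI[of "zer X Z" "zer Z Y"] Z serre_Obj assms by simp
qed

lemma negl_Comp_left:
  assumes "negl f" "g \<in> Arr A" "Dom A g = Cod A f" shows "negl (g \<cdot> f)"
proof -
  from assms obtain a b where ab: "a \<in> Arr A" "b \<in> Arr A" "Cod A a \<in> \<B>" "Dom A b = Cod A a" "f = b \<cdot> a"
    unfolding negligible_def by blast
  then have "g \<cdot> f = (g \<cdot> b) \<cdot> a" using assms by simp
  then show ?thesis using negligibleI[of a "g \<cdot> b"] ab assms by simp
qed

lemma negl_Comp_right: "negl f \<Longrightarrow> g \<in> Arr A \<Longrightarrow> Cod A g = Dom A f \<Longrightarrow> negl (f \<cdot> g)"
  using serre_quotient.negl_Comp_left[OF serre_quotient_opposite, of f g] by simp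

text \<open>The image of an arrow factoring as \<open>b \<cdot> a\<close> through an object of
  \<open>\<B>\<close> is a subquotient of that object: the coimage of \<open>a\<close> is a
  subobject of it, and \<open>e\<close> factors through the coimage because \<open>m\<close> is
  monic and so \<open>e\<close> kills the kernel of \<open>a\<close>.\<close>

lemma negl_monic_epic:
  assumes m: "monic A m" and e: "epic A e" and "Dom A m = Cod A e" and n: "negl (m \<cdot> e)"
  shows "Cod A e \<in> \<B>"
proof -
  note me = monic_Arr[OF m] epic_Arr[OF e]
  from n obtain a b where ab: "a \<in> Arr A" "b \<in> Arr A" "Cod A a \<in> \<B>" "Dom A b = Cod A a" "m \<cdot> e = b \<cdot> a"
    unfolding negligible_def by blast
  have dom: "Dom A a = Dom A e" "Cod A b = Cod A m" using ab me assms(3) by (metis Comp_simps)+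
  obtain k where k: "is_kernel A a k" using ex_kernel[OF ab(1)] ..
  note k' = is_kernelD[OF k]
  obtain c where c: "is_cokernel A k c" using ex_cokernel[OF k'(2)] ..
  note c' = is_cokernelD[OF c]
  from coimage_factorization[OF k c] obtain l where l: "monic A l" "Dom A l = Cod A c" "Cod A l = Cod A a" .
  then have cB: "Cod A c \<in> \<B>" using serre_monic ab(3) by metis
  have "m \<cdot> (e \<cdot> k) = b \<cdot> (a \<cdot> k)" by (rule Comp_eq_extend) (use ab me assms k' dom in auto)
  then have "e \<cdot> k = zer (Dom A (e \<cdot> k)) (Dom A m)"
    by (intro monic_Comp_zerD[OF m]) (use ab me assms k' dom in auto)
  also have "\<dots> = zer (Dom A k) (Cod A e)" using me(2) k' dom(1) assms(3) by simp
  finally have ek: "e \<cdot> k = zer (Dom A k) (Cod A e)" .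
  have "Dom A e = Cod A k" using k' dom by simp
  from cokernel_factor[OF c me(2) this ek] obtain w where
    w: "w \<in> Arr A" "Cod A w = Cod A e" "Dom A w = Cod A c" "w \<cdot> c = e" .
  have "epic A w" by (rule epic_Comp_left[of _ c]) (use w(1,3) c'(2) e in \<open>simp_all add: w(4)\<close>)
  then show ?thesis using serre_epic[of w] w cB by simp
qed

lemma negl_monic: assumes "negl m" "monic A m" shows "Dom A m \<in> \<B>"
  using negl_monic_epic[OF assms(2) epic_Id, of "Dom A m"] assms monic_Arr by auto

text \<open>The image of \<open>x\<close> is an extension of two objects of \<open>\<B>\<close>. Its
  further image under \<open>s\<close> is the image of the negligible \<open>s \<cdot> x\<close>;
  the part of it killed by \<open>s\<close> embeds into the kernel of \<open>s\<close>. This is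
  where closure of \<open>\<B>\<close> under extensions enters.\<close>

lemma mono_mod_if_kernel:
  assumes s: "is_kernel A s k" and kB: "Dom A k \<in> \<B>"
  shows "mono_mod A \<B> s"
  unfolding mono_mod_def
proof (intro conjI ballI impI)
  note k = is_kernelD[OF s]
  show "s \<in> Arr A" by (rule k)
  have null: "negl x" if x: "x \<in> Arr A" "Cod A x = Dom A s" "s \<cdot> x = zer (Dom A x) (Cod A s)" for x
  proof -
    obtain u where u: "u \<in> Arr A" "Dom A u = Dom A x" "Cod A u = Dom A k" "k \<cdot> u = x"
      by (rule kernel_factor[OF s x])
    have "negl (k \<cdot> u)" by (rule negligibleI) (use u(1,3) k kB in simp_all)
    then show ?thesis unfolding u(4) .
  qed
  fix x assume x: "x \<in> Arr A" "Cod A x = Dom A s \<and> negl (s \<cdot> x)"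
  from epic_monic_factorization[OF x(1)] obtain m c where mc: "monic A m" "epic A c"
    "Dom A m = Cod A c" "Cod A m = Cod A x" "Dom A c = Dom A x" "m \<cdot> c = x" .
  note mc' = monic_Arr[OF mc(1)] epic_Arr[OF mc(2)]
  have sm: "s \<cdot> m \<in> Arr A" using k(1) mc x mc' by simp
  from epic_monic_factorization[OF sm] obtain n d where nd: "monic A n" "epic A d"
    "Dom A n = Cod A d" "Cod A n = Cod A (s \<cdot> m)" "Dom A d = Dom A (s \<cdot> m)" "n \<cdot> d = s \<cdot> m" .
  note nd' = monic_Arr[OF nd(1)] epic_Arr[OF nd(2)]
  have dd: "Dom A d = Dom A m" "Cod A n = Cod A s" using nd k mc mc' x by simp_all
  have "n \<cdot> (d \<cdot> c) = s \<cdot> (m \<cdot> c)"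
    by (rule Comp_eq_extend) (use nd nd' mc mc' k x dd in auto)
  then have "negl (n \<cdot> (d \<cdot> c))" using mc x by simp
  moreover have dc: "epic A (d \<cdot> c)" using epic_Comp[OF nd(2) mc(2)] dd mc by simp
  ultimately have dB: "Cod A d \<in> \<B>"
    using negl_monic_epic[OF nd(1), of "d \<cdot> c"] nd nd' mc mc' dd by simp
  obtain \<kappa> where \<kappa>: "is_kernel A d \<kappa>" using ex_kernel nd' by blast
  note \<kappa>' = is_kernelD[OF \<kappa>]
  have "s \<cdot> (m \<cdot> \<kappa>) = n \<cdot> (d \<cdot> \<kappa>)"
    by (rule Comp_eq_extend) (use nd nd' mc mc' k x dd \<kappa>' in auto)
  then have "negl (m \<cdot> \<kappa>)"
    using \<kappa>' nd nd' mc mc' dd x k(1) by (intro null) auto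
  moreover have "monic A (m \<cdot> \<kappa>)" using monic_Comp[OF mc(1) kernel_monic[OF \<kappa>]] \<kappa>' dd by simp
  ultimately have "Dom A \<kappa> \<in> \<B>" using negl_monic[of "m \<cdot> \<kappa>"] \<kappa>' mc' dd by simp
  then have "Cod A c \<in> \<B>" using serre_short_exact[OF short_exact_kernel[OF nd(2) \<kappa>]] dB dd mc by simp
  moreover have "negl (m \<cdot> c)" if "Cod A c \<in> \<B>" by (rule negligibleI) (use that mc(3) mc' in simp_all)
  ultimately show "negl x" unfolding mc(6) by blast
qed

text \<open>It is enough to test arrows that \<open>s\<close> kills outright, because the kernel is
  one of them: a negligible monic has its domain in \<open>\<B>\<close>.\<close>

lemma mono_mod_if_zero:
  assumes "s \<in> Arr A"
    "\<And>x. x \<in> Arr A \<Longrightarrow> Cod A x = Dom A s \<Longrightarrow> s \<cdot> x = zer (Dom A x) (Cod A s) \<Longrightarrow> negl x"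
  shows "mono_mod A \<B> s"
proof -
  obtain k where k: "is_kernel A s k" using ex_kernel[OF assms(1)] ..
  have "negl k" by (rule assms(2)) (use is_kernelD[OF k] in simp_all)
  then show ?thesis using mono_mod_if_kernel[OF k] negl_monic kernel_monic[OF k] by blast
qed

lemma mono_mod_monic: assumes "monic A m" shows "mono_mod A \<B> m"
proof -
  obtain k where k: "is_kernel A m k" using ex_kernel monic_Arr[OF assms] by blast
  note k' = is_kernelD[OF k]
  have "k = zer (Dom A k) (Dom A m)" by (rule monic_Comp_zerD[OF assms]) (use k' in auto)
  then have "negl k" using k' by (metis Obj_Dom_Cod(1) negl_zer)
  then show ?thesis using mono_mod_if_kernel[OF k] negl_monic kernel_monic[OF k] by blast
qed

lemma kernel_if_mono_mod: assumes "is_kernel A s k" "mono_mod A \<B> s" shows "Dom A k \<in> \<B>"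
proof (rule negl_monic)
  show "negl k" using assms is_kernelD[OF assms(1)] unfolding mono_mod_def by simp
qed (rule kernel_monic[OF assms(1)])

lemma mono_mod_iff: "mono_mod A \<B> s \<longleftrightarrow> s \<in> Arr A \<and> (\<exists>k. is_kernel A s k \<and> Dom A k \<in> \<B>)"
  using mono_mod_if_kernel kernel_if_mono_mod ex_kernel mono_mod_def by metis

lemma epi_mod_iff: "epi_mod A \<B> s \<longleftrightarrow> s \<in> Arr A \<and> (\<exists>k. is_cokernel A s k \<and> Cod A k \<in> \<B>)"
  using serre_quotient.mono_mod_iff[OF serre_quotient_opposite, of s] by simp

lemma epi_mod_epic: "epic A m \<Longrightarrow> epi_mod A \<B> m"
  using serre_quotient.mono_mod_monic[OF serre_quotient_opposite, of m] by simp

lemma cokernel_if_epi_mod: "is_cokernel A s k \<Longrightarrow> epi_mod A \<B> s \<Longrightarrow> Cod A k \<in> \<B>"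
  using serre_quotient.kernel_if_mono_mod[OF serre_quotient_opposite, of s k] by simp

lemma W_iff: "s \<in> W \<longleftrightarrow> mono_mod A \<B> s \<and> epi_mod A \<B> s"
  unfolding quot_weq_def mono_mod_iff epi_mod_iff by blast

lemma W_mono_mod: "s \<in> W \<Longrightarrow> mono_mod A \<B> s" and W_epi_mod: "s \<in> W \<Longrightarrow> epi_mod A \<B> s"
  by (simp_all add: W_iff)

lemma W_Arr [simp]: "s \<in> W \<Longrightarrow> s \<in> Arr A"
  by (simp add: quot_weq_def)

lemma mono_mod_Comp:
  assumes "mono_mod A \<B> f" "mono_mod A \<B> g" "Cod A f = Dom A g"
  shows "mono_mod A \<B> (g \<cdot> f)"
  using assms unfolding mono_mod_def by (auto simp: mono_mod_def)

lemma epi_mod_Comp: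
  "epi_mod A \<B> f \<Longrightarrow> epi_mod A \<B> g \<Longrightarrow> Cod A f = Dom A g \<Longrightarrow> epi_mod A \<B> (g \<cdot> f)"
  using serre_quotient.mono_mod_Comp[OF serre_quotient_opposite, of g f] by simp

lemma mono_mod_Comp_right:
  assumes "mono_mod A \<B> (g \<cdot> f)" "f \<in> Arr A" "g \<in> Arr A" "Cod A f = Dom A g"
  shows "mono_mod A \<B> f"
  unfolding mono_mod_def
proof (intro conjI ballI impI assms(2))
  fix x assume x: "x \<in> Arr A" "Cod A x = Dom A f \<and> negl (f \<cdot> x)"
  then have "negl ((g \<cdot> f) \<cdot> x)" using negl_Comp_left[of "f \<cdot> x" g] assms by simp
  then show "negl x" using assms x unfolding mono_mod_def by simp
qed

lemma epi_mod_Comp_left: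
  "epi_mod A \<B> (g \<cdot> f) \<Longrightarrow> f \<in> Arr A \<Longrightarrow> g \<in> Arr A \<Longrightarrow> Cod A f = Dom A g \<Longrightarrow> epi_mod A \<B> g"
  using serre_quotient.mono_mod_Comp_right[OF serre_quotient_opposite, of f g] by simp

lemma W_Comp [simp]: "f \<in> W \<Longrightarrow> g \<in> W \<Longrightarrow> Cod A f = Dom A g \<Longrightarrow> g \<cdot> f \<in> W"
  unfolding W_iff using mono_mod_Comp epi_mod_Comp by blast

lemma W_Id [simp]: "X \<in> Obj A \<Longrightarrow> Id A X \<in> W"
  unfolding W_iff using mono_mod_monic epi_mod_epic monic_Id epic_Id by blast

text \<open>The cokernel of \<open>k\<close> is the coimage of \<open>f\<close>, which lies in
  \<open>\<B>\<close> since \<open>f\<close> is negligible. This is a main source of arrows of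
  \<open>W\<close>.\<close>

lemma negl_kernel_W:
  assumes "negl f" "is_kernel A f k" shows "k \<in> W"
proof -
  note k = is_kernelD[OF assms(2)]
  obtain c where c: "is_cokernel A k c" using ex_cokernel[OF k(2)] ..
  from coimage_factorization[OF assms(2) c] obtain m where
    "monic A m" "Dom A m = Cod A c" "m \<cdot> c = f" .
  then have "Cod A c \<in> \<B>" using negl_monic_epic[OF _ cokernel_epic[OF c]] assms(1) by simp
  then show ?thesis using c k kernel_monic[OF assms(2)] mono_mod_monic epi_mod_iff W_iff by blast
qed

section \<open>Congruence of arrows modulo negligible differences\<close>

definition cong where
  "cong f g \<longleftrightarrow> f \<in> Arr A \<and> g \<in> Arr A \<and> Dom A f = Dom A g \<and> Cod A f = Cod A g \<and> negl (diff f g)"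

lemma congD:
  assumes "cong f g"
  shows "f \<in> Arr A" "g \<in> Arr A" "Dom A f = Dom A g" "Cod A f = Cod A g"
  using assms by (auto simp: cong_def)

lemma cong_refl: "f \<in> Arr A \<Longrightarrow> cong f f"
  by (simp add: cong_def)

lemma cong_zer_iff: "f \<in> Arr A \<Longrightarrow> cong f (zer (Dom A f) (Cod A f)) \<longleftrightarrow> negl f"
  by (simp add: cong_def)

text \<open>The kernel of the difference is the arrow sought. It converts congruences, which are
  easy to cancel, into the strict equalities demanded by \<open>roof_equiv\<close>.\<close>

lemma cong_equalizer:
  assumes "cong f g" obtains e where "e \<in> W" "Cod A e = Dom A f" "f \<cdot> e = g \<cdot> e"
proof -
  note a = congD[OF assms]
  obtain e where e: "is_kernel A (diff f g) e" using ex_kernel[of "diff f g"] a by auto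
  note e' = is_kernelD[OF e]
  have "diff (f \<cdot> e) (g \<cdot> e) = diff f g \<cdot> e" by (rule diff_Comp[symmetric]) (use a e' in auto)
  also have "\<dots> = zer (Dom A (g \<cdot> e)) (Cod A (g \<cdot> e))" unfolding e'(4) using e' a by simp
  finally have "f \<cdot> e = g \<cdot> e" by (subst (asm) diff_eq_zer_iff) (use a e' in auto)
  then show ?thesis using negl_kernel_W[OF _ e] assms e' a by (intro that[of e]) (auto simp: cong_def)
qed

lemma cong_if_equalized:
  assumes "f \<in> Arr A" "g \<in> Arr A" "Dom A f = Dom A g" "Cod A f = Cod A g"
    "epi_mod A \<B> e" "Cod A e = Dom A f" "cong (f \<cdot> e) (g \<cdot> e)"
  shows "cong f g"
proof -
  have e: "e \<in> Arr A" using assms by (simp add: epi_mod_def)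
  have "negl (diff f g \<cdot> e)" using assms e by (subst diff_Comp) (auto simp: cong_def)
  then show ?thesis using assms by (auto simp: cong_def epi_mod_def)
qed

lemma cong_mono_mod_cancel:
  assumes "f \<in> Arr A" "g \<in> Arr A" "Dom A f = Dom A g" "Cod A f = Dom A e" "Cod A g = Dom A e"
    "mono_mod A \<B> e" "cong (e \<cdot> f) (e \<cdot> g)"
  shows "cong f g"
proof -
  have e: "e \<in> Arr A" using assms by (simp add: mono_mod_def)
  have "negl (e \<cdot> diff f g)" using assms e by (subst Comp_diff) (auto simp: cong_def)
  then show ?thesis using assms by (auto simp: cong_def mono_mod_def)
qed

text \<open>Here and in \<open>cong_trans\<close> the argument avoids sums of negligible arrows:
  precomposition with an equaliser in \<open>W\<close> turns the first congruence into an equality,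
  and the equaliser is cancelled afterwards.\<close>

lemma cong_sym: assumes "cong f g" shows "cong g f"
proof -
  note a = congD[OF assms]
  obtain e where e: "e \<in> W" "Cod A e = Dom A f" "f \<cdot> e = g \<cdot> e" using cong_equalizer[OF assms] .
  then have "cong (g \<cdot> e) (f \<cdot> e)" using a by (simp add: cong_refl)
  from cong_if_equalized[OF _ _ _ _ W_epi_mod[OF e(1)] _ this] show ?thesis using a e(2) by simp
qed

lemma cong_trans: assumes "cong f g" "cong g h" shows "cong f h"
proof -
  note a = congD[OF assms(1)] congD[OF assms(2)]
  obtain e where e: "e \<in> W" "Cod A e = Dom A f" "f \<cdot> e = g \<cdot> e" using cong_equalizer[OF assms(1)] .
  have "negl (diff g h \<cdot> e)" using assms(2) e a by (intro negl_Comp_right) (auto simp: cong_def)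
  also have "diff g h \<cdot> e = diff (g \<cdot> e) (h \<cdot> e)" by (rule diff_Comp) (use e a in auto)
  finally have "cong (f \<cdot> e) (h \<cdot> e)" unfolding e(3) using a e(1,2) by (simp add: cong_def)
  from cong_if_equalized[OF _ _ _ _ W_epi_mod[OF e(1)] _ this] show ?thesis using a e(2) by simp
qed

lemma cong_Comp_left:
  assumes "cong f g" "h \<in> Arr A" "Dom A h = Cod A f" shows "cong (h \<cdot> f) (h \<cdot> g)"
proof -
  note a = congD[OF assms(1)]
  have "negl (h \<cdot> diff f g)" using assms a by (intro negl_Comp_left) (auto simp: cong_def)
  then show ?thesis using assms a Comp_diff[of f g h] by (simp add: cong_def)
qed

lemma cong_Comp_right:
  assumes "cong f g" "h \<in> Arr A" "Cod A h = Dom A f" shows "cong (f \<cdot> h) (g \<cdot> h)"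
proof -
  note a = congD[OF assms(1)]
  have "negl (diff f g \<cdot> h)" using assms a by (intro negl_Comp_right) (auto simp: cong_def)
  then show ?thesis using assms a diff_Comp[of f g h] by (simp add: cong_def)
qed

text \<open>Write \<open>s = m \<cdot> e\<close> with \<open>m\<close> the image. The preimage \<open>d\<close> of the image along \<open>g\<close> is the kernel of a
  negligible arrow; pulling back the epic \<open>e\<close> along the restriction of \<open>g\<close> finishes the square.\<close>

lemma ore:
  assumes s: "s \<in> W" and g: "g \<in> Arr A" "Cod A s = Cod A g"
  obtains u h where "u \<in> W" "Cod A u = Dom A g" "h \<in> Arr A" "Dom A h = Dom A u" "Cod A h = Dom A s"
    "s \<cdot> h = g \<cdot> u"
proof -
  note s' = W_Arr[OF s]
  obtain c where c: "is_cokernel A s c" using ex_cokernel[OF s'] ..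
  note c' = is_cokernelD[OF c]
  obtain m where m: "is_kernel A c m" using ex_kernel[OF c'(2)] ..
  note m' = is_kernelD[OF m]
  from image_factorization[OF c m] obtain e where e: "epic A e" "Cod A e = Dom A m" "Dom A e = Dom A s" "m \<cdot> e = s" .
  note e' = epic_Arr[OF e(1)]
  have cB: "Cod A c \<in> \<B>" using cokernel_if_epi_mod[OF c] s W_iff by blast
  have em: "mono_mod A \<B> e" 
    by (rule mono_mod_Comp_right[of m]) (use W_mono_mod[OF s] m' e(2) e' in \<open>simp_all add: e(4)\<close>)
  have cg: "negl (c \<cdot> g)"
    using negligibleI[of "c \<cdot> g" "Id A (Cod A c)"] c' g cB by simp
  have cgA: "c \<cdot> g \<in> Arr A" "Dom A (c \<cdot> g) = Dom A g" using c' g by auto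
  obtain d where d: "is_kernel A (c \<cdot> g) d" using ex_kernel[OF cgA(1)] ..
  note d' = is_kernelD[OF d]
  have dW: "d \<in> W" by (rule negl_kernel_W[OF cg d])
  have "c \<cdot> (g \<cdot> d) = zer (Dom A (g \<cdot> d)) (Cod A c)" using d' c' g by simp
  then obtain g' where g': "g' \<in> Arr A" "Dom A g' = Dom A d" "Cod A g' = Dom A m" "m \<cdot> g' = g \<cdot> d"
    using kernel_factor[OF m, of "g \<cdot> d"] d' c' g by auto
  obtain h k where pb: "pullback A e g' h k" and k: "epic A k"
    using pullback_of_epic[OF e(1) g'(1)] e g' by metis
  note p = pullbackD[OF pb]
  \<comment> \<open>Base change preserves cancellation. If \<open>k \<cdot> x\<close> is negligible,
    then \<open>y\<close> in \<open>W\<close> makes it zero; by the pullback square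
    \<open>h \<cdot> (x \<cdot> y)\<close> becomes negligible, and a further \<open>z\<close> in
    \<open>W\<close> makes it zero as well. Both projections now kill
    \<open>x \<cdot> (y \<cdot> z)\<close>, and \<open>y \<cdot> z\<close> is cancelled.\<close>
  have "mono_mod A \<B> k"
    unfolding mono_mod_def
  proof (intro conjI ballI impI p)
    fix x assume x: "x \<in> Arr A" "Cod A x = Dom A k \<and> negl (k \<cdot> x)"
    then have kx: "cong (k \<cdot> x) (zer (Dom A x) (Dom A g'))"
      using p by (metis Comp_simps cong_zer_iff)
    then obtain y where y: "y \<in> W" "Cod A y = Dom A (k \<cdot> x)" "(k \<cdot> x) \<cdot> y = zer (Dom A x) (Dom A g') \<cdot> y"
      by (rule cong_equalizer)
    have y': "Cod A y = Dom A x" using y x p by simp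
    have kxy: "k \<cdot> (x \<cdot> y) = zer (Dom A y) (Dom A g')" using y x p by simp
    have "e \<cdot> (h \<cdot> (x \<cdot> y)) = g' \<cdot> (k \<cdot> (x \<cdot> y))"
      by (rule Comp_eq_extend) (use p x y y' in auto)
    then have "negl (e \<cdot> (h \<cdot> (x \<cdot> y)))" unfolding kxy using p y x y' by simp
    then have "negl (h \<cdot> (x \<cdot> y))" using em x y y' p unfolding mono_mod_def by simp
    then have "cong (h \<cdot> (x \<cdot> y)) (zer (Dom A y) (Dom A e))"
      using p x y y' by (metis Comp_simps cong_zer_iff W_Arr)
    then obtain z where z: "z \<in> W" "Cod A z = Dom A (h \<cdot> (x \<cdot> y))"
        "(h \<cdot> (x \<cdot> y)) \<cdot> z = zer (Dom A y) (Dom A e) \<cdot> z"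
      by (rule cong_equalizer)
    have z': "Cod A z = Dom A y" using z x y y' p by simp
    have kxyz: "k \<cdot> (x \<cdot> (y \<cdot> z)) = zer (Dom A z) (Dom A g')"
    proof -
      have "k \<cdot> (x \<cdot> (y \<cdot> z)) = (k \<cdot> (x \<cdot> y)) \<cdot> z" using x y(1) y' z(1) z' p(1-8) by simp
      then show ?thesis unfolding kxy using z z' p y by simp
    qed
    have "x \<cdot> (y \<cdot> z) = zer (Dom A z) (Dom A h)"
      by (rule pullback_cancel[OF pb]) (use x y(1) y' z z' p kxyz in auto)
    then have "negl (x \<cdot> (y \<cdot> z))" using z p by simp
    moreover have "epi_mod A \<B> (y \<cdot> z)" using W_Comp[OF z(1) y(1) z'] W_iff by blast
    ultimately show "negl x" using x y(1) y' z z' unfolding epi_mod_def by simp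
  qed
  then have kW: "k \<in> W" using k epi_mod_epic W_iff by blast
  have "s \<cdot> h = m \<cdot> (e \<cdot> h)" using e' e p m' by (metis Comp_assoc_Arr)
  also have "\<dots> = (m \<cdot> g') \<cdot> k" unfolding p(9) using m' g'(1-3) p by simp
  also have "\<dots> = g \<cdot> (d \<cdot> k)" unfolding g'(4) using g d' p cgA g' by simp
  finally have "s \<cdot> h = g \<cdot> (d \<cdot> k)" .
  then show ?thesis using dW kW p g' d' cgA e by (intro that[of "d \<cdot> k" h]) auto
qed

lemma ore_opposite:
  assumes "s \<in> W" "g \<in> Arr A" "Dom A s = Dom A g"
  obtains u h where "u \<in> W" "Dom A u = Cod A g" "h \<in> Arr A" "Cod A h = Cod A u" "Dom A h = Cod A s"
    "h \<cdot> s = u \<cdot> g"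
  using serre_quotient.ore[OF serre_quotient_opposite, of s g] assms by auto

text \<open>A dual Ore square moves the test arrow \<open>y\<close> past \<open>g\<close>: with
  \<open>h \<cdot> g = u \<cdot> y\<close>, negligibility of \<open>y \<cdot> f\<close> passes to
  \<open>h \<cdot> (g \<cdot> f)\<close>, hence to \<open>h\<close>, hence to
  \<open>u \<cdot> y\<close>, and \<open>u\<close> is cancelled.\<close>

lemma epi_mod_Comp_right:
  assumes gf: "epi_mod A \<B> (g \<cdot> f)" and g: "g \<in> W" and f: "f \<in> Arr A" "Cod A f = Dom A g"
  shows "epi_mod A \<B> f"
  unfolding epi_mod_def
proof (intro conjI ballI impI f)
  note g' = W_Arr[OF g]
  fix y assume y: "y \<in> Arr A" "Dom A y = Cod A f \<and> negl (y \<cdot> f)"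
  then obtain u h where uh: "u \<in> W" "Dom A u = Cod A y" "h \<in> Arr A" "Cod A h = Cod A u"
    "Dom A h = Cod A g" "h \<cdot> g = u \<cdot> y"
    using ore_opposite[OF g y(1)] f by metis
  have "h \<cdot> (g \<cdot> f) = u \<cdot> (y \<cdot> f)" by (rule Comp_eq_extend) (use uh g' y f in auto)
  moreover have "negl (u \<cdot> (y \<cdot> f))" by (rule negl_Comp_left) (use y uh f in auto)
  ultimately have "negl (h \<cdot> (g \<cdot> f))" by simp
  then have "negl h" using gf uh g' f unfolding epi_mod_def by simp
  then have "negl (u \<cdot> y)" using negl_Comp_right[of h g] uh g' by simp
  then show "negl y" using uh y unfolding W_iff mono_mod_def by simp
qed

end

section \<open>The quotient category\<close>

context serre_quotient
begin

abbreviation "Q \<equiv> quotient_category A \<B>"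
abbreviation "roof s f \<equiv> s \<in> W \<and> f \<in> Arr A \<and> Dom A s = Dom A f"

text \<open>The arrow \<open>f \<cdot> s\<^sup>-\<^sup>1\<close> of the quotient.\<close>

definition frac where
  "frac s f = (Cod A s, roof_equiv A \<B> (Cod A s) (Cod A f) `` {(s, f)}, Cod A f)"

lemma in_roofs: "(s, f) \<in> roofs A \<B> X Y \<longleftrightarrow> roof s f \<and> Cod A s = X \<and> Cod A f = Y"
  by (auto simp: roofs_def)

lemma roof_equiv_iff:
  "((s, f), (s', f')) \<in> roof_equiv A \<B> X Y \<longleftrightarrow>
     roof s f \<and> roof s' f' \<and> Cod A s = X \<and> Cod A s' = X \<and> Cod A f = Y \<and> Cod A f' = Y \<and>
     (\<exists>u \<in> Arr A. \<exists>u' \<in> Arr A. Dom A u = Dom A u' \<and> Cod A u = Dom A s \<and> Cod A u' = Dom A s' \<and>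
        s \<cdot> u \<in> W \<and> s \<cdot> u = s' \<cdot> u' \<and> f \<cdot> u = f' \<cdot> u')"
  unfolding roof_equiv_def by (simp add: in_roofs in_Hom Bex_def) metis

text \<open>Congruences replace the strict equalities of the definition. Two successive equalisers,
  \<open>e\<close> for the left legs and \<open>d\<close> for the right legs, restore equality, and
  precomposition with them keeps the common left leg in \<open>W\<close>.\<close>

lemma roof_equivI:
  assumes r: "roof s f" "roof s' f'"
    and a: "a \<in> Arr A" "Cod A a = Dom A s" and a': "a' \<in> Arr A" "Cod A a' = Dom A s'"
    and c: "s \<cdot> a \<in> W" "cong (s \<cdot> a) (s' \<cdot> a')" "cong (f \<cdot> a) (f' \<cdot> a')"
  shows "((s, f), (s', f')) \<in> roof_equiv A \<B> (Cod A s) (Cod A f)"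
proof -
  note cs = congD[OF c(2)] congD[OF c(3)]
  have eqs: "Dom A a = Dom A a'" "Cod A s = Cod A s'" "Cod A f = Cod A f'"
    using cs r a a' by simp_all
  obtain e where e: "e \<in> W" "Cod A e = Dom A (s \<cdot> a)" "(s \<cdot> a) \<cdot> e = (s' \<cdot> a') \<cdot> e"
    using cong_equalizer[OF c(2)] .
  have e': "Cod A e = Dom A a" "Cod A e = Dom A a'" using e(2) a eqs r by simp_all
  have "cong ((f \<cdot> a) \<cdot> e) ((f' \<cdot> a') \<cdot> e)"
    by (rule cong_Comp_right[OF c(3)]) (use e e' a r in simp_all)
  then obtain d where d: "d \<in> W" "Cod A d = Dom A ((f \<cdot> a) \<cdot> e)"
    "((f \<cdot> a) \<cdot> e) \<cdot> d = ((f' \<cdot> a') \<cdot> e) \<cdot> d"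
    by (rule cong_equalizer)
  have d': "Cod A d = Dom A e" using d(2) a r e(1) e' by simp
  define u u' where "u = a \<cdot> (e \<cdot> d)" and "u' = a' \<cdot> (e \<cdot> d)"
  have u: "u \<in> Arr A" "Dom A u = Dom A u'" "Cod A u = Dom A s" "u' \<in> Arr A" "Cod A u' = Dom A s'"
    using a a' e(1) e' d(1) d' by (simp_all add: u_def u'_def)
  have su: "s \<cdot> u = (s \<cdot> a) \<cdot> (e \<cdot> d)" using r a e(1) e' d(1) d' by (simp add: u_def)
  have "s \<cdot> u \<in> W" unfolding su by (intro W_Comp c e d) (use r a e(1) e' d(1) d' in simp_all)
  moreover have "s \<cdot> u = s' \<cdot> u'"
  proof -
    have "s \<cdot> u = ((s \<cdot> a) \<cdot> e) \<cdot> d" using r a e(1) e' d(1) d' by (simp add: u_def)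
    also have "\<dots> = s' \<cdot> u'" unfolding e(3) using r a' e(1) e' d(1) d' by (simp add: u'_def)
    finally show ?thesis .
  qed
  moreover have "f \<cdot> u = f' \<cdot> u'"
  proof -
    have "f \<cdot> u = ((f \<cdot> a) \<cdot> e) \<cdot> d" using r a e(1) e' d(1) d' by (simp add: u_def)
    also have "\<dots> = f' \<cdot> u'" unfolding d(3) using r a' e(1) e' d(1) d' by (simp add: u'_def)
    finally show ?thesis .
  qed
  ultimately show ?thesis unfolding roof_equiv_iff using u r eqs(2,3)[symmetric] by blast
qed

text \<open>Equivalence asks for one square equalising the two roofs; up to negligible arrows, every
  square then does.\<close>

lemma roof_equivD:
  assumes q: "((s, f), (s', f')) \<in> roof_equiv A \<B> X Y"
    and a: "a \<in> Arr A" "Cod A a = Dom A s" and a': "a' \<in> Arr A" "Cod A a' = Dom A s'"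
    and c: "cong (s \<cdot> a) (s' \<cdot> a')"
  shows "cong (f \<cdot> a) (f' \<cdot> a')"
proof -
  from q have r: "roof s f" "roof s' f'" and XY: "Cod A s = Cod A s'" "Cod A f = Cod A f'"
    by (simp_all add: roof_equiv_iff)
  from q obtain u u' where u: "u \<in> Arr A" "Dom A u = Dom A u'" "Cod A u = Dom A s"
    and u': "u' \<in> Arr A" "Cod A u' = Dom A s'"
    and su: "s \<cdot> u \<in> W" "s \<cdot> u = s' \<cdot> u'" and fu: "f \<cdot> u = f' \<cdot> u'"
    unfolding roof_equiv_iff by blast
  have aa: "Dom A a = Dom A a'" using congD[OF c] a a' r by simp
  have sa: "s \<cdot> a \<in> Arr A" "Dom A (s \<cdot> a) = Dom A a" "Cod A (s \<cdot> a) = Cod A s" using r a by simp_all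
  \<comment> \<open>An Ore square relates the arbitrary pair \<open>a\<close>, \<open>a'\<close> to
    the equalising pair \<open>u\<close>, \<open>u'\<close>. The left legs are cancellable modulo
    \<open>\<B>\<close>, so \<open>a \<cdot> y\<close> and \<open>a' \<cdot> y\<close> are congruent
    to \<open>u \<cdot> x\<close> and \<open>u' \<cdot> x\<close>, where the right legs agree;
    finally \<open>y\<close> is cancelled.\<close>
  obtain y x where y: "y \<in> W" "Cod A y = Dom A (s \<cdot> a)" and x: "x \<in> Arr A" "Dom A x = Dom A y"
    "Cod A x = Dom A (s \<cdot> u)" and xy: "(s \<cdot> u) \<cdot> x = (s \<cdot> a) \<cdot> y"
    by (rule ore[OF su(1) sa(1)]) (use sa r u in auto)
  have x': "Cod A x = Dom A u'" and y': "Cod A y = Dom A a" "Cod A y = Dom A a'" and yA: "y \<in> Arr A"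
    using x y u r sa aa by simp_all
  have 1: "cong (u \<cdot> x) (a \<cdot> y)"
  proof (rule cong_mono_mod_cancel[OF _ _ _ _ _ W_mono_mod])
    show "cong (s \<cdot> (u \<cdot> x)) (s \<cdot> (a \<cdot> y))"
      using xy r u x(1) x' a yA y' cong_refl[of "s \<cdot> (a \<cdot> y)"] by simp
  qed (use r u x(1,2) x' a yA y' in simp_all)
  have sux: "s' \<cdot> (u' \<cdot> x) = (s \<cdot> u) \<cdot> x" unfolding su(2) using r u' x(1) x' by simp
  have "cong ((s \<cdot> a) \<cdot> y) ((s' \<cdot> a') \<cdot> y)"
    by (rule cong_Comp_right[OF c]) (use yA y sa in simp_all)
  then have "cong (s' \<cdot> (u' \<cdot> x)) ((s' \<cdot> a') \<cdot> y)" unfolding sux xy .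
  then have "cong (s' \<cdot> (u' \<cdot> x)) (s' \<cdot> (a' \<cdot> y))" using r a' yA y' by simp
  then have 2: "cong (u' \<cdot> x) (a' \<cdot> y)"
    by (rule cong_mono_mod_cancel[OF _ _ _ _ _ W_mono_mod, rotated 6]) (use r u' x(1,2) x' a' yA y' in simp_all)
  have "cong (f \<cdot> (u \<cdot> x)) (f \<cdot> (a \<cdot> y))"
    by (rule cong_Comp_left[OF 1]) (use r u x(1) x' in simp_all)
  moreover have "cong (f' \<cdot> (u' \<cdot> x)) (f' \<cdot> (a' \<cdot> y))"
    by (rule cong_Comp_left[OF 2]) (use r u' x(1) x' in simp_all)
  moreover have "f \<cdot> (u \<cdot> x) = f' \<cdot> (u' \<cdot> x)"
    by (rule Comp_eq_extend[OF fu]) (use r u u' x(1) x' in simp_all)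
  ultimately have "cong (f \<cdot> (a \<cdot> y)) (f' \<cdot> (a' \<cdot> y))" using cong_sym cong_trans by metis
  then have "cong ((f \<cdot> a) \<cdot> y) ((f' \<cdot> a') \<cdot> y)" using r a a' yA y' by simp
  then show ?thesis
    by (rule cong_if_equalized[OF _ _ _ _ W_epi_mod[OF y(1)], rotated 5]) (use r XY a a' aa y' in simp_all)
qed

lemma roof_equivD_roof:
  assumes "((s, f), (s', f')) \<in> roof_equiv A \<B> X Y"
  shows "roof s f" "roof s' f'" "Cod A s = X" "Cod A s' = X" "Cod A f = Y" "Cod A f' = Y"
  using assms by (simp_all add: roof_equiv_iff)

lemma equiv_roof_equiv: "equiv (roofs A \<B> X Y) (roof_equiv A \<B> X Y)"
proof (rule equivI)
  show "roof_equiv A \<B> X Y \<subseteq> roofs A \<B> X Y \<times> roofs A \<B> X Y" by (auto simp: roof_equiv_def)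
  show "refl_on (roofs A \<B> X Y) (roof_equiv A \<B> X Y)"
  proof (rule refl_onI)
    fix x assume x: "x \<in> roofs A \<B> X Y"
    obtain s f where sf: "x = (s, f)" by (cases x)
    have r: "roof s f" "Cod A s = X" "Cod A f = Y" using x by (simp_all add: sf in_roofs)
    show "(x, x) \<in> roof_equiv A \<B> X Y"
      using roof_equivI[OF r(1) r(1), of "Id A (Dom A f)" "Id A (Dom A f)"] r by (simp add: sf cong_refl)
  qed
  show "sym (roof_equiv A \<B> X Y)"
  proof (rule symI)
    fix x y assume xy: "(x, y) \<in> roof_equiv A \<B> X Y"
    obtain s f s' f' where e: "x = (s, f)" "y = (s', f')" by (cases x, cases y)
    from xy show "(y, x) \<in> roof_equiv A \<B> X Y" unfolding e roof_equiv_iff by metis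
  qed
  show "trans (roof_equiv A \<B> X Y)"
  proof (rule transI)
    fix x y z assume xy: "(x, y) \<in> roof_equiv A \<B> X Y" "(y, z) \<in> roof_equiv A \<B> X Y"
    obtain s f s' f' s2 f2 where e: "x = (s, f)" "y = (s', f')" "z = (s2, f2)" by (cases x, cases y, cases z)
    note r1 = roof_equivD_roof[OF xy(1)[unfolded e]] and r2 = roof_equivD_roof[OF xy(2)[unfolded e]]
    \<comment> \<open>Two Ore squares refine all three left legs simultaneously. Since
      \<open>roof_equivD\<close> holds over every such refinement, the witnesses of the two given
      equivalences need not be combined.\<close>
    obtain b a where b: "b \<in> W" "Cod A b = Dom A s'" and a: "a \<in> Arr A" "Dom A a = Dom A b"
      "Cod A a = Dom A s" and ab: "s \<cdot> a = s' \<cdot> b"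
      by (rule ore[of s s']) (use r1 in auto)
    have sb: "s' \<cdot> b \<in> W" "Cod A (s' \<cdot> b) = X" "Dom A (s' \<cdot> b) = Dom A b" using r1 b by simp_all
    obtain d c where d: "d \<in> W" "Cod A d = Dom A (s' \<cdot> b)" and c: "c \<in> Arr A" "Dom A c = Dom A d"
      "Cod A c = Dom A s2" and cd: "s2 \<cdot> c = (s' \<cdot> b) \<cdot> d"
      by (rule ore[of s2 "s' \<cdot> b"]) (use r2 sb in auto)
    have bd: "s' \<cdot> (b \<cdot> d) = (s' \<cdot> b) \<cdot> d"
      by (rule Comp_assoc_Arr[symmetric]) (use r1 b d sb in simp_all)
    have ad: "s \<cdot> (a \<cdot> d) = (s' \<cdot> b) \<cdot> d" unfolding ab[symmetric]
      by (rule Comp_assoc_Arr[symmetric]) (use r1 a b d sb in simp_all)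
    have bdW: "(s' \<cdot> b) \<cdot> d \<in> W" by (rule W_Comp) (use sb d in simp_all)
    note r = cong_refl[OF W_Arr[OF bdW]]
    have "cong (f \<cdot> (a \<cdot> d)) (f' \<cdot> (b \<cdot> d))"
      by (rule roof_equivD[OF xy(1)[unfolded e]]) (use a b d sb r in \<open>simp_all add: bd ad del: Comp_assoc_Arr\<close>)
    moreover have "cong (f' \<cdot> (b \<cdot> d)) (f2 \<cdot> c)"
      by (rule roof_equivD[OF xy(2)[unfolded e]]) (use a b c d sb r in \<open>simp_all add: bd cd del: Comp_assoc_Arr\<close>)
    ultimately have c2: "cong (f \<cdot> (a \<cdot> d)) (f2 \<cdot> c)" by (rule cong_trans)
    have "((s, f), (s2, f2)) \<in> roof_equiv A \<B> (Cod A s) (Cod A f)"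
      by (rule roof_equivI[OF r1(1) r2(2) _ _ c(1,3) _ _ c2])
        (use a b d sb r bdW in \<open>simp_all add: ad cd del: Comp_assoc_Arr\<close>)
    then show "(x, z) \<in> roof_equiv A \<B> X Y" unfolding e using r1 by simp
  qed
qed

section \<open>Arrows of the quotient as fractions, and their composition\<close>

lemma Q_simps [simp]:
  "Obj Q = Obj A" "Dom Q (X, \<phi>, Y) = X" "Cod Q (X, \<phi>, Y) = Y"
  "Id Q X = (X, roof_equiv A \<B> X X `` {(Id A X, Id A X)}, X)"
  "(Y', \<psi>, Z) \<cdot>\<^bsub>Q\<^esub> (X, \<phi>, Y) = (X, roof_comp A \<B> X Z \<psi> \<phi>, Z)"
  "(X, \<phi>, Y) \<in> Arr Q \<longleftrightarrow> X \<in> Obj A \<and> Y \<in> Obj A \<and> \<phi> \<in> roofs A \<B> X Y // roof_equiv A \<B> X Y"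
  by (simp_all add: quotient_category_def)

lemma frac_simps [simp]:
  shows "Dom Q (frac s f) = Cod A s" "Cod Q (frac s f) = Cod A f"
    "roof s f \<Longrightarrow> frac s f \<in> Arr Q"
  by (auto simp: frac_def in_roofs intro!: quotientI)

lemma Arr_Q_cases:
  assumes "\<phi> \<in> Arr Q" obtains s f where "roof s f" "\<phi> = frac s f" "Dom Q \<phi> = Cod A s" "Cod Q \<phi> = Cod A f"
proof -
  obtain X r Y where [simp]: "\<phi> = (X, r, Y)" by (cases \<phi>)
  from assms obtain s f where "(s, f) \<in> roofs A \<B> X Y" "r = roof_equiv A \<B> X Y `` {(s, f)}"
    by (auto elim!: quotientE)
  then show ?thesis by (intro that[of s f]) (auto simp: in_roofs frac_def)
qed

lemma frac_eq_iff:
  assumes "roof s f" "roof s' f'"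
  shows "frac s f = frac s' f' \<longleftrightarrow> ((s, f), (s', f')) \<in> roof_equiv A \<B> (Cod A s) (Cod A f)"
proof
  assume e: "frac s f = frac s' f'"
  then have c: "Cod A s = Cod A s'" "Cod A f = Cod A f'" by (auto simp: frac_def)
  from e have "roof_equiv A \<B> (Cod A s) (Cod A f) `` {(s, f)} = roof_equiv A \<B> (Cod A s) (Cod A f) `` {(s', f')}"
    unfolding frac_def c by simp
  then show "((s, f), (s', f')) \<in> roof_equiv A \<B> (Cod A s) (Cod A f)"
    by (rule eq_equiv_class[OF _ equiv_roof_equiv]) (use assms c in \<open>simp add: in_roofs\<close>)
next
  assume e: "((s, f), (s', f')) \<in> roof_equiv A \<B> (Cod A s) (Cod A f)"
  from equiv_class_eq[OF equiv_roof_equiv e] roof_equivD_roof[OF e] show "frac s f = frac s' f'"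
    by (simp add: frac_def)
qed

lemma frac_eqI:
  assumes "roof s f" "roof s' f'" "a \<in> Arr A" "Cod A a = Dom A s" "a' \<in> Arr A" "Cod A a' = Dom A s'"
    "s \<cdot> a \<in> W" "cong (s \<cdot> a) (s' \<cdot> a')" "cong (f \<cdot> a) (f' \<cdot> a')"
  shows "frac s f = frac s' f'"
  using roof_equivI[OF assms] frac_eq_iff[OF assms(1,2)] by blast

lemma frac_eqD:
  assumes "frac s f = frac s' f'" "roof s f" "roof s' f'"
    "a \<in> Arr A" "Cod A a = Dom A s" "a' \<in> Arr A" "Cod A a' = Dom A s'" "cong (s \<cdot> a) (s' \<cdot> a')"
  shows "cong (f \<cdot> a) (f' \<cdot> a')"
  using roof_equivD[OF _ assms(4-8)] frac_eq_iff[OF assms(2,3)] assms(1) by blast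

text \<open>Over a common refinement of the two composite left legs, equivalence of the first roofs
  makes \<open>f\<close> and \<open>f'\<close> agree up to congruence. The two squares turn this
  into a congruence of the left legs \<open>t\<close> and \<open>t'\<close>, which is the input that
  equivalence of the second roofs requires.\<close>

lemma roof_comp_equiv:
  assumes e1: "((s, f), (s', f')) \<in> roof_equiv A \<B> X Y" and e2: "((t, g), (t', g')) \<in> roof_equiv A \<B> Y Z"
    and u: "u \<in> W" "Cod A u = Dom A f" and h: "h \<in> Arr A" "Dom A h = Dom A u" "Cod A h = Dom A t" "f \<cdot> u = t \<cdot> h"
    and u': "u' \<in> W" "Cod A u' = Dom A f'"
    and h': "h' \<in> Arr A" "Dom A h' = Dom A u'" "Cod A h' = Dom A t'" "f' \<cdot> u' = t' \<cdot> h'"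
  shows "((s \<cdot> u, g \<cdot> h), (s' \<cdot> u', g' \<cdot> h')) \<in> roof_equiv A \<B> X Z"
proof -
  note r = roof_equivD_roof[OF e1] roof_equivD_roof[OF e2]
  have su: "s \<cdot> u \<in> W" "s' \<cdot> u' \<in> W" using r u u' by simp_all
  obtain b a where b: "b \<in> W" "Cod A b = Dom A (s' \<cdot> u')" and a: "a \<in> Arr A" "Dom A a = Dom A b"
    "Cod A a = Dom A (s \<cdot> u)" and ab: "(s \<cdot> u) \<cdot> a = (s' \<cdot> u') \<cdot> b"
    by (rule ore[of "s \<cdot> u" "s' \<cdot> u'"]) (use su r u u' in auto)
  have ca: "Cod A a = Dom A u" "Cod A b = Dom A u'" and bA: "b \<in> Arr A" using a b r u u' by simp_all
  have W1: "(s' \<cdot> u') \<cdot> b \<in> W" by (rule W_Comp) (use su b in simp_all)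
  have ab': "s \<cdot> (u \<cdot> a) = s' \<cdot> (u' \<cdot> b)" using ab r u u' a(1) ca bA by simp
  have W1': "s' \<cdot> (u' \<cdot> b) \<in> W" using W1 r u' ca bA by simp
  have "cong (f \<cdot> (u \<cdot> a)) (f' \<cdot> (u' \<cdot> b))"
    by (rule roof_equivD[OF e1]) (use r u u' a ca bA W1' in \<open>simp_all add: ab' cong_refl\<close>)
  moreover have "f \<cdot> (u \<cdot> a) = t \<cdot> (h \<cdot> a)"
    by (rule Comp_eq_extend[OF h(4)]) (use r u h a ca in simp_all)
  moreover have "f' \<cdot> (u' \<cdot> b) = t' \<cdot> (h' \<cdot> b)"
    by (rule Comp_eq_extend[OF h'(4)]) (use r u' h' bA ca in simp_all)
  ultimately have "cong (t \<cdot> (h \<cdot> a)) (t' \<cdot> (h' \<cdot> b))" by simp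
  then have c: "cong (g \<cdot> (h \<cdot> a)) (g' \<cdot> (h' \<cdot> b))"
    by (rule roof_equivD[OF e2, rotated 4]) (use h h' a bA ca in simp_all)
  have "((s \<cdot> u, g \<cdot> h), (s' \<cdot> u', g' \<cdot> h')) \<in> roof_equiv A \<B> (Cod A (s \<cdot> u)) (Cod A (g \<cdot> h))"
  proof (rule roof_equivI[of _ _ _ _ a b])
    show "(s \<cdot> u) \<cdot> a \<in> W" "cong ((s \<cdot> u) \<cdot> a) ((s' \<cdot> u') \<cdot> b)"
      unfolding ab using W1 cong_refl W_Arr by simp_all
    show "cong ((g \<cdot> h) \<cdot> a) ((g' \<cdot> h') \<cdot> b)" using c h h' r a(1) ca bA by simp
  qed (use su r u u' h(1-3) h'(1-3) a ca bA in simp_all)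
  then show ?thesis using r u h(1-3) by simp
qed

text \<open>All classes in the union defining \<open>roof_comp\<close> coincide and the supplied
  square contributes one of them, so a composite may be computed from whichever square is
  convenient.\<close>

lemma Comp_frac:
  assumes r: "roof s f" "roof t g" "Cod A f = Cod A t"
    and u: "u \<in> W" "Cod A u = Dom A f" and h: "h \<in> Arr A" "Dom A h = Dom A u" "Cod A h = Dom A t" "f \<cdot> u = t \<cdot> h"
  shows "frac t g \<cdot>\<^bsub>Q\<^esub> frac s f = frac (s \<cdot> u) (g \<cdot> h)"
proof -
  define X Y Z where "X = Cod A s" and "Y = Cod A f" and "Z = Cod A g"
  let ?S = "roof_equiv A \<B> X Y `` {(s, f)}" and ?T = "roof_equiv A \<B> Y Z `` {(t, g)}"
  let ?R = "roof_equiv A \<B> X Z `` {(s \<cdot> u, g \<cdot> h)}"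
  have sub: "roof_equiv A \<B> X Z `` {(s' \<cdot> u', g' \<cdot> h')} = ?R"
    if "(s', f') \<in> ?S" "(t', g') \<in> ?T" "u' \<in> W" "Cod A u' = Dom A f'"
      "h' \<in> Hom A (Dom A u') (Dom A t')" "f' \<cdot> u' = t' \<cdot> h'" for s' f' t' g' u' h'
  proof (rule equiv_class_eq[OF equiv_roof_equiv, symmetric], rule roof_comp_equiv[OF _ _ u h])
    show "((s, f), (s', f')) \<in> roof_equiv A \<B> X Y" "((t, g), (t', g')) \<in> roof_equiv A \<B> Y Z"
      using that by simp_all
  qed (use that in \<open>simp_all add: in_Hom\<close>)
  have "(s, f) \<in> ?S"
    by (rule equiv_class_self[OF equiv_roof_equiv]) (use r in \<open>simp add: in_roofs X_def Y_def\<close>)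
  moreover have "(t, g) \<in> ?T"
    by (rule equiv_class_self[OF equiv_roof_equiv]) (use r in \<open>simp add: in_roofs Y_def Z_def\<close>)
  moreover have "h \<in> Hom A (Dom A u) (Dom A t)" using h by (simp add: in_Hom)
  ultimately have "roof_comp A \<B> X Z ?T ?S = ?R"
    unfolding roof_comp_def using sub u h(4) by blast
  then show ?thesis using r u h(1-3) by (simp add: frac_def X_def Y_def Z_def)
qed

lemma ex_square:
  assumes "roof s f" "roof t g" "Cod A f = Cod A t"
  obtains u h where "u \<in> W" "u \<in> Arr A" "Cod A u = Dom A f" "h \<in> Arr A" "Dom A h = Dom A u" "Cod A h = Dom A t"
    "f \<cdot> u = t \<cdot> h"
proof -
  obtain u h where "u \<in> W" "Cod A u = Dom A f" "h \<in> Arr A" "Dom A h = Dom A u" "Cod A h = Dom A t"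
    "t \<cdot> h = f \<cdot> u"
    by (rule ore[of t f]) (use assms in auto)
  then show ?thesis by (intro that[of u h]) auto
qed

lemma Hom_Q_cases:
  assumes "\<phi> \<in> Hom Q X Y" obtains s f where "roof s f" "\<phi> = frac s f" "Cod A s = X" "Cod A f = Y"
proof -
  have \<phi>: "\<phi> \<in> Arr Q" "Dom Q \<phi> = X" "Cod Q \<phi> = Y" using assms by (simp_all add: Hom_def)
  from Arr_Q_cases[OF \<phi>(1)] obtain s f where "roof s f" "\<phi> = frac s f" "Dom Q \<phi> = Cod A s" "Cod Q \<phi> = Cod A f" .
  with \<phi> show ?thesis by (intro that[of s f]) simp_all
qed

lemma Id_Q: "X \<in> Obj A \<Longrightarrow> Id Q X = frac (Id A X) (Id A X)"
  by (simp add: frac_def)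

lemma Comp_frac_Arr:
  assumes "roof s f" "g \<in> Arr A" "Cod A f = Dom A g"
  shows "frac (Id A (Dom A g)) g \<cdot>\<^bsub>Q\<^esub> frac s f = frac s (g \<cdot> f)"
  using Comp_frac[of s f "Id A (Dom A g)" g "Id A (Dom A f)" f] assms by simp

section \<open>The category axioms for the quotient\<close>

lemma category_Q: "category Q"
proof
  fix \<phi> assume \<phi>: "\<phi> \<in> Arr Q"
  show "Dom Q \<phi> \<in> Obj Q" "Cod Q \<phi> \<in> Obj Q" by (rule Arr_Q_cases[OF \<phi>], simp)+
next
  fix X assume "X \<in> Obj Q"
  then show "Id Q X \<in> Hom Q X X" unfolding Hom_def by (simp add: Id_Q del: Q_simps(4))
next
  fix \<phi> \<psi> X Y Z assume "\<phi> \<in> Hom Q X Y" "\<psi> \<in> Hom Q Y Z"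
  then obtain s f t g where r: "roof s f" "\<phi> = frac s f" "Cod A s = X" "Cod A f = Y"
    "roof t g" "\<psi> = frac t g" "Cod A t = Y" "Cod A g = Z" by (metis Hom_Q_cases)
  obtain u h where u: "u \<in> W" "u \<in> Arr A" "Cod A u = Dom A f" "h \<in> Arr A" "Dom A h = Dom A u" "Cod A h = Dom A t"
    "f \<cdot> u = t \<cdot> h" by (rule ex_square[OF r(1,5)]) (use r in simp)
  have "\<psi> \<cdot>\<^bsub>Q\<^esub> \<phi> = frac (s \<cdot> u) (g \<cdot> h)" unfolding r(2,6)
    by (rule Comp_frac) (use r u in simp_all)
  moreover have "roof (s \<cdot> u) (g \<cdot> h)" "Cod A (s \<cdot> u) = X" "Cod A (g \<cdot> h) = Z" using r u by simp_all
  ultimately show "\<psi> \<cdot>\<^bsub>Q\<^esub> \<phi> \<in> Hom Q X Z" unfolding Hom_def by simp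
next
  fix \<phi> X Y assume "\<phi> \<in> Hom Q X Y"
  then obtain s f where r: "roof s f" "\<phi> = frac s f" "Cod A s = X" "Cod A f = Y" by (rule Hom_Q_cases)
  have X: "X \<in> Obj A" "Y \<in> Obj A" using r by auto
  have "frac s f \<cdot>\<^bsub>Q\<^esub> frac (Id A X) (Id A X) = frac (Id A X \<cdot> s) (f \<cdot> Id A (Dom A f))"
    by (rule Comp_frac) (use r X in simp_all)
  then show "\<phi> \<cdot>\<^bsub>Q\<^esub> Id Q X = \<phi>" using r X by (simp add: Id_Q del: Q_simps(4))
  show "Id Q Y \<cdot>\<^bsub>Q\<^esub> \<phi> = \<phi>" using r X Comp_frac_Arr[OF r(1), of "Id A Y"]
    by (simp add: Id_Q del: Q_simps(4))
next
  fix \<phi> \<psi> \<chi> X Y Z V assume "\<phi> \<in> Hom Q V X" "\<psi> \<in> Hom Q X Y" "\<chi> \<in> Hom Q Y Z"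
  then obtain s f t g r k where r: "roof s f" "\<phi> = frac s f" "Cod A s = V" "Cod A f = X"
    "roof t g" "\<psi> = frac t g" "Cod A t = X" "Cod A g = Y"
    "roof r k" "\<chi> = frac r k" "Cod A r = Y" "Cod A k = Z" by (metis Hom_Q_cases)
  \<comment> \<open>The same pair of squares serves both bracketings: \<open>n\<close> is chosen
    against the composite leg \<open>t \<cdot> w\<close>, so each triple composite is represented by
    the left leg \<open>s \<cdot> u\<close> and the right leg
    \<open>k \<cdot> (m \<cdot> n)\<close>. For the second bracketing the outer square then has an
    identity as its leg.\<close>
  obtain w m where w: "w \<in> W" "w \<in> Arr A" "Cod A w = Dom A g" and m: "m \<in> Arr A" "Dom A m = Dom A w" "Cod A m = Dom A r"
    and wm: "g \<cdot> w = r \<cdot> m" by (rule ex_square[OF r(5,9)]) (use r in simp)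
  have twW: "t \<cdot> w \<in> W" using r w by simp
  obtain u n where u: "u \<in> W" "u \<in> Arr A" "Cod A u = Dom A f" and n: "n \<in> Arr A" "Dom A n = Dom A u"
    "Cod A n = Dom A (t \<cdot> w)" and un: "f \<cdot> u = (t \<cdot> w) \<cdot> n"
    by (rule ex_square[of s f "t \<cdot> w" "k \<cdot> m"]) (use r twW w m in simp_all)
  have n': "Cod A n = Dom A w" using n r w by simp
  have un': "f \<cdot> u = t \<cdot> (w \<cdot> n)" using un r w n(1) n' by simp
  have "frac r k \<cdot>\<^bsub>Q\<^esub> frac t g = frac (t \<cdot> w) (k \<cdot> m)"
    by (rule Comp_frac) (use r w m wm in simp_all)
  moreover have "frac (t \<cdot> w) (k \<cdot> m) \<cdot>\<^bsub>Q\<^esub> frac s f = frac (s \<cdot> u) ((k \<cdot> m) \<cdot> n)"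
    by (rule Comp_frac) (use r twW w m u n un in simp_all)
  moreover have "frac t g \<cdot>\<^bsub>Q\<^esub> frac s f = frac (s \<cdot> u) (g \<cdot> (w \<cdot> n))"
    by (rule Comp_frac) (use r w u n(1,2) n' un' in simp_all)
  moreover have "frac r k \<cdot>\<^bsub>Q\<^esub> frac (s \<cdot> u) (g \<cdot> (w \<cdot> n)) = frac ((s \<cdot> u) \<cdot> Id A (Dom A u)) (k \<cdot> (m \<cdot> n))"
  proof (rule Comp_frac)
    show "(g \<cdot> (w \<cdot> n)) \<cdot> Id A (Dom A u) = r \<cdot> (m \<cdot> n)"
      using Comp_eq_extend[OF wm, of n] r w m n(1,2) n' by simp
  qed (use r w m u n(1,2) n' in simp_all)
  ultimately show "(\<chi> \<cdot>\<^bsub>Q\<^esub> \<psi>) \<cdot>\<^bsub>Q\<^esub> \<phi> = \<chi> \<cdot>\<^bsub>Q\<^esub> (\<psi> \<cdot>\<^bsub>Q\<^esub> \<phi>)"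
    using r w m u n(1,2) n' by simp
qed

section \<open>Zero arrows and zero objects of the quotient\<close>

lemma frac_zer_iff:
  assumes r: "roof s f" and XY: "Cod A s = X" "Cod A f = Y"
  shows "frac s f = frac (Id A X) (zer X Y) \<longleftrightarrow> negl f"
proof -
  have O: "X \<in> Obj A" "Y \<in> Obj A" using assms by auto
  have z: "zer X Y \<cdot> s = zer (Dom A f) (Cod A f)" using assms O by simp
  have "negl f" if "frac s f = frac (Id A X) (zer X Y)"
  proof -
    have "cong (f \<cdot> Id A (Dom A f)) (zer X Y \<cdot> s)"
      by (rule frac_eqD[OF that r]) (use assms O in \<open>auto simp: cong_refl\<close>)
    then show ?thesis using z r cong_zer_iff[of f] by simp
  qed
  moreover have "frac s f = frac (Id A X) (zer X Y)" if "negl f"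
  proof (rule frac_eqI[OF r, of _ _ "Id A (Dom A f)" s])
    show "cong (f \<cdot> Id A (Dom A f)) (zer X Y \<cdot> s)" using that z r cong_zer_iff[of f] by simp
  qed (use assms O in \<open>auto simp: cong_refl\<close>)
  ultimately show ?thesis by blast
qed

lemma zero_object_Q: assumes "zero_object A Z" shows "zero_object Q Z"
  unfolding zero_object_def
proof (intro conjI ballI)
  have Z: "Z \<in> Obj A" using assms by (simp add: zero_object_def)
  then show "Z \<in> Obj Q" by simp
  fix X assume "X \<in> Obj Q"
  then have X: "X \<in> Obj A" by simp
  show "\<exists>!\<phi>. \<phi> \<in> Hom Q X Z"
  proof (rule ex1I[of _ "frac (Id A X) (zer X Z)"])
    show "frac (Id A X) (zer X Z) \<in> Hom Q X Z" using X Z by (simp add: Hom_def)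
    fix \<phi> assume "\<phi> \<in> Hom Q X Z"
    then obtain s f where r: "roof s f" "\<phi> = frac s f" "Cod A s = X" "Cod A f = Z" by (rule Hom_Q_cases)
    then have "negl f" using zero_object_Hom(1)[OF assms, of f] Z by (metis negl_zer Obj_Dom_Cod(1))
    then show "\<phi> = frac (Id A X) (zer X Z)" using frac_zer_iff r by blast
  qed
  show "\<exists>!\<phi>. \<phi> \<in> Hom Q Z X"
  proof (rule ex1I[of _ "frac (Id A Z) (zer Z X)"])
    show "frac (Id A Z) (zer Z X) \<in> Hom Q Z X" using X Z by (simp add: Hom_def)
    fix \<phi> assume "\<phi> \<in> Hom Q Z X"
    then obtain s f where r: "roof s f" "\<phi> = frac s f" "Cod A s = Z" "Cod A f = X" by (rule Hom_Q_cases)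
    \<comment> \<open>The leg \<open>s\<close> ends in a zero object, so it is zero. Being
      cancellable modulo \<open>\<B>\<close>, it forces the identity of its domain to be negligible,
      and with it every arrow out of that domain.\<close>
    have "negl s" using zero_object_Hom(1)[OF assms, of s] Z r by (metis W_Arr negl_zer Obj_Dom_Cod(1))
    then have "negl (Id A (Dom A f))" using r W_mono_mod[of s] unfolding mono_mod_def by simp
    then have "negl f" using negl_Comp_left[of "Id A (Dom A f)" f] r by simp
    then show "\<phi> = frac (Id A Z) (zer Z X)" using frac_zer_iff r by blast
  qed
qed

text \<open>The zero object in \<open>zero_arr Q\<close> ranges over the quotient and need not be
  zero in \<open>A\<close>. Uniqueness of arrows into it identifies the first factor with a zero
  fraction; for the converse a zero object of \<open>A\<close> is used.\<close>

lemma zero_arr_frac_iff: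
  assumes r: "roof s f" shows "zero_arr Q (frac s f) \<longleftrightarrow> negl f"
proof -
  define X Y where "X = Cod A s" and "Y = Cod A f"
  have O: "X \<in> Obj A" "Y \<in> Obj A" using r by (auto simp: X_def Y_def)
  have z: "frac s f = frac (Id A X) (zer X Y) \<longleftrightarrow> negl f"
    by (rule frac_zer_iff[OF r]) (simp_all add: X_def Y_def)
  have c: "frac t h \<cdot>\<^bsub>Q\<^esub> frac (Id A X) (zer X Z) = frac (Id A X) (zer X (Cod A h))"
    if "roof t h" "Cod A t = Z" for t h Z
  proof -
    have Z: "Z \<in> Obj A" using that by auto
    have "frac t h \<cdot>\<^bsub>Q\<^esub> frac (Id A X) (zer X Z) = frac (Id A X \<cdot> Id A X) (h \<cdot> zer X (Dom A h))"
      by (rule Comp_frac) (use O Z that in simp_all)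
    then show ?thesis using O that by simp
  qed
  obtain Z where Z: "zero_object A Z" using ex_zero_object by blast
  then have ZO: "Z \<in> Obj A" by (simp add: zero_object_def)
  have "negl f" if zero: "zero_arr Q (frac s f)"
  proof -
    obtain V g h where V: "zero_object Q V" "g \<in> Hom Q X V" "h \<in> Hom Q V Y" "frac s f = h \<cdot>\<^bsub>Q\<^esub> g"
      using zero unfolding zero_arr_def by (auto simp: X_def Y_def)
    then have VO: "V \<in> Obj A" by (simp add: zero_object_def)
    have "frac (Id A X) (zer X V) \<in> Hom Q X V" using O VO by (simp add: Hom_def)
    moreover have "\<exists>!g. g \<in> Hom Q X V" using V(1) O unfolding zero_object_def by simp
    ultimately have g: "g = frac (Id A X) (zer X V)" using V(2) by blast
    obtain t k where t: "roof t k" "h = frac t k" "Cod A t = V" "Cod A k = Y" by (rule Hom_Q_cases[OF V(3)])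
    show ?thesis using c[OF t(1,3)] V(4) z t(4) unfolding g t(2) by simp
  qed
  moreover have "zero_arr Q (frac s f)" if "negl f"
  proof -
    have "frac s f = frac (Id A Z) (zer Z Y) \<cdot>\<^bsub>Q\<^esub> frac (Id A X) (zer X Z)"
      using c[of "Id A Z" "zer Z Y" Z] z that O ZO by simp
    moreover have "frac (Id A Z) (zer Z Y) \<in> Hom Q Z Y" "frac (Id A X) (zer X Z) \<in> Hom Q X Z"
      using O ZO by (simp_all add: Hom_def)
    moreover have "frac s f \<in> Arr Q" "Dom Q (frac s f) = X" "Cod Q (frac s f) = Y"
      using r by (simp_all add: X_def Y_def)
    ultimately show ?thesis using zero_object_Q[OF Z] unfolding zero_arr_def by metis
  qed
  ultimately show ?thesis by blast
qed

section \<open>Exactness of the quotient functor\<close>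

text \<open>On arrows of \<open>A\<close> this is the arrow part of \<open>quotient_functor\<close>,
  written as a fraction so that \<open>Comp_frac\<close> applies.\<close>

definition q_arr where "q_arr f = frac (Id A (Dom A f)) f"

lemma q_arr_simps [simp]:
  assumes "f \<in> Arr A"
  shows "q_arr f \<in> Arr Q" "Dom Q (q_arr f) = Dom A f" "Cod Q (q_arr f) = Cod A f"
  using assms by (simp_all add: q_arr_def)

lemma q_arr_Comp_frac:
  "roof s f \<Longrightarrow> g \<in> Arr A \<Longrightarrow> Cod A f = Dom A g \<Longrightarrow> q_arr g \<cdot>\<^bsub>Q\<^esub> frac s f = frac s (g \<cdot> f)"
  unfolding q_arr_def by (rule Comp_frac_Arr)

lemma frac_Comp_q_arr:
  assumes "roof s f" "g \<in> Arr A" "Cod A g = Cod A s"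
    "u \<in> W" "Cod A u = Dom A g" "h \<in> Arr A" "Dom A h = Dom A u" "Cod A h = Dom A s" "g \<cdot> u = s \<cdot> h"
  shows "frac s f \<cdot>\<^bsub>Q\<^esub> q_arr g = frac u (f \<cdot> h)"
  using Comp_frac[of "Id A (Dom A g)" g s f u h] assms unfolding q_arr_def by simp

text \<open>If \<open>frac s f\<close> is killed, then \<open>p \<cdot> f\<close> is negligible and
  becomes zero after some \<open>e\<close> in \<open>W\<close>. The kernel in \<open>A\<close> then
  factors \<open>f \<cdot> e\<close> as \<open>i \<cdot> v\<close>, and the fraction of
  \<open>v\<close> over \<open>s \<cdot> e\<close> is the required factor.\<close>

lemma is_kernel_q_arr:
  assumes "is_kernel A p i" shows "is_kernel Q (q_arr p) (q_arr i)"
proof -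
  note k = is_kernelD[OF assms] and mono = kernel_monic[OF assms]
  have pi: "q_arr p \<cdot>\<^bsub>Q\<^esub> q_arr i = frac (Id A (Dom A i)) (zer (Dom A i) (Cod A p))"
    using q_arr_Comp_frac[of "Id A (Dom A i)" i p] k by (simp add: q_arr_def)
  show ?thesis
    unfolding is_kernel_def
  proof (intro conjI ballI impI)
    show "q_arr p \<in> Arr Q" "q_arr i \<in> Arr Q" "Cod Q (q_arr i) = Dom Q (q_arr p)" using k by simp_all
    show "zero_arr Q (q_arr p \<cdot>\<^bsub>Q\<^esub> q_arr i)" unfolding pi using k by (subst zero_arr_frac_iff) auto
    fix \<phi> assume \<phi>: "\<phi> \<in> Arr Q" "Cod Q \<phi> = Dom Q (q_arr p) \<and> zero_arr Q (q_arr p \<cdot>\<^bsub>Q\<^esub> \<phi>)"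
    obtain s f where r: "roof s f" "\<phi> = frac s f" "Cod A f = Dom A p" "Dom Q \<phi> = Cod A s"
      using Arr_Q_cases[OF \<phi>(1)] \<phi>(2) k by (metis q_arr_simps(2))
    have "negl (p \<cdot> f)" using \<phi>(2) r k q_arr_Comp_frac[of s f p] zero_arr_frac_iff[of s "p \<cdot> f"] by simp
    then have "cong (p \<cdot> f) (zer (Dom A f) (Cod A p))" using cong_zer_iff[of "p \<cdot> f"] r k by simp
    then obtain e where e: "e \<in> W" "Cod A e = Dom A (p \<cdot> f)" "(p \<cdot> f) \<cdot> e = zer (Dom A f) (Cod A p) \<cdot> e"
      by (rule cong_equalizer)
    have e': "Cod A e = Dom A f" "e \<in> Arr A" using e r k by simp_all
    have "p \<cdot> (f \<cdot> e) = zer (Dom A (f \<cdot> e)) (Cod A p)" using e(3) e' r k by simp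
    then obtain v where v: "v \<in> Arr A" "Dom A v = Dom A e" "Cod A v = Dom A i" "i \<cdot> v = f \<cdot> e"
      using kernel_factor[OF assms, of "f \<cdot> e"] e' r by auto
    have se: "s \<cdot> e \<in> W" using e e' r by simp
    have rv: "roof (s \<cdot> e) v" using se v r e' by simp
    have "q_arr i \<cdot>\<^bsub>Q\<^esub> frac (s \<cdot> e) v = frac (s \<cdot> e) (f \<cdot> e)"
      using q_arr_Comp_frac[OF rv, of i] v k by simp
    also have "\<dots> = frac s f"
    proof (rule frac_eqI[of _ _ _ _ "Id A (Dom A e)" e])
      show "cong ((s \<cdot> e) \<cdot> Id A (Dom A e)) (s \<cdot> e)" "cong ((f \<cdot> e) \<cdot> Id A (Dom A e)) (f \<cdot> e)"
        using r e' by (simp_all add: cong_refl)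
    qed (use se r e' in simp_all)
    finally have ex: "q_arr i \<cdot>\<^bsub>Q\<^esub> frac (s \<cdot> e) v = \<phi>" using r by simp
    show "\<exists>!\<psi>. \<psi> \<in> Hom Q (Dom Q \<phi>) (Dom Q (q_arr i)) \<and> q_arr i \<cdot>\<^bsub>Q\<^esub> \<psi> = \<phi>"
    proof (rule ex1I[of _ "frac (s \<cdot> e) v"])
      show "frac (s \<cdot> e) v \<in> Hom Q (Dom Q \<phi>) (Dom Q (q_arr i)) \<and> q_arr i \<cdot>\<^bsub>Q\<^esub> frac (s \<cdot> e) v = \<phi>"
        using ex rv r v k e' by (simp add: Hom_def)
      fix \<psi> assume \<psi>: "\<psi> \<in> Hom Q (Dom Q \<phi>) (Dom Q (q_arr i)) \<and> q_arr i \<cdot>\<^bsub>Q\<^esub> \<psi> = \<phi>"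
      then obtain t g where t: "roof t g" "\<psi> = frac t g" "Cod A t = Cod A s" "Cod A g = Dom A i"
        using Hom_Q_cases k r by (metis q_arr_simps(2))
      have ig: "frac t (i \<cdot> g) = frac (s \<cdot> e) (i \<cdot> v)"
        using \<psi> ex q_arr_Comp_frac[OF rv, of i] q_arr_Comp_frac[OF t(1), of i] t v k by simp
      \<comment> \<open>Uniqueness is tested over a common refinement of the two left legs;
        \<open>i\<close>, monic in \<open>A\<close>, is cancellable modulo \<open>\<B>\<close> as
        well.\<close>
      obtain a b where b: "b \<in> W" "Cod A b = Dom A (s \<cdot> e)" and a: "a \<in> Arr A" "Dom A a = Dom A b"
        "Cod A a = Dom A t" and ab: "t \<cdot> a = (s \<cdot> e) \<cdot> b"
        by (rule ore[of t "s \<cdot> e"]) (use t se e' r in auto)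
      have b': "b \<in> Arr A" "Cod A b = Dom A v" using b rv by simp_all
      have sebW: "(s \<cdot> e) \<cdot> b \<in> W" by (rule W_Comp) (use b se in simp_all)
      then have sebc: "cong (t \<cdot> a) ((s \<cdot> e) \<cdot> b)" unfolding ab by (simp add: cong_refl)
      have "cong ((i \<cdot> g) \<cdot> a) ((i \<cdot> v) \<cdot> b)"
        by (rule frac_eqD[OF ig _ _ _ _ _ _ sebc]) (use t k rv v(1-3) a b b' in simp_all)
      then have "cong (i \<cdot> (g \<cdot> a)) (i \<cdot> (v \<cdot> b))" using t k v(1-3) a b' by simp
      then have "cong (g \<cdot> a) (v \<cdot> b)"
        by (rule cong_mono_mod_cancel[OF _ _ _ _ _ mono_mod_monic[OF mono], rotated 5])
          (use t k v(1-3) a b' in simp_all)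
      then show "\<psi> = frac (s \<cdot> e) v" unfolding t(2)
        by (rule frac_eqI[OF t(1) rv _ _ _ _ _ sebc, rotated 5]) (use t a b b' sebW in \<open>simp_all add: ab\<close>)
    qed
  qed
qed

text \<open>The hypothesis on \<open>p\<close> is only modulo \<open>\<B>\<close>, as required for a
  composite with an embedding whose cokernel lies in \<open>\<B>\<close>. The factor cannot be read
  off from a cokernel of \<open>i\<close> in \<open>A\<close>: the arrow to be factored starts with
  an inverted \<open>s\<close>, so the cokernel is formed at the domain of \<open>s\<close>.\<close>

lemma is_cokernel_q_arr:
  assumes ker: "is_kernel A p i" and p: "epi_mod A \<B> p"
  shows "is_cokernel Q (q_arr i) (q_arr p)"
proof -
  note k = is_kernelD[OF ker] and mono = kernel_monic[OF ker]
  have pi: "q_arr p \<cdot>\<^bsub>Q\<^esub> q_arr i = frac (Id A (Dom A i)) (zer (Dom A i) (Cod A p))"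
    using q_arr_Comp_frac[of "Id A (Dom A i)" i p] k by (simp add: q_arr_def)
  \<comment> \<open>The factor is \<open>frac m h\<close>. The kernel of \<open>p \<cdot> s\<close>
    is the preimage of the kernel of \<open>p\<close> along \<open>s\<close>; there \<open>g\<close>
    vanishes only up to a negligible arrow, so it is cut down by \<open>e\<close> until
    \<open>g\<close> vanishes exactly. Both \<open>g\<close> and \<open>p \<cdot> s\<close> then
    factor through the cokernel \<open>c'\<close>, as \<open>h\<close> and as
    \<open>m\<close>.\<close>
  have factor: "\<exists>\<psi> \<in> Hom Q (Cod A p) (Cod A g). \<psi> \<cdot>\<^bsub>Q\<^esub> q_arr p = frac s g"
    if r: "roof s g" and c: "Cod A s = Cod A i" and z: "zero_arr Q (frac s g \<cdot>\<^bsub>Q\<^esub> q_arr i)" for s g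
  proof -
    have sA: "s \<in> Arr A" and ps: "p \<cdot> s \<in> Arr A" "Dom A (p \<cdot> s) = Dom A s" "Cod A (p \<cdot> s) = Cod A p"
      using r c k by simp_all
    obtain \<kappa> where \<kappa>: "is_kernel A (p \<cdot> s) \<kappa>" using ex_kernel[OF ps(1)] ..
    note \<kappa>' = is_kernelD[OF \<kappa>]
    have "p \<cdot> (s \<cdot> \<kappa>) = zer (Dom A (s \<cdot> \<kappa>)) (Cod A p)" using \<kappa>' sA c k ps by simp
    then obtain t where t: "t \<in> Arr A" "Dom A t = Dom A \<kappa>" "Cod A t = Dom A i" "i \<cdot> t = s \<cdot> \<kappa>"
      using kernel_factor[OF ker, of "s \<cdot> \<kappa>"] \<kappa>' sA c k ps by auto
    \<comment> \<open>\<open>t\<close> is the restriction of \<open>s\<close> to kernels. It is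
      monic modulo \<open>\<B>\<close> through \<open>i \<cdot> t = s \<cdot> \<kappa>\<close>, and
      epic modulo \<open>\<B>\<close> because an Ore square produces \<open>u\<close> in
      \<open>W\<close> that factors through it.\<close>
    have tW: "t \<in> W"
    proof -
      have "mono_mod A \<B> (s \<cdot> \<kappa>)"
        by (rule mono_mod_Comp[OF mono_mod_monic[OF kernel_monic[OF \<kappa>]] W_mono_mod]) (use r \<kappa>' ps in simp_all)
      then have "mono_mod A \<B> t"
        by (intro mono_mod_Comp_right[of i t]) (use t(1-3) k in \<open>simp_all add: t(4)\<close>)
      moreover have "epi_mod A \<B> t"
      proof -
        obtain u h where u: "u \<in> W" "Cod A u = Dom A i" and h: "h \<in> Arr A" "Dom A h = Dom A u"
          "Cod A h = Dom A s" "s \<cdot> h = i \<cdot> u"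
          by (rule ore[of s i]) (use r c k in auto)
        have "(p \<cdot> s) \<cdot> h = p \<cdot> (i \<cdot> u)" unfolding h(4)[symmetric]
          by (rule Comp_assoc_Arr) (use h(1-3) sA c k in simp_all)
        also have "\<dots> = (p \<cdot> i) \<cdot> u" by (rule Comp_assoc_Arr[symmetric]) (use u k in simp_all)
        also have "\<dots> = zer (Dom A h) (Cod A (p \<cdot> s))" unfolding k(4) using u h k ps by simp
        finally have "(p \<cdot> s) \<cdot> h = zer (Dom A h) (Cod A (p \<cdot> s))" .
        from kernel_factor[OF \<kappa> h(1) _ this] obtain v where v: "v \<in> Arr A" "Dom A v = Dom A h"
          "Cod A v = Dom A \<kappa>" "\<kappa> \<cdot> v = h" using h(3) ps by metis
        have "i \<cdot> (t \<cdot> v) = s \<cdot> (\<kappa> \<cdot> v)"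
          by (rule Comp_eq_extend[OF t(4)]) (use t(1-3) v(1-3) k \<kappa>' sA ps in simp_all)
        then have "i \<cdot> (t \<cdot> v) = i \<cdot> u" using v(4) h(4) by simp
        then have "t \<cdot> v = u"
          by (rule monic_cancel[OF mono]) (use t(1-3) v(1-3) u h(2) k in simp_all)
        then show ?thesis using W_epi_mod[OF u(1)] t(1,2) v(1,3) by (intro epi_mod_Comp_left[of t v]) auto
      qed
      ultimately show ?thesis by (simp add: W_iff)
    qed
    have "frac s g \<cdot>\<^bsub>Q\<^esub> q_arr i = frac t (g \<cdot> \<kappa>)"
      by (rule frac_Comp_q_arr) (use r c k t tW \<kappa>' ps in simp_all)
    then have "negl (g \<cdot> \<kappa>)" using z r t \<kappa>' tW ps zero_arr_frac_iff[of t "g \<cdot> \<kappa>"] by simp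
    moreover have g\<kappa>: "g \<cdot> \<kappa> \<in> Arr A" "Dom A (g \<cdot> \<kappa>) = Dom A \<kappa>" using r \<kappa>' ps by simp_all
    moreover obtain e where e: "is_kernel A (g \<cdot> \<kappa>) e" using ex_kernel[OF g\<kappa>(1)] ..
    ultimately have eW: "e \<in> W" using negl_kernel_W by blast
    note e' = is_kernelD[OF e]
    have \<kappa>e: "\<kappa> \<cdot> e \<in> Arr A" "Dom A (\<kappa> \<cdot> e) = Dom A e" "Cod A (\<kappa> \<cdot> e) = Dom A s" using e' \<kappa>' g\<kappa> ps by simp_all
    obtain c' where cc: "is_cokernel A (\<kappa> \<cdot> e) c'" using ex_cokernel[OF \<kappa>e(1)] ..
    note cc' = is_cokernelD[OF cc] cokernel_epic[OF cc]
    have "g \<cdot> (\<kappa> \<cdot> e) = zer (Dom A (\<kappa> \<cdot> e)) (Cod A g)" using e' g\<kappa> r \<kappa>' ps by simp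
    then obtain h where h: "h \<in> Arr A" "Cod A h = Cod A g" "Dom A h = Cod A c'" "h \<cdot> c' = g"
      using cokernel_factor[OF cc, of g] r \<kappa>e by auto
    have "(p \<cdot> s) \<cdot> (\<kappa> \<cdot> e) = ((p \<cdot> s) \<cdot> \<kappa>) \<cdot> e"
      by (rule Comp_assoc_Arr[symmetric]) (use e' g\<kappa> \<kappa>' ps in simp_all)
    also have "\<dots> = zer (Dom A (\<kappa> \<cdot> e)) (Cod A (p \<cdot> s))" unfolding \<kappa>'(4) using e' g\<kappa> \<kappa>' \<kappa>e ps k by simp
    finally have "(p \<cdot> s) \<cdot> (\<kappa> \<cdot> e) = zer (Dom A (\<kappa> \<cdot> e)) (Cod A (p \<cdot> s))" .
    then obtain m where m: "m \<in> Arr A" "Cod A m = Cod A p" "Dom A m = Cod A c'" "m \<cdot> c' = p \<cdot> s"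
      using cokernel_factor[OF cc ps(1)] ps \<kappa>e by metis
    have mW: "m \<in> W"
    proof -
      have "epi_mod A \<B> (p \<cdot> s)"
        by (rule epi_mod_Comp[OF W_epi_mod p]) (use r c k in simp_all)
      then have "epi_mod A \<B> m"
        by (intro epi_mod_Comp_left[of m c']) (use m(1-3) cc' in \<open>simp_all add: m(4)\<close>)
      \<comment> \<open>An arrow killed by \<open>m\<close> is lifted along the epic
        \<open>c'\<close>; the lift lies in the kernel \<open>\<kappa>\<close> of
        \<open>p \<cdot> s\<close>. On that kernel \<open>c'\<close> is negligible, since it
        vanishes after \<open>e\<close>, which is in \<open>W\<close>.\<close>
      moreover have "mono_mod A \<B> m"
      proof (rule mono_mod_if_zero[OF m(1)])
        fix x assume x: "x \<in> Arr A" "Cod A x = Dom A m" "m \<cdot> x = zer (Dom A x) (Cod A m)"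
        obtain l d where pb: "pullback A c' x l d" and d: "epic A d"
          using pullback_of_epic[OF cc'(5) x(1)] x(2) m(3) by metis
        note pd = pullbackD[OF pb]
        have "(p \<cdot> s) \<cdot> l = m \<cdot> (c' \<cdot> l)" unfolding m(4)[symmetric]
          by (rule Comp_assoc_Arr) (use pd(1-8) m(1-3) in simp_all)
        also have "\<dots> = (m \<cdot> x) \<cdot> d" unfolding pd(9)
          by (rule Comp_assoc_Arr[symmetric]) (use pd(1-8) m(1-3) x in simp_all)
        also have "\<dots> = zer (Dom A l) (Cod A (p \<cdot> s))" unfolding x(3) using pd(1-8) m(1-3) x(1,2) ps k by simp
        finally have pl: "(p \<cdot> s) \<cdot> l = zer (Dom A l) (Cod A (p \<cdot> s))" .
        have "Cod A l = Dom A (p \<cdot> s)" using pd cc' \<kappa>e ps by simp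
        from kernel_factor[OF \<kappa> pd(3) this pl] obtain y where
          y: "y \<in> Arr A" "Dom A y = Dom A l" "Cod A y = Dom A \<kappa>" "\<kappa> \<cdot> y = l" .
        have c\<kappa>: "c' \<cdot> \<kappa> \<in> Arr A" "Dom A (c' \<cdot> \<kappa>) = Dom A \<kappa>" using \<kappa>' cc' \<kappa>e ps by simp_all
        have "(c' \<cdot> \<kappa>) \<cdot> e = c' \<cdot> (\<kappa> \<cdot> e)"
          by (rule Comp_assoc_Arr) (use e' g\<kappa> \<kappa>' cc' \<kappa>e ps in simp_all)
        then have "negl ((c' \<cdot> \<kappa>) \<cdot> e)" unfolding cc'(4) using \<kappa>e cc' e'(2) by simp
        then have "negl (c' \<cdot> \<kappa>)" using W_epi_mod[OF eW] c\<kappa> e' g\<kappa> unfolding epi_mod_def by simp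
        then have "negl ((c' \<cdot> \<kappa>) \<cdot> y)" by (rule negl_Comp_right) (use y c\<kappa> in simp_all)
        moreover have "(c' \<cdot> \<kappa>) \<cdot> y = c' \<cdot> (\<kappa> \<cdot> y)"
          by (rule Comp_assoc_Arr) (use y(1-3) \<kappa>' cc' \<kappa>e ps in simp_all)
        ultimately have "negl (x \<cdot> d)" unfolding y(4) pd(9) by simp
        then show "negl x" using epi_mod_epic[OF d] pd x(1) unfolding epi_mod_def by simp
      qed
      ultimately show ?thesis by (simp add: W_iff)
    qed
    have "frac m h \<cdot>\<^bsub>Q\<^esub> q_arr p = frac s (h \<cdot> c')"
      by (rule frac_Comp_q_arr) (use r c k m mW h cc' \<kappa>e in simp_all)
    then show ?thesis using mW h m by (intro bexI[of _ "frac m h"]) (simp_all add: Hom_def)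
  qed
  \<comment> \<open>The two fractions are brought to the common left leg
    \<open>s' \<cdot> b\<close>, and an Ore square replaces \<open>p\<close> by \<open>p'\<close>,
    its counterpart over that leg. By \<open>epi_mod_Comp_right\<close> the arrow \<open>p'\<close>
    is still epic modulo \<open>\<B>\<close>, so it cancels from the right legs.\<close>
  have unique: "frac s v = frac s' v'"
    if r: "roof s v" "roof s' v'" and c: "Cod A s = Cod A p" "Cod A s' = Cod A p"
      and eq: "frac s v \<cdot>\<^bsub>Q\<^esub> q_arr p = frac s' v' \<cdot>\<^bsub>Q\<^esub> q_arr p" for s v s' v'
  proof -
    obtain b a where b: "b \<in> W" "Cod A b = Dom A s'" and a: "a \<in> Arr A" "Dom A a = Dom A b"
      "Cod A a = Dom A s" and ab: "s \<cdot> a = s' \<cdot> b"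
      by (rule ore[of s s']) (use r c in auto)
    have \<sigma>: "s' \<cdot> b \<in> W" "Dom A (s' \<cdot> b) = Dom A b" "Cod A (s' \<cdot> b) = Cod A p" using r b c by simp_all
    obtain t p' where t: "t \<in> W" "Cod A t = Dom A p" and p': "p' \<in> Arr A" "Dom A p' = Dom A t"
      "Cod A p' = Dom A (s' \<cdot> b)" and pt: "(s' \<cdot> b) \<cdot> p' = p \<cdot> t"
      by (rule ore[of "s' \<cdot> b" p]) (use \<sigma> k in auto)
    have p'': "Cod A p' = Dom A b" "Cod A p' = Dom A a" using p' \<sigma> a by simp_all
    have 1: "p \<cdot> t = s' \<cdot> (b \<cdot> p')" unfolding pt[symmetric]
      by (rule Comp_assoc_Arr) (use r b p'(1) p'' in simp_all)
    have 2: "p \<cdot> t = s \<cdot> (a \<cdot> p')" unfolding pt[symmetric] ab[symmetric]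
      by (rule Comp_assoc_Arr) (use r a p'(1) p'' in simp_all)
    have "frac s v \<cdot>\<^bsub>Q\<^esub> q_arr p = frac t (v \<cdot> (a \<cdot> p'))"
      by (rule frac_Comp_q_arr) (use r c a p'(1,2) p'' t k 2 in simp_all)
    moreover have "frac s' v' \<cdot>\<^bsub>Q\<^esub> q_arr p = frac t (v' \<cdot> (b \<cdot> p'))"
      by (rule frac_Comp_q_arr) (use r c b p'(1,2) p'' t k 1 in simp_all)
    ultimately have fr: "frac t (v \<cdot> (a \<cdot> p')) = frac t (v' \<cdot> (b \<cdot> p'))" using eq by simp
    have "cong ((v \<cdot> (a \<cdot> p')) \<cdot> Id A (Dom A t)) ((v' \<cdot> (b \<cdot> p')) \<cdot> Id A (Dom A t))"
      by (rule frac_eqD[OF fr]) (use r a b p'(1,2) p'' t in \<open>simp_all add: cong_refl\<close>)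
    then have c2: "cong ((v \<cdot> a) \<cdot> p') ((v' \<cdot> b) \<cdot> p')" using r a b p'(1,2) p'' t by simp
    have cods: "Cod A v = Cod A v'" using congD[OF c2] r a b p'(1) p'' by simp
    have "epi_mod A \<B> (p \<cdot> t)" by (rule epi_mod_Comp[OF W_epi_mod[OF t(1)] p t(2)])
    then have "epi_mod A \<B> p'" unfolding pt[symmetric]
      by (rule epi_mod_Comp_right[OF _ \<sigma>(1) p'(1,3)])
    then have c3: "cong (v \<cdot> a) (v' \<cdot> b)"
      by (rule cong_if_equalized[OF _ _ _ _ _ _ c2, rotated 4]) (use r a b p'' cods in simp_all)
    show ?thesis
      by (rule frac_eqI[OF r _ _ _ _ _ _ c3]) (use a b \<sigma> in \<open>simp_all add: ab cong_refl\<close>)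
  qed
  show ?thesis
    unfolding is_cokernel_def
  proof (intro conjI ballI impI)
    show "q_arr i \<in> Arr Q" "q_arr p \<in> Arr Q" "Dom Q (q_arr p) = Cod Q (q_arr i)" using k by simp_all
    show "zero_arr Q (q_arr p \<cdot>\<^bsub>Q\<^esub> q_arr i)" unfolding pi using k by (subst zero_arr_frac_iff) auto
    fix \<phi> assume \<phi>: "\<phi> \<in> Arr Q" "Dom Q \<phi> = Cod Q (q_arr i) \<and> zero_arr Q (\<phi> \<cdot>\<^bsub>Q\<^esub> q_arr i)"
    obtain s g where r: "roof s g" "\<phi> = frac s g" "Cod A s = Cod A i"
      using Arr_Q_cases[OF \<phi>(1)] \<phi>(2) k by (metis q_arr_simps(3))
    obtain \<psi> where \<psi>: "\<psi> \<in> Hom Q (Cod A p) (Cod A g)" "\<psi> \<cdot>\<^bsub>Q\<^esub> q_arr p = \<phi>"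
      using factor[OF r(1,3)] \<phi>(2) unfolding r(2) by blast
    show "\<exists>!\<psi>. \<psi> \<in> Hom Q (Cod Q (q_arr p)) (Cod Q \<phi>) \<and> \<psi> \<cdot>\<^bsub>Q\<^esub> q_arr p = \<phi>"
    proof (rule ex1I[of _ \<psi>])
      show "\<psi> \<in> Hom Q (Cod Q (q_arr p)) (Cod Q \<phi>) \<and> \<psi> \<cdot>\<^bsub>Q\<^esub> q_arr p = \<phi>" using \<psi> k r by simp
      fix \<chi> assume "\<chi> \<in> Hom Q (Cod Q (q_arr p)) (Cod Q \<phi>) \<and> \<chi> \<cdot>\<^bsub>Q\<^esub> q_arr p = \<phi>"
      then have \<chi>: "\<chi> \<in> Hom Q (Cod A p) (Cod A g)" "\<chi> \<cdot>\<^bsub>Q\<^esub> q_arr p = \<phi>" using k r by simp_all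
      obtain t v where t: "roof t v" "\<psi> = frac t v" "Cod A t = Cod A p" by (rule Hom_Q_cases[OF \<psi>(1)])
      obtain t' v' where t': "roof t' v'" "\<chi> = frac t' v'" "Cod A t' = Cod A p" by (rule Hom_Q_cases[OF \<chi>(1)])
      show "\<chi> = \<psi>" using unique[OF t'(1) t(1) t'(3) t(3)] \<psi>(2) \<chi>(2) unfolding t(2) t'(2) by simp
    qed
  qed
qed

section \<open>Torsion pairs in the quotient\<close>

text \<open>A singleton quotient set makes the two classes equal. The second extension lies in its
  own class through the identity, hence in the class of the first, and this membership supplies
  \<open>h\<close>.\<close>

lemma Ext1_vanishes_isomorphism:
  assumes ext: "Ext1_vanishes A X Y" and se: "short_exact A Y i E p X" "short_exact A Y i' E' p' X"
  obtains h where "h \<in> Hom A E E'" "h \<cdot> i = i'"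
proof -
  let ?r = "extension_equiv A X Y"
  have ex: "(i, E, p) \<in> extensions A X Y" "(i', E', p') \<in> extensions A X Y"
    using se by (simp_all add: extensions_def)
  then have "?r `` {(i, E, p)} \<in> Ext1 A X Y" "?r `` {(i', E', p')} \<in> Ext1 A X Y"
    unfolding Ext1_def by (auto intro: quotientI)
  then have eq: "?r `` {(i, E, p)} = ?r `` {(i', E', p')}"
    using ext unfolding Ext1_vanishes_def is_singleton_def by auto
  have a: "i' \<in> Arr A" "Cod A i' = E'" "p' \<in> Arr A" "Dom A p' = E'"
    using se(2) by (simp_all add: short_exact_def in_Hom)
  then have E': "E' \<in> Obj A" by auto
  then have "isomorphism A (Id A E')" unfolding isomorphism_def by (auto simp: in_Hom)
  then have "((i', E', p'), (i', E', p')) \<in> ?r"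
    unfolding extension_equiv_def using ex a E' by (auto simp: in_Hom intro!: bexI[of _ "Id A E'"])
  then have "((i, E, p), (i', E', p')) \<in> ?r" using eq by blast
  then show ?thesis using that unfolding extension_equiv_def by blast
qed

lemma Hom_vanishesD: "Hom_vanishes A (Dom A f) (Cod A f) \<Longrightarrow> f \<in> Arr A \<Longrightarrow> f = zer (Dom A f) (Cod A f)"
  using zero_arr_iff[of f] unfolding Hom_vanishes_def by (simp add: in_Hom)

text \<open>Vanishing of \<open>Hom\<close> on \<open>\<B>\<close> makes \<open>f\<close> factor through the image of \<open>s\<close>. Pushing out along that
  factor gives an extension by \<open>G\<close> of an object of \<open>\<B>\<close>, which splits, so the factor extends to the
  codomain of \<open>s\<close>.\<close>

lemma closed_object_Hom_zero:
  assumes G: "G \<in> closed_objects A \<B>" and r: "roof s f" "Cod A f = G"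
    and van: "Hom_vanishes A (Cod A s) G"
  shows "f = zer (Dom A f) G"
proof -
  obtain k c where k: "is_kernel A s k" "Dom A k \<in> \<B>" and c: "is_cokernel A s c" "Cod A c \<in> \<B>"
    using r unfolding quot_weq_def by blast
  note k' = is_kernelD[OF k(1)] and c' = is_cokernelD[OF c(1)] cokernel_epic[OF c(1)]
  obtain m where m: "is_kernel A c m" using ex_kernel[OF c'(2)] ..
  note m' = is_kernelD[OF m] kernel_monic[OF m]
  have cm: "is_cokernel A m c" by (rule epic_cokernel_of_kernel[OF c'(5) m])
  from image_factorization[OF c(1) m] obtain e where
    e: "epic A e" "Cod A e = Dom A m" "Dom A e = Dom A s" "m \<cdot> e = s" .
  note eA = epic_Arr[OF e(1)]
  obtain \<kappa> where \<kappa>: "is_kernel A e \<kappa>" using ex_kernel[OF eA] ..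
  note \<kappa>' = is_kernelD[OF \<kappa>]
  \<comment> \<open>The kernel of \<open>e\<close> is killed by \<open>s\<close>, so it factors
    through \<open>k\<close>, whose domain lies in \<open>\<B>\<close>. Thus \<open>f\<close> kills
    it and descends along \<open>e\<close>.\<close>
  have "s \<cdot> \<kappa> = m \<cdot> (e \<cdot> \<kappa>)" unfolding e(4)[symmetric] by (rule Comp_assoc_Arr) (use m' e(2) eA \<kappa>' in simp_all)
  also have "\<dots> = zer (Dom A \<kappa>) (Cod A s)" unfolding \<kappa>'(4) using m' c' e(2) \<kappa>' by simp
  finally have s\<kappa>: "s \<cdot> \<kappa> = zer (Dom A \<kappa>) (Cod A s)" .
  have "Cod A \<kappa> = Dom A s" using \<kappa>' e(3) by simp
  from kernel_factor[OF k(1) \<kappa>'(2) this s\<kappa>] obtain y where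
    y: "y \<in> Arr A" "Dom A y = Dom A \<kappa>" "Cod A y = Dom A k" "k \<cdot> y = \<kappa>" .
  have fk: "f \<cdot> k \<in> Arr A" "Dom A (f \<cdot> k) = Dom A k" "Cod A (f \<cdot> k) = G" using r k' by simp_all
  have "Hom_vanishes A (Dom A k) G" using G k(2) by (simp add: closed_objects_def)
  then have fk0: "f \<cdot> k = zer (Dom A k) G" using Hom_vanishesD[of "f \<cdot> k"] fk by simp
  have "f \<cdot> \<kappa> = (f \<cdot> k) \<cdot> y" unfolding y(4)[symmetric]
    by (rule Comp_assoc_Arr[symmetric]) (use r k' y(1-3) in simp_all)
  also have "\<dots> = zer (Dom A \<kappa>) (Cod A f)" unfolding fk0 using y r by auto
  finally have f\<kappa>: "f \<cdot> \<kappa> = zer (Dom A \<kappa>) (Cod A f)" .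
  have "Dom A f = Cod A \<kappa>" using r \<kappa>' e(3) by simp
  from cokernel_factor[OF epic_cokernel_of_kernel[OF e(1) \<kappa>] _ this f\<kappa>] r obtain f' where
    f': "f' \<in> Arr A" "Cod A f' = G" "Dom A f' = Dom A m" "f' \<cdot> e = f" using e(2) by metis
  \<comment> \<open>A pullback in the opposite category is the pushout of \<open>m\<close> and
    \<open>f'\<close>. The dual of stability of epics makes \<open>j\<^sub>1\<close> monic.\<close>
  obtain j\<^sub>2 j\<^sub>1 where po: "pullback (opposite A) m f' j\<^sub>2 j\<^sub>1" and j1: "monic A j\<^sub>1"
    using abelian_category.pullback_of_epic[OF abelian_category_opposite, of m f'] m' f' by auto
  note p = abelian_category.pullbackD[OF abelian_category_opposite po, simplified]
  have cmf: "c \<cdot> m = zer G (Cod A c) \<cdot> f'" using m' c' f' by auto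
  have "\<exists>q. q \<in> Arr A \<and> Dom A q = Cod A j\<^sub>2 \<and> Cod A q = Cod A c \<and> q \<cdot> j\<^sub>2 = c \<and> q \<cdot> j\<^sub>1 = zer G (Cod A c)"
  proof (rule abelian_category.pullback_factor[OF abelian_category_opposite po, of c "zer G (Cod A c)"])
    show "m \<cdot>\<^bsub>opposite A\<^esub> c = f' \<cdot>\<^bsub>opposite A\<^esub> zer G (Cod A c)" using cmf by simp
  qed (use c' m' f' in auto)
  then obtain q where q: "q \<in> Arr A" "Dom A q = Cod A j\<^sub>2" "Cod A q = Cod A c" "q \<cdot> j\<^sub>2 = c" "q \<cdot> j\<^sub>1 = zer G (Cod A c)"
    by blast
  \<comment> \<open>Pushing out does not change the cokernel object: if \<open>x\<close> kills
    \<open>j\<^sub>1\<close>, then \<open>x \<cdot> j\<^sub>2\<close> kills \<open>m\<close>, hence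
    factors through \<open>c\<close>, and the pushout property carries the factorisation over to
    \<open>x\<close>.\<close>
  have qc: "is_cokernel A j\<^sub>1 q"
  proof (rule is_cokernelI)
    show "epic A q" by (rule epic_Comp_left[of _ j\<^sub>2]) (use q(1-3) p c'(5) in \<open>simp_all add: q(4)\<close>)
    show "q \<cdot> j\<^sub>1 = zer (Dom A j\<^sub>1) (Cod A q)" using q p f' by simp
    fix x assume x: "x \<in> Arr A" "Dom A x = Cod A j\<^sub>1" "x \<cdot> j\<^sub>1 = zer (Dom A j\<^sub>1) (Cod A x)"
    have "(x \<cdot> j\<^sub>2) \<cdot> m = x \<cdot> (j\<^sub>2 \<cdot> m)" by (rule Comp_assoc_Arr) (use x(1,2) p(1-8) in simp_all)
    also have "\<dots> = (x \<cdot> j\<^sub>1) \<cdot> f'" unfolding p(9)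
      by (rule Comp_assoc_Arr[symmetric]) (use x(1,2) p(1-8) in simp_all)
    also have "\<dots> = zer (Dom A m) (Cod A (x \<cdot> j\<^sub>2))" unfolding x(3) using x(1,2) p(1-8) f' by simp
    finally have "(x \<cdot> j\<^sub>2) \<cdot> m = zer (Dom A m) (Cod A (x \<cdot> j\<^sub>2))" .
    moreover have xj: "x \<cdot> j\<^sub>2 \<in> Arr A" "Dom A (x \<cdot> j\<^sub>2) = Cod A m" "Cod A (x \<cdot> j\<^sub>2) = Cod A x"
      using x(1,2) p(1-8) by simp_all
    ultimately obtain w where w: "w \<in> Arr A" "Cod A w = Cod A x" "Dom A w = Cod A c" "w \<cdot> c = x \<cdot> j\<^sub>2"
      using cokernel_factor[OF cm xj(1,2)] by metis
    have "w \<cdot> q = x"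
    proof (rule abelian_category.pullback_cancel[OF abelian_category_opposite po])
      have "(w \<cdot> q) \<cdot> j\<^sub>2 = w \<cdot> (q \<cdot> j\<^sub>2)" "(w \<cdot> q) \<cdot> j\<^sub>1 = w \<cdot> (q \<cdot> j\<^sub>1)"
        by (rule Comp_assoc_Arr; use w(1-3) q(1-3) p(1-8) in simp)+
      moreover have "w \<cdot> zer G (Cod A c) = zer G (Cod A x)" using w(1-3) f' by auto
      moreover have "zer (Dom A j\<^sub>1) (Cod A x) = zer G (Cod A x)" using p f' by simp
      ultimately show "j\<^sub>2 \<cdot>\<^bsub>opposite A\<^esub> (w \<cdot> q) = j\<^sub>2 \<cdot>\<^bsub>opposite A\<^esub> x"
        "j\<^sub>1 \<cdot>\<^bsub>opposite A\<^esub> (w \<cdot> q) = j\<^sub>1 \<cdot>\<^bsub>opposite A\<^esub> x"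
        unfolding opposite_simps q(4,5) w(4) x(3) by simp_all
    qed (use w(1-3) q(1-3) x(1,2) p(1-8) in simp_all)
    then show "\<exists>u\<in>Hom A (Cod A q) (Cod A x). u \<cdot> q = x"
      using w q by (intro bexI[of _ w]) (simp_all add: in_Hom)
  qed (use p q in simp_all)
  have se: "short_exact A G j\<^sub>1 (Cod A j\<^sub>1) q (Cod A c)"
    using short_exact_cokernel[OF j1 qc] p f' q by simp
  have O: "G \<in> Obj A" "Cod A c \<in> Obj A" using G c' by (auto simp: closed_objects_def)
  obtain P i l \<pi> where bi: "short_exact A G i P l (Cod A c)" "\<pi> \<in> Hom A P G" "\<pi> \<cdot> i = Id A G"
    by (rule short_exact_biproduct[OF O])
  have "Ext1_vanishes A (Cod A c) G" using G c(2) by (simp add: closed_objects_def)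
  then obtain h where h: "h \<in> Hom A (Cod A j\<^sub>1) P" "h \<cdot> j\<^sub>1 = i"
    by (rule Ext1_vanishes_isomorphism[OF _ se bi(1)])
  \<comment> \<open>Comparison with the split extension yields this retraction of
    \<open>j\<^sub>1\<close>. The composite \<open>\<rho> \<cdot> j\<^sub>2\<close> extends
    \<open>f'\<close> to the codomain of \<open>s\<close>, where \<open>van\<close> forces it to be
    zero.\<close>
  define \<rho> where "\<rho> = \<pi> \<cdot> h"
  have \<rho>: "\<rho> \<in> Arr A" "Dom A \<rho> = Cod A j\<^sub>1" "Cod A \<rho> = G" using h(1) bi(2) by (simp_all add: \<rho>_def in_Hom)
  have \<rho>j: "\<rho> \<cdot> j\<^sub>1 = Id A G" unfolding \<rho>_def bi(3)[symmetric] h(2)[symmetric]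
    by (rule Comp_assoc_Arr) (use h(1) bi(2) p in \<open>simp_all add: in_Hom\<close>)
  have "\<rho> \<cdot> j\<^sub>2 \<in> Arr A" "Dom A (\<rho> \<cdot> j\<^sub>2) = Cod A s" "Cod A (\<rho> \<cdot> j\<^sub>2) = G"
    using \<rho> p(1-8) m' c' by simp_all
  then have \<rho>0: "\<rho> \<cdot> j\<^sub>2 = zer (Cod A s) G" using Hom_vanishesD[of "\<rho> \<cdot> j\<^sub>2"] van by simp
  have "f' = (\<rho> \<cdot> j\<^sub>1) \<cdot> f'" unfolding \<rho>j using f' by simp
  also have "\<dots> = \<rho> \<cdot> (j\<^sub>1 \<cdot> f')" by (rule Comp_assoc_Arr) (use \<rho> p(1-8) in simp_all)
  also have "\<dots> = (\<rho> \<cdot> j\<^sub>2) \<cdot> m" unfolding p(9)[symmetric]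
    by (rule Comp_assoc_Arr[symmetric]) (use \<rho> p(1-8) in simp_all)
  also have "\<dots> = zer (Dom A m) G" unfolding \<rho>0 using m' c' O by simp
  finally have "f' = zer (Dom A m) G" .
  then have "f = zer (Dom A m) G \<cdot> e" using f'(4) by simp
  then show ?thesis using e eA O r by simp
qed

text \<open>Both conditions are established for the objects of \<open>\<T>\<close> and
  \<open>\<G>\<close> themselves, which is meaningful because the quotient functor is the identity
  on objects. Essential images contain these objects, and vanishing of Hom is invariant under
  isomorphism.\<close>

lemma torsion_pair_Q:
  assumes tp: "torsion_pair A \<T> \<F>" and sub: "\<G> \<subseteq> \<F> \<inter> closed_objects A \<B>"
    and emb: "embedding_condition A \<B> \<F> \<G>"
  shows "torsion_pair Q (essential_image Q (quotient_functor A \<B>) \<T>)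
    (essential_image Q (quotient_functor A \<B>) \<G>)"
proof -
  interpret Q: category Q by (rule category_Q)
  have ess: "Y \<in> essential_image Q (quotient_functor A \<B>) \<H> \<longleftrightarrow> Y \<in> Obj A \<and> (\<exists>X \<in> \<H>. isomorphic Q X Y)"
    for Y \<H> by (simp add: essential_image_def quotient_functor_def)
  have van: "Hom_vanishes Q T G" if "T \<in> \<T>" "G \<in> \<G>" for T G
    unfolding Hom_vanishes_def
  proof
    fix \<phi> assume "\<phi> \<in> Hom Q T G"
    then obtain s f where r: "roof s f" "\<phi> = frac s f" "Cod A s = T" "Cod A f = G" by (rule Hom_Q_cases)
    have "Hom_vanishes A (Cod A s) G" using tp sub that r unfolding torsion_pair_def by blast
    then have "f = zer (Dom A f) G" using closed_object_Hom_zero[OF _ r(1,4)] sub that by blast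
    moreover have "negl (zer (Dom A f) G)" using r by auto
    ultimately show "zero_arr Q \<phi>" unfolding r(2) zero_arr_frac_iff[OF r(1)] by simp
  qed
  have seq: "\<exists>T \<in> \<T>. \<exists>G \<in> \<G>. \<exists>i p. short_exact Q T i X p G" if X: "X \<in> Obj A" for X
  proof -
    obtain T F i p where T: "T \<in> \<T>" "F \<in> \<F>" "short_exact A T i X p F"
      using tp X unfolding torsion_pair_def by blast
    obtain G B j r where G: "G \<in> \<G>" "B \<in> \<B>" "short_exact A F j G r B"
      using emb T(2) unfolding embedding_condition_def by blast
    have a: "i \<in> Arr A" "Dom A i = T" "Cod A i = X" "p \<in> Arr A" "Dom A p = X" "Cod A p = F"
      "j \<in> Arr A" "Dom A j = F" "Cod A j = G" "Cod A r = B"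
      and i: "is_kernel A p i" and p: "is_cokernel A i p" and j: "is_kernel A r j" and r: "is_cokernel A j r"
      using T(3) G(3) by (simp_all add: short_exact_def in_Hom)
    have ker: "is_kernel A (j \<cdot> p) i"
    proof (rule is_kernelI[OF _ kernel_monic[OF i]])
      show "(j \<cdot> p) \<cdot> i = zer (Dom A i) (Cod A (j \<cdot> p))" using a is_kernelD[OF i] by auto
      fix g assume g: "g \<in> Arr A" "Cod A g = Dom A (j \<cdot> p)" "(j \<cdot> p) \<cdot> g = zer (Dom A g) (Cod A (j \<cdot> p))"
      then have "p \<cdot> g = zer (Dom A (p \<cdot> g)) (Dom A j)"
        using a by (intro monic_Comp_zerD[OF kernel_monic[OF j]]) simp_all
      then have pg: "p \<cdot> g = zer (Dom A g) (Cod A p)" using a g by simp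
      have "Cod A g = Dom A p" using a g by simp
      from kernel_factor[OF i g(1) this pg] obtain u where
        "u \<in> Arr A" "Dom A u = Dom A g" "Cod A u = Dom A i" "i \<cdot> u = g" .
      then show "\<exists>u \<in> Hom A (Dom A g) (Dom A i). i \<cdot> u = g" by (auto simp: in_Hom)
    qed (use a in simp_all)
    have "epi_mod A \<B> j" unfolding epi_mod_iff using r G(2) a by auto
    then have "epi_mod A \<B> (j \<cdot> p)"
      using epi_mod_Comp[OF epi_mod_epic[OF cokernel_epic[OF p]]] a by simp
    then have "short_exact Q T (q_arr i) X (q_arr (j \<cdot> p)) G"
      using is_kernel_q_arr[OF ker] is_cokernel_q_arr[OF ker] a by (simp add: short_exact_def Hom_def)
    then show ?thesis using T(1) G(1) by blast
  qed
  have sub': "\<T> \<subseteq> Obj A" "\<G> \<subseteq> Obj A"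
    using tp sub unfolding torsion_pair_def full_subcategory_def by blast+
  have "\<H> \<subseteq> essential_image Q (quotient_functor A \<B>) \<H>" if "\<H> \<subseteq> Obj A" for \<H>
    unfolding subset_eq ess using that Q.isomorphic_refl by auto
  then have sub2: "\<T> \<subseteq> essential_image Q (quotient_functor A \<B>) \<T>"
    "\<G> \<subseteq> essential_image Q (quotient_functor A \<B>) \<G>" using sub' by blast+
  show ?thesis
    unfolding torsion_pair_def
  proof (intro conjI ballI)
    fix T G assume "T \<in> essential_image Q (quotient_functor A \<B>) \<T>"
      "G \<in> essential_image Q (quotient_functor A \<B>) \<G>"
    then show "Hom_vanishes Q T G" unfolding ess using van Q.Hom_vanishes_isomorphic by blast
  next
    fix X assume "X \<in> Obj Q"
    then have "X \<in> Obj A" by simp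
    from seq[OF this] show "\<exists>T \<in> essential_image Q (quotient_functor A \<B>) \<T>.
      \<exists>F \<in> essential_image Q (quotient_functor A \<B>) \<G>. \<exists>i p. short_exact Q T i X p F"
      using sub2 by blast
  qed (auto simp: full_subcategory_def essential_image_def)
qed

end

theorem proposition3p6:
  fixes A :: "('o, 'a) cat"
    and add :: "'a \<Rightarrow> 'a \<Rightarrow> 'a"
    and \<B> \<T> \<F> \<G> :: "'o set"
  defines "C \<equiv> quotient_category A \<B>"
    and "q \<equiv> quotient_functor A \<B>"
    and "\<E> \<equiv> closed_objects A \<B>"
  assumes "abelian_category A add"
    and "serre_subcategory A \<B>"
    and "torsion_pair A \<T> \<F>"
    and "full_subcategory A \<G>"
    and "\<G> \<subseteq> \<F> \<inter> \<E>"
    and "embedding_condition A \<B> \<F> \<G>"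
  shows "torsion_pair C (essential_image C q \<T>) (essential_image C q \<G>)"
proof -
  interpret serre_quotient A add \<B>
    using assms by (simp add: serre_quotient_def serre_quotient_axioms_def)
  show ?thesis unfolding C_def q_def using assms by (intro torsion_pair_Q) (simp_all add: \<E>_def)
qed

end
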